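(* Let $U$ be any associative commutative algebra over a field $K$ of characteristic $p\ge 0$, with derivation $\partial$. Then: (i) For any $k>0$, the algebra $(U,V^{0,1,\ldots,k})$ is homotopical $(k+1)$-Lie. Moreover, for any $\lambda_2,\lambda_3,\ldots\in K$ (and $\lambda_1=0$), the algebra $(U,\{0,\lambda_{i+1}V^{0,1,\ldots,i},\ i=1,2,\ldots\})$, i.e. $(U,\{\omega_1,\omega_2,\ldots\})$ with $\omega_1=0$ and $\omega_{i+1}=\lambda_{i+1}V^{0,1,\ldots,i}$ for $i=1,2,\ldots$, is homotopical Lie. (ii) The algebra $(U,V^{0,1,\ldots,k})$, $k>0$, is $k$-left commutative if and only if $k\ne 2$. (iii) The algebra $(U,V^{0,1,\ldots,k})$, $k>0$, is $(k+1)$-Lie if and only if one of the following conditions holds: $k=1$ and $p$ is any prime number or $0$; $k=2$ and $p=2$; $k=3$ and $p=3$; $k=4$ and $p=2$.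
   Context: For an associative commutative algebra $U$ with derivation $\partial$, the Wronskian $V^{0,1,\ldots,k}$ is the $(k+1)$-ary multiplication on $U$ given by $V^{0,1,\ldots,k}(u_0,\ldots,u_k)=\det\big(\partial^{i}u_j\big)_{0\le i,j\le k}$. For a vector space $A$, $C^n(A,A)=\mathrm{Hom}(\wedge^nA,A)$ is the space of skew-symmetric $n$-linear maps $A\times\cdots\times A\to A$. $\mathrm{Sym}_m$ is the group of permutations of $\{1,\ldots,m\}$, and $\mathrm{Sym}_{k,l}\subset \mathrm{Sym}_{k+l}$ is the set of shuffles: $\sigma(1)<\cdots<\sigma(k)$ and $\sigma(k+1)<\cdots<\sigma(k+l)$. Let $(A,\omega)$ be an algebra with $n$-ary multilinear multiplication $\omega$. - $(A,\omega)$ is $n$-Lie if $\omega$ is skew-symmetric and for all $a_1,\ldots,a_{n-1}\in A$ the map $D: a\mapsto\omega(a_1,\ldots,a_{n-1},a)$ is a derivation of $(A,\omega)$, i.e. $D(\omega(b_1,\ldots,b_n))=\sum_{i=1}^n\omega(b_1,\ldots,b_{i-1},D(b_i),b_{i+1},\ldots,b_n)$ for all $b_1,\ldots,b_n\in A$. - $(A,\omega)$ is $(n-1)$-left commutative if $\sum_{\sigma\in \mathrm{Sym}_{2n-2}}\mathrm{sign}(\sigma)\,\omega(a_{\sigma(1)},\ldots,a_{\sigma(n-1)},\omega(a_{\sigma(n)},\ldots,a_{\sigma(2n-2)},a_{2n-1}))=0$ for all $a_1,\ldots,a_{2n-1}\in A$. - $(A,\omega)$ is homotopical $n$-Lie if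 $\omega\in C^n(A,A)$ and $\sum_{\sigma\in \mathrm{Sym}_{n-1,n}}\mathrm{sign}(\sigma)\,\omega(a_{\sigma(1)},\ldots,a_{\sigma(n-1)},\omega(a_{\sigma(n)},\ldots,a_{\sigma(2n-1)}))=0$ for all $a_1,\ldots,a_{2n-1}\in A$. An algebra $(A,\{\omega_1,\omega_2,\ldots\})$ is homotopical Lie if $\omega_k\in C^k(A,A)$ for every $k\ge1$ and, for all $i,j\ge 1$ and all $a_1,\ldots,a_{i+j-1}\in A$, $\sum_{\sigma\in \mathrm{Sym}_{i-1,j}}\mathrm{sign}(\sigma)\,\omega_i(a_{\sigma(1)},\ldots,a_{\sigma(i-1)},\omega_j(a_{\sigma(i)},\ldots,a_{\sigma(i+j-1)}))=0$.
   Formalization: Part (ii) is corrected to "k-left commutative iff k≠1 and (k≠2 or p=2)", as the printed claim fails for k=1 (U=K[x], arguments 1,x,x) and for k=2, p=2; in (ii) and (iii) "is" means "for every U over K", since for one fixed U (e.g. ∂=0) "only if" fails. *)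

theory Defs
  imports "HOL-Algebra.Module" "HOL-Combinatorics.Permutations" "HOL-Computational_Algebra.Primes"
begin

definition has_characteristic :: "('k, 'm) ring_scheme \<Rightarrow> nat \<Rightarrow> bool" where
  "has_characteristic K p \<longleftrightarrow> (\<forall>m::nat. [m] \<cdot>\<^bsub>K\<^esub> \<one>\<^bsub>K\<^esub> = \<zero>\<^bsub>K\<^esub> \<longleftrightarrow> p dvd m)"

text \<open>
  Associative commutative algebras are not required to have a unit, so this is
  \<^locale>\<open>algebra\<close> with the ring axioms for the multiplication stated without it;
  the \<^const>\<open>one\<close> field of the record \<open>U\<close> is never used.
\<close>

locale assoc_comm_algebra = module K U for K (structure) and U (structure) +
  assumes mult_closed:
      "\<lbrakk>x \<in> carrier U; y \<in> carrier U\<rbrakk> \<Longrightarrow> x \<otimes>\<^bsub>U\<^esub> y \<in> carrier U"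
    and mult_assoc:
      "\<lbrakk>x \<in> carrier U; y \<in> carrier U; z \<in> carrier U\<rbrakk> \<Longrightarrow>
        (x \<otimes>\<^bsub>U\<^esub> y) \<otimes>\<^bsub>U\<^esub> z = x \<otimes>\<^bsub>U\<^esub> (y \<otimes>\<^bsub>U\<^esub> z)"
    and mult_comm:
      "\<lbrakk>x \<in> carrier U; y \<in> carrier U\<rbrakk> \<Longrightarrow> x \<otimes>\<^bsub>U\<^esub> y = y \<otimes>\<^bsub>U\<^esub> x"
    and mult_distr:
      "\<lbrakk>x \<in> carrier U; y \<in> carrier U; z \<in> carrier U\<rbrakk> \<Longrightarrow>
        (x \<oplus>\<^bsub>U\<^esub> y) \<otimes>\<^bsub>U\<^esub> z = x \<otimes>\<^bsub>U\<^esub> z \<oplus>\<^bsub>U\<^esub> y \<otimes>\<^bsub>U\<^esub> z"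
    and mult_smult:
      "\<lbrakk>c \<in> carrier K; x \<in> carrier U; y \<in> carrier U\<rbrakk> \<Longrightarrow>
        (c \<odot>\<^bsub>U\<^esub> x) \<otimes>\<^bsub>U\<^esub> y = c \<odot>\<^bsub>U\<^esub> (x \<otimes>\<^bsub>U\<^esub> y)"

locale differential_algebra = assoc_comm_algebra K U for K (structure) and U (structure) +
  fixes D :: "'c \<Rightarrow> 'c"
  assumes D_closed: "x \<in> carrier U \<Longrightarrow> D x \<in> carrier U"
    and D_add:
      "\<lbrakk>x \<in> carrier U; y \<in> carrier U\<rbrakk> \<Longrightarrow> D (x \<oplus>\<^bsub>U\<^esub> y) = D x \<oplus>\<^bsub>U\<^esub> D y"
    and D_smult:
      "\<lbrakk>c \<in> carrier K; x \<in> carrier U\<rbrakk> \<Longrightarrow> D (c \<odot>\<^bsub>U\<^esub> x) = c \<odot>\<^bsub>U\<^esub> D x"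
    and D_mult:
      "\<lbrakk>x \<in> carrier U; y \<in> carrier U\<rbrakk> \<Longrightarrow>
        D (x \<otimes>\<^bsub>U\<^esub> y) = D x \<otimes>\<^bsub>U\<^esub> y \<oplus>\<^bsub>U\<^esub> x \<otimes>\<^bsub>U\<^esub> D y"

text \<open>
  An \<open>n\<close>-ary operation is a function on lists, of which only the values on lists
  of length \<open>n\<close> matter.  The product \<open>f 0 \<cdots> f k\<close> of \<open>k + 1\<close> factors makes sense
  without a unit, so that the Wronskian can be given by the Leibniz formula for
  the determinant of the matrix with entry \<open>(D ^^ i) (us ! j)\<close> in row \<open>i\<close>, column \<open>j\<close>.
\<close>

primrec nonempty_prod :: "('u, 'm) ring_scheme \<Rightarrow> (nat \<Rightarrow> 'u) \<Rightarrow> nat \<Rightarrow> 'u" where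
  "nonempty_prod U f 0 = f 0"
| "nonempty_prod U f (Suc k) = nonempty_prod U f k \<otimes>\<^bsub>U\<^esub> f (Suc k)"

definition wronskian :: "('u, 'm) ring_scheme \<Rightarrow> ('u \<Rightarrow> 'u) \<Rightarrow> nat \<Rightarrow> 'u list \<Rightarrow> 'u" where
  "wronskian U D k us =
    (\<Oplus>\<^bsub>U\<^esub>\<sigma>\<in>{\<sigma>. \<sigma> permutes {0..k}}.
      [sign \<sigma>] \<cdot>\<^bsub>U\<^esub> nonempty_prod U (\<lambda>j. (D ^^ \<sigma> j) (us ! j)) k)"

definition multilinear ::
    "('k, 'm) ring_scheme \<Rightarrow> ('k, 'a, 'n) module_scheme \<Rightarrow> nat \<Rightarrow> ('a list \<Rightarrow> 'a) \<Rightarrow> bool" where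
  "multilinear K A n \<omega> \<longleftrightarrow>
    (\<forall>as. length as = n \<and> set as \<subseteq> carrier A \<longrightarrow>
      \<omega> as \<in> carrier A \<and>
      (\<forall>i<n. \<forall>x\<in>carrier A. \<forall>y\<in>carrier A.
        \<omega> (as[i := x \<oplus>\<^bsub>A\<^esub> y]) = \<omega> (as[i := x]) \<oplus>\<^bsub>A\<^esub> \<omega> (as[i := y])) \<and>
      (\<forall>i<n. \<forall>c\<in>carrier K. \<forall>x\<in>carrier A.
        \<omega> (as[i := c \<odot>\<^bsub>A\<^esub> x]) = c \<odot>\<^bsub>A\<^esub> \<omega> (as[i := x])))"

text \<open>
  \<open>Hom(\<And>\<^sup>n A, A)\<close>: skew-symmetry is vanishing on lists with a repeated entry, which
  in characteristic 2 is stronger than the sign rule for permuted arguments.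
\<close>

definition cochains ::
    "('k, 'm) ring_scheme \<Rightarrow> ('k, 'a, 'n) module_scheme \<Rightarrow> nat \<Rightarrow> ('a list \<Rightarrow> 'a) set" where
  "cochains K A n =
    {\<omega>. multilinear K A n \<omega> \<and>
        (\<forall>as. length as = n \<and> set as \<subseteq> carrier A \<and> \<not> distinct as \<longrightarrow> \<omega> as = \<zero>\<^bsub>A\<^esub>)}"

definition n_lie ::
    "('k, 'm) ring_scheme \<Rightarrow> ('k, 'a, 'n) module_scheme \<Rightarrow> nat \<Rightarrow> ('a list \<Rightarrow> 'a) \<Rightarrow> bool" where
  "n_lie K A n \<omega> \<longleftrightarrow>
    \<omega> \<in> cochains K A n \<and>
    (\<forall>as bs. length as = n - 1 \<and> set as \<subseteq> carrier A \<and> length bs = n \<and> set bs \<subseteq> carrier A \<longrightarrow>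
      \<omega> (as @ [\<omega> bs]) = (\<Oplus>\<^bsub>A\<^esub>i\<in>{..<n}. \<omega> (bs[i := \<omega> (as @ [bs ! i])])))"

text \<open>\<open>k\<close>-left commutativity of an operation of arity \<open>k + 1\<close>.\<close>

definition left_commutative :: "('a, 'm) ring_scheme \<Rightarrow> nat \<Rightarrow> ('a list \<Rightarrow> 'a) \<Rightarrow> bool" where
  "left_commutative A k \<omega> \<longleftrightarrow>
    (\<forall>a\<in>{1..2 * k + 1} \<rightarrow> carrier A.
      (\<Oplus>\<^bsub>A\<^esub>\<sigma>\<in>{\<sigma>. \<sigma> permutes {1..2 * k}}.
        [sign \<sigma>] \<cdot>\<^bsub>A\<^esub>
          \<omega> (map (\<lambda>i. a (\<sigma> i)) [1..<k + 1] @
             [\<omega> (map (\<lambda>i. a (\<sigma> i)) [k + 1..<2 * k + 1] @ [a (2 * k + 1)])])) = \<zero>\<^bsub>A\<^esub>)"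

definition shuffle_perms :: "nat \<Rightarrow> nat \<Rightarrow> (nat \<Rightarrow> nat) set" where
  "shuffle_perms k l =
    {\<sigma>. \<sigma> permutes {1..k + l} \<and> strict_mono_on {1..k} \<sigma> \<and> strict_mono_on {k + 1..k + l} \<sigma>}"

definition shuffle_identity ::
    "('a, 'm) ring_scheme \<Rightarrow> nat \<Rightarrow> nat \<Rightarrow> ('a list \<Rightarrow> 'a) \<Rightarrow> ('a list \<Rightarrow> 'a) \<Rightarrow> bool" where
  "shuffle_identity A i j \<omega> \<omega>' \<longleftrightarrow>
    (\<forall>a\<in>{1..i + j - 1} \<rightarrow> carrier A.
      (\<Oplus>\<^bsub>A\<^esub>\<sigma>\<in>shuffle_perms (i - 1) j.
        [sign \<sigma>] \<cdot>\<^bsub>A\<^esub>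
          \<omega> (map (\<lambda>m. a (\<sigma> m)) [1..<i] @ [\<omega>' (map (\<lambda>m. a (\<sigma> m)) [i..<i + j])])) = \<zero>\<^bsub>A\<^esub>)"

definition homotopical_n_lie ::
    "('k, 'm) ring_scheme \<Rightarrow> ('k, 'a, 'n) module_scheme \<Rightarrow> nat \<Rightarrow> ('a list \<Rightarrow> 'a) \<Rightarrow> bool" where
  "homotopical_n_lie K A n \<omega> \<longleftrightarrow> \<omega> \<in> cochains K A n \<and> shuffle_identity A n n \<omega> \<omega>"

definition homotopical_lie ::
    "('k, 'm) ring_scheme \<Rightarrow> ('k, 'a, 'n) module_scheme \<Rightarrow> (nat \<Rightarrow> 'a list \<Rightarrow> 'a) \<Rightarrow> bool" where
  "homotopical_lie K A \<omega> \<longleftrightarrow>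
    (\<forall>k\<ge>1. \<omega> k \<in> cochains K A k) \<and>
    (\<forall>i\<ge>1. \<forall>j\<ge>1. shuffle_identity A i j (\<omega> i) (\<omega> j))"

text \<open>
  Over \<open>K\<close>, an identity in finitely many arguments holds in all differential algebras
  as soon as it holds in the countably generated ones.  Those are carried by every type
  into which \<^typ>\<open>'k list\<close> injects, so over such a type \<^typ>\<open>'u\<close> quantifying over the
  algebras with elements in \<^typ>\<open>'u\<close> amounts to quantifying over all of them.
\<close>

definition large_universe :: "'k itself \<Rightarrow> 'u itself \<Rightarrow> bool" where
  "large_universe _ _ \<longleftrightarrow> (\<exists>e :: 'k list \<Rightarrow> 'u. inj e)"

end

theory Submission
  imports Defs "HOL-Algebra.AbelCoset" "HOL-Library.Infinite_Set" "HOL-Library.Poly_Mapping"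
begin

text \<open>
  A multilinear differential expression in \<open>a\<^sub>1, \<dots>, a\<^sub>N\<close> is encoded by its symbol, the polynomial in
  \<open>t\<^sub>1, \<dots>, t\<^sub>N\<close> in which \<open>t\<^sub>1 ^ e\<^sub>1 \<cdots> t\<^sub>N ^ e\<^sub>N\<close> stands for the product of the
  \<open>(D ^^ e\<^sub>i) a\<^sub>i\<close>. Differentiation becomes multiplication by \<open>t\<^sub>1 + \<cdots> + t\<^sub>N\<close>, so the symbol of a
  Wronskian is a Vandermonde determinant, and that of a Wronskian nested in another one is a product of two.

  The homotopical and left-commutative identities antisymmetrize such a product in \<open>N\<close> variables. An
  antisymmetric polynomial of degree below \<open>N (N - 1) / 2\<close> vanishes, which settles the homotopical
  identities and left commutativity for \<open>k \<ge> 3\<close>. The symbol of the \<open>n\<close>-Lie identity is expanded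
  in alternants by the Pieri rule for the product of an alternant with the sum of its variables; for the exceptional
  pairs \<open>(k, p)\<close> all coefficients turn out to be divisible by \<open>p\<close>.

  Conversely, in the algebra of divided powers \<open>x\<^sub>n = x ^ n / n!\<close>, which makes sense over every field,
  the Wronskian of \<open>x\<^sub>e\<^sub>0, \<dots>, x\<^sub>e\<^sub>k\<close> is an integer multiple of a single divided power. Left
  commutativity evaluated there gives \<open>p dvd 1\<close> for \<open>k = 1\<close> and \<open>p dvd 8\<close> for \<open>k = 2\<close>. For \<open>k \<ge> 2\<close> the
  \<open>n\<close>-Lie identity gives \<open>p dvd k\<close>, for \<open>k \<ge> 5\<close> also \<open>p dvd (k - 1) (k - 4)\<close>, hence \<open>p = 2\<close>, and
  for \<open>k \<ge> 6\<close> that \<open>p\<close> divides a number of the parity of \<open>k - 1\<close>, a contradiction.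
\<close>

section \<open>Signed sums over permutations\<close>

lemma sign_compose_permutes:
  assumes "\<sigma> permutes P" "\<tau> permutes P" "finite P"
  shows "sign (\<sigma> \<circ> \<tau>) = sign \<sigma> * sign \<tau>"
  using assms by (intro sign_compose) (auto intro: permutes_imp_permutation)

lemma sign_compose_transpose:
  assumes "\<sigma> permutes P" "finite P" "i \<noteq> j"
  shows "sign (\<sigma> \<circ> transpose i j) = - sign \<sigma>"
  using assms by (subst sign_compose)
    (auto intro: permutes_imp_permutation simp: permutation_swap_id sign_swap_id)

lemma odd_permutations_eq_image:
  assumes "finite P" "i \<in> P" "j \<in> P" "i \<noteq> j"
  shows "{\<pi>. \<pi> permutes P \<and> \<not> evenperm \<pi>} =
    (\<lambda>\<pi>. \<pi> \<circ> transpose i j) ` {\<pi>. \<pi> permutes P \<and> evenperm \<pi>}" (is "?odd = ?h ` ?even")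
proof -
  have "transpose i j permutes P" using assms by (intro permutes_swap_id)
  moreover have "evenperm (\<pi> \<circ> transpose i j) \<longleftrightarrow> \<not> evenperm \<pi>" if "\<pi> permutes P" for \<pi>
    using sign_compose_transpose[OF that assms(1,4)] by (auto simp: sign_def split: if_splits)
  ultimately have maps: "?h ` ?odd \<subseteq> ?even" "?h ` ?even \<subseteq> ?odd"
    by (auto intro: permutes_compose)
  have "?odd = ?h ` ?h ` ?odd" by (simp add: image_comp comp_def)
  then show ?thesis using maps by blast
qed

lemma sum_permutations_eq_sum_even:
  fixes g :: "('i \<Rightarrow> 'i) \<Rightarrow> 'a::comm_monoid_add"
  assumes "finite P" "i \<in> P" "j \<in> P" "i \<noteq> j"
  shows "(\<Sum>\<pi> | \<pi> permutes P. g \<pi>) =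
    (\<Sum>\<pi> | \<pi> permutes P \<and> evenperm \<pi>. g \<pi> + g (\<pi> \<circ> transpose i j))"
proof -
  let ?even = "{\<pi>. \<pi> permutes P \<and> evenperm \<pi>}" and ?odd = "{\<pi>. \<pi> permutes P \<and> \<not> evenperm \<pi>}"
  have "sum g (?even \<union> ?odd) = sum g ?even + sum g ?odd"
    using finite_permutations[OF assms(1)] by (intro sum.union_disjoint) auto
  moreover have "?even \<union> ?odd = {\<pi>. \<pi> permutes P}" by blast
  ultimately have "(\<Sum>\<pi> | \<pi> permutes P. g \<pi>) = sum g ?even + sum g ?odd" by (simp only:)
  also have "sum g ?odd = (\<Sum>\<pi>\<in>?even. g (\<pi> \<circ> transpose i j))"
    unfolding odd_permutations_eq_image[OF assms]
    by (rule sum.reindex_cong[OF _ refl refl])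
      (rule inj_on_inverseI[where g = "\<lambda>\<pi>. \<pi> \<circ> transpose i j"], simp add: comp_assoc)
  finally show ?thesis by (simp add: sum.distrib)
qed

lemma signed_sum_permutations_eq_0:
  fixes f :: "('i \<Rightarrow> 'i) \<Rightarrow> 'a::comm_ring_1"
  assumes "finite P" "i \<in> P" "j \<in> P" "i \<noteq> j"
    and "\<And>\<pi>. \<pi> permutes P \<Longrightarrow> f (\<pi> \<circ> transpose i j) = f \<pi>"
  shows "(\<Sum>\<pi> | \<pi> permutes P. of_int (sign \<pi>) * f \<pi>) = 0"
  unfolding sum_permutations_eq_sum_even[OF assms(1-4)]
  using assms by (intro sum.neutral) (auto simp: sign_compose_transpose)

lemma even_sum_permutations:
  fixes f :: "('i \<Rightarrow> 'i) \<Rightarrow> 'a::comm_ring_1"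
  assumes "finite P" "i \<in> P" "j \<in> P" "i \<noteq> j"
    and "\<And>\<pi>. \<pi> permutes P \<Longrightarrow> f (\<pi> \<circ> transpose i j) = f \<pi>"
  shows "2 dvd (\<Sum>\<pi> | \<pi> permutes P. f \<pi>)"
  unfolding sum_permutations_eq_sum_even[OF assms(1-4)]
  using assms(5) by (intro dvd_sum) (auto simp: mult_2[symmetric])

lemma signed_sum_permutations_insert:
  fixes f :: "('i \<Rightarrow> 'i) \<Rightarrow> 'a::comm_ring_1"
  assumes P: "finite P" "i \<notin> P"
  shows "(\<Sum>\<pi> | \<pi> permutes insert i P. of_int (sign \<pi>) * f \<pi>) =
    (\<Sum>\<pi> | \<pi> permutes P. of_int (sign \<pi>) * f \<pi>) -
    (\<Sum>j\<in>P. \<Sum>\<pi> | \<pi> permutes P. of_int (sign \<pi>) * f (transpose i j \<circ> \<pi>))"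
proof -
  have "sign (transpose i j \<circ> \<pi>) = - sign \<pi>" if "j \<in> P" "\<pi> permutes P" for j \<pi>
    using that P by (subst sign_compose)
      (auto intro: permutes_imp_permutation permutation_swap_id simp: sign_swap_id)
  then have "(\<Sum>j\<in>P. \<Sum>\<pi> | \<pi> permutes P. of_int (sign (transpose i j \<circ> \<pi>)) * f (transpose i j \<circ> \<pi>)) =
      - (\<Sum>j\<in>P. \<Sum>\<pi> | \<pi> permutes P. of_int (sign \<pi>) * f (transpose i j \<circ> \<pi>))"
    by (simp add: sum_negf)
  then show ?thesis
    using P by (simp add: sum_over_permutations_insert)
qed

lemmas signed_int_sum_permutations_insert =
  signed_sum_permutations_insert[where 'a = int, unfolded of_int_eq_id id_apply]

lemma signed_sum_permutations_compose_left:
  fixes f :: "('i \<Rightarrow> 'i) \<Rightarrow> 'a::comm_ring_1"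
  assumes \<tau>: "\<tau> permutes P" and P: "finite P"
  shows "(\<Sum>\<pi> | \<pi> permutes P. of_int (sign \<pi>) * f (\<tau> \<circ> \<pi>)) =
    of_int (sign \<tau>) * (\<Sum>\<pi> | \<pi> permutes P. of_int (sign \<pi>) * f \<pi>)"
proof -
  have sq: "of_int (sign \<tau>) * (of_int (sign \<tau>) * x) = x" for x :: 'a
    by (simp only: mult.assoc[symmetric] of_int_mult[symmetric] sign_idempotent) simp
  have "(\<Sum>\<pi> | \<pi> permutes P. of_int (sign \<pi>) * f \<pi>) =
      (\<Sum>\<pi> | \<pi> permutes P. of_int (sign (\<tau> \<circ> \<pi>)) * f (\<tau> \<circ> \<pi>))"
    by (rule setum_permutations_compose_left[OF \<tau>])
  also have "\<dots> = of_int (sign \<tau>) * (\<Sum>\<pi> | \<pi> permutes P. of_int (sign \<pi>) * f (\<tau> \<circ> \<pi>))"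
    unfolding sum_distrib_left by (rule sum.cong) (auto simp: sign_compose_permutes[OF \<tau> _ P])
  finally show ?thesis by (simp only: sq)
qed

lemma bij_betw_map_permutation:
  assumes "inj_on f P"
  shows "bij_betw (map_permutation P f) {\<pi>. \<pi> permutes P} {\<pi>. \<pi> permutes f ` P}"
  using bij_betw_permutations[of f P "f ` P"] assms
  by (simp add: inj_on_imp_bij_betw map_permutation_def[abs_def] restrict_id_def comp_def)

section \<open>Alternants\<close>

definition alternant :: "'i set \<Rightarrow> ('i \<Rightarrow> nat) \<Rightarrow> ('i \<Rightarrow> 'a::comm_ring_1) \<Rightarrow> 'a" where
  "alternant P e z = (\<Sum>\<pi> | \<pi> permutes P. of_int (sign \<pi>) * (\<Prod>i\<in>P. z i ^ e (\<pi> i)))"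

abbreviation vandermonde :: "nat \<Rightarrow> (nat \<Rightarrow> 'a::comm_ring_1) \<Rightarrow> 'a" where
  "vandermonde k \<equiv> alternant {0..k} id"

lemma alternant_cong:
  assumes "\<And>i. i \<in> P \<Longrightarrow> e i = e' i" "\<And>i. i \<in> P \<Longrightarrow> z i = z' i"
  shows "alternant P e z = alternant P e' z'"
proof -
  have "e (\<pi> i) = e' (\<pi> i)" if "\<pi> permutes P" "i \<in> P" for \<pi> i
    using assms that by (simp add: permutes_in_image)
  then show ?thesis
    unfolding alternant_def using assms by (auto intro!: sum.cong prod.cong)
qed

lemma alternant_altdef:
  assumes "finite P"
  shows "alternant P e z = (\<Sum>\<pi> | \<pi> permutes P. of_int (sign \<pi>) * (\<Prod>i\<in>P. z (\<pi> i) ^ e i))"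
proof -
  have "alternant P e z = (\<Sum>\<pi> | \<pi> permutes P.
      of_int (sign (Hilbert_Choice.inv \<pi>)) * (\<Prod>i\<in>P. z i ^ e (Hilbert_Choice.inv \<pi> i)))"
    unfolding alternant_def by (rule sum_permutations_inverse)
  also have "\<dots> = (\<Sum>\<pi> | \<pi> permutes P. of_int (sign \<pi>) * (\<Prod>i\<in>P. z (\<pi> i) ^ e i))"
  proof (rule sum.cong[OF refl])
    fix \<pi> assume "\<pi> \<in> {\<pi>. \<pi> permutes P}"
    then have \<pi>: "\<pi> permutes P" by simp
    have "(\<Prod>i\<in>P. z i ^ e (Hilbert_Choice.inv \<pi> i)) = (\<Prod>i\<in>P. z (\<pi> i) ^ e i)"
      by (subst prod.permute[OF \<pi>]) (simp add: o_def permutes_inverses[OF \<pi>])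
    then show "of_int (sign (Hilbert_Choice.inv \<pi>)) * (\<Prod>i\<in>P. z i ^ e (Hilbert_Choice.inv \<pi> i)) =
        of_int (sign \<pi>) * (\<Prod>i\<in>P. z (\<pi> i) ^ e i)"
      using permutes_imp_permutation[OF assms \<pi>] by (simp add: sign_inverse)
  qed
  finally show ?thesis .
qed

lemma alternant_permute_exponents:
  assumes "\<tau> permutes P" "finite P"
  shows "alternant P (e \<circ> \<tau>) z = of_int (sign \<tau>) * alternant P e z"
  unfolding alternant_def
  using signed_sum_permutations_compose_left[OF assms, of "\<lambda>\<pi>. \<Prod>i\<in>P. z i ^ e (\<pi> i)"] by simp

lemma alternant_permute_variables:
  assumes "\<tau> permutes P" "finite P"
  shows "alternant P e (z \<circ> \<tau>) = of_int (sign \<tau>) * alternant P e z"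
  unfolding alternant_altdef[OF assms(2)]
  using signed_sum_permutations_compose_left[OF assms, of "\<lambda>\<pi>. \<Prod>i\<in>P. z (\<pi> i) ^ e i"] by simp

lemma alternant_eq_0:
  assumes P: "finite P" and "\<not> inj_on e P"
  shows "alternant P e z = 0"
proof -
  obtain i j where ij: "i \<in> P" "j \<in> P" "i \<noteq> j" "e i = e j"
    using assms(2) by (auto simp: inj_on_def)
  have e: "e (transpose i j m) = e m" for m using ij(4) by (simp add: transpose_def)
  have t: "transpose i j permutes P" using ij by (intro permutes_swap_id)
  show ?thesis
    unfolding alternant_altdef[OF P]
  proof (rule signed_sum_permutations_eq_0[OF P ij(1-3)])
    fix \<pi>
    show "(\<Prod>m\<in>P. z ((\<pi> \<circ> transpose i j) m) ^ e m) = (\<Prod>m\<in>P. z (\<pi> m) ^ e m)"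
      by (subst (2) prod.permute[OF t]) (simp add: e)
  qed
qed

lemma alternant_reindex:
  assumes f: "inj_on f P" and P: "finite P"
  shows "alternant (f ` P) e z = alternant P (e \<circ> f) (z \<circ> f)"
proof -
  have "(\<Prod>i\<in>f ` P. z i ^ e (map_permutation P f \<pi> i)) = (\<Prod>i\<in>P. (z \<circ> f) i ^ (e \<circ> f) (\<pi> i))" for \<pi>
    using map_permutation_apply[OF f] by (simp add: prod.reindex[OF f])
  then show ?thesis
    unfolding alternant_def
    by (subst sum.reindex_bij_betw[OF bij_betw_map_permutation[OF f], symmetric])
      (auto intro!: sum.cong simp: sign_map_permutation f P)
qed

lemma alternant_insert:
  assumes P: "finite P" "i \<notin> P"
  shows "alternant (insert i P) e z =
    z i ^ e i * alternant P e z - (\<Sum>j\<in>P. z i ^ e j * alternant P (e(j := e i)) z)"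
proof -
  have "(\<Prod>m\<in>insert i P. z m ^ e (\<pi> m)) = z i ^ e i * (\<Prod>m\<in>P. z m ^ e (\<pi> m))"
    if "\<pi> permutes P" for \<pi>
    using P permutes_not_in[OF that P(2)] by simp
  moreover have "(\<Prod>m\<in>insert i P. z m ^ e ((transpose i j \<circ> \<pi>) m)) =
      z i ^ e j * (\<Prod>m\<in>P. z m ^ (e(j := e i)) (\<pi> m))" if "\<pi> permutes P" "j \<in> P" for j \<pi>
  proof -
    have "e (transpose i j (\<pi> m)) = (e(j := e i)) (\<pi> m)" if "m \<in> P" for m
      using permutes_in_image[OF \<open>\<pi> permutes P\<close>, of m] that P by (auto simp: transpose_def)
    then show ?thesis using P permutes_not_in[OF that(1) P(2)] by simp
  qed
  ultimately show ?thesis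
    unfolding alternant_def signed_sum_permutations_insert[OF P] sum_distrib_left
    by (simp add: mult.left_commute del: fun_upd_apply)
qed

lemma weighted_sum_alternant_upd:
  assumes P: "finite P"
  shows "(\<Sum>m\<in>P. w m * alternant P (e(m := f m)) z) =
    (\<Sum>\<pi> | \<pi> permutes P. of_int (sign \<pi>) *
      (\<Sum>i\<in>P. w (\<pi> i) * z i ^ f (\<pi> i) * (\<Prod>j\<in>P - {i}. z j ^ e (\<pi> j))))"
proof -
  have "(\<Sum>m\<in>P. w m * (\<Prod>j\<in>P. z j ^ (e(m := f m)) (\<pi> j))) =
      (\<Sum>i\<in>P. w (\<pi> i) * z i ^ f (\<pi> i) * (\<Prod>j\<in>P - {i}. z j ^ e (\<pi> j)))" if \<pi>: "\<pi> permutes P" for \<pi>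
  proof -
    have "(\<Prod>j\<in>P. z j ^ (e(\<pi> i := f (\<pi> i))) (\<pi> j)) = z i ^ f (\<pi> i) * (\<Prod>j\<in>P - {i}. z j ^ e (\<pi> j))"
      if "i \<in> P" for i
      using permutes_inj[OF \<pi>] P that
      by (subst prod.remove[of _ i]) (auto simp: inj_eq intro!: arg_cong2[where f = "(*)"] prod.cong)
    then show ?thesis
      by (subst sum.permute[OF \<pi>]) (simp add: mult.assoc del: fun_upd_apply)
  qed
  then show ?thesis
    unfolding alternant_def sum_distrib_left
    by (subst sum.swap) (simp add: mult.left_commute[of "w _"] sum_distrib_left[symmetric] del: fun_upd_apply)
qed

lemma sum_variables_times_alternant:
  assumes P: "finite P"
  shows "(\<Sum>i\<in>P. z i) * alternant P e z = (\<Sum>m\<in>P. alternant P (e(m := Suc (e m))) z)"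
proof -
  have "(\<Sum>m\<in>P. alternant P (e(m := Suc (e m))) z) = (\<Sum>\<pi> | \<pi> permutes P. of_int (sign \<pi>) *
      (\<Sum>i\<in>P. z i ^ Suc (e (\<pi> i)) * (\<Prod>j\<in>P - {i}. z j ^ e (\<pi> j))))"
    using weighted_sum_alternant_upd[OF P, of "\<lambda>_. 1" e "\<lambda>m. Suc (e m)" z] by simp
  also have "\<dots> = (\<Sum>\<pi> | \<pi> permutes P. of_int (sign \<pi>) * (\<Sum>i\<in>P. z i * (\<Prod>j\<in>P. z j ^ e (\<pi> j))))"
    by (simp add: prod.remove[OF P] mult.assoc cong: sum.cong)
  also have "\<dots> = (\<Sum>i\<in>P. z i) * alternant P e z"
    by (simp add: alternant_def sum_distrib_left sum_distrib_right mult_ac)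
  finally show ?thesis ..
qed

lemma sum_vandermonde_shift:
  "(\<Sum>i\<in>{0..k}. z i ^ a * vandermonde k (z(i := z i + s))) =
    (\<Sum>m\<in>{0..k}. \<Sum>r\<le>m. of_nat (m choose r) * s ^ r * alternant {0..k} (id(m := m - r + a)) z)"
proof -
  have "(\<Sum>m\<in>{0..k}. \<Sum>r\<le>m. of_nat (m choose r) * s ^ r * alternant {0..k} (id(m := m - r + a)) z) =
      (\<Sum>r\<le>k. \<Sum>m\<in>{0..k}. of_nat (m choose r) * s ^ r * alternant {0..k} (id(m := m - r + a)) z)"
    by (subst sum.swap, intro sum.cong refl sum.mono_neutral_left) (auto simp: binomial_eq_0)
  also have "\<dots> = (\<Sum>\<pi> | \<pi> permutes {0..k}. of_int (sign \<pi>) * (\<Sum>i\<in>{0..k}. \<Sum>r\<le>k.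
      of_nat (\<pi> i choose r) * s ^ r * z i ^ (\<pi> i - r + a) * (\<Prod>j\<in>{0..k} - {i}. z j ^ \<pi> j)))"
    unfolding weighted_sum_alternant_upd[OF finite_atLeastAtMost]
    by (simp add: sum_distrib_left sum.swap[of _ _ "{..k}"])
  also have "\<dots> = (\<Sum>\<pi> | \<pi> permutes {0..k}. of_int (sign \<pi>) *
      (\<Sum>i\<in>{0..k}. z i ^ a * (\<Prod>j\<in>{0..k}. (z(i := z i + s)) j ^ \<pi> j)))"
  proof (intro sum.cong refl arg_cong2[where f = "(*)"])
    fix \<pi> i assume "\<pi> \<in> {\<pi>. \<pi> permutes {0..k}}" and i: "i \<in> {0..k}"
    then have le: "\<pi> i \<le> k" using permutes_in_image[of \<pi> "{0..k}" i] by auto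
    have "(z i + s) ^ \<pi> i = (\<Sum>r\<le>\<pi> i. of_nat (\<pi> i choose r) * s ^ r * z i ^ (\<pi> i - r))"
      by (subst add.commute) (rule binomial_ring)
    also have "\<dots> = (\<Sum>r\<le>k. of_nat (\<pi> i choose r) * s ^ r * z i ^ (\<pi> i - r))"
      using le by (intro sum.mono_neutral_left) (auto simp: binomial_eq_0)
    finally have "(\<Prod>j\<in>{0..k}. (z(i := z i + s)) j ^ \<pi> j) =
        (\<Sum>r\<le>k. of_nat (\<pi> i choose r) * s ^ r * z i ^ (\<pi> i - r)) * (\<Prod>j\<in>{0..k} - {i}. z j ^ \<pi> j)"
      using i by (subst prod.remove[of _ i]) (auto intro!: arg_cong2[where f = "(*)"] prod.cong)
    then show "(\<Sum>r\<le>k. of_nat (\<pi> i choose r) * s ^ r * z i ^ (\<pi> i - r + a) * (\<Prod>j\<in>{0..k} - {i}. z j ^ \<pi> j)) =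
        z i ^ a * (\<Prod>j\<in>{0..k}. (z(i := z i + s)) j ^ \<pi> j)"
      by (simp only: power_add sum_distrib_left sum_distrib_right mult_ac)
  qed
  also have "\<dots> = (\<Sum>i\<in>{0..k}. z i ^ a * vandermonde k (z(i := z i + s)))"
    unfolding alternant_def sum_distrib_left id_apply by (subst sum.swap) (simp only: mult_ac)
  finally show ?thesis ..
qed

section \<open>Antisymmetrization of polynomials of small degree\<close>

text \<open>Variables outside \<open>P\<close> count as constants, hence the arbitrary ring elements as coefficients.\<close>

inductive polynomial_degree_le :: "'i set \<Rightarrow> nat \<Rightarrow> (('i \<Rightarrow> 'a::comm_ring_1) \<Rightarrow> 'a) \<Rightarrow> bool"
  for P where
  monomial: "sum e P \<le> n \<Longrightarrow> polynomial_degree_le P n (\<lambda>z. c * (\<Prod>i\<in>P. z i ^ e i))"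
| add: "polynomial_degree_le P n f \<Longrightarrow> polynomial_degree_le P n g \<Longrightarrow>
    polynomial_degree_le P n (\<lambda>z. f z + g z)"

lemma polynomial_degree_le_const: "polynomial_degree_le P n (\<lambda>z. c)"
  using monomial[of "\<lambda>_. 0" P n c] by simp

lemma polynomial_degree_le_var:
  assumes "finite P" "i \<in> P"
  shows "polynomial_degree_le P 1 (\<lambda>z. z i :: 'a::comm_ring_1)"
proof -
  have "(\<Prod>j\<in>P. z j ^ of_bool (j = i)) = z i" for z :: "'b \<Rightarrow> 'a"
    using assms by (simp add: of_bool_def if_distrib[of "\<lambda>n. _ ^ n"] cong: if_cong)
  then show ?thesis
    using monomial[of "\<lambda>j. of_bool (j = i)" P 1 "1 :: 'a"] assms by (simp add: of_bool_def)
qed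

lemma polynomial_degree_le_sum:
  assumes "\<And>j. j \<in> J \<Longrightarrow> polynomial_degree_le P n (f j)"
  shows "polynomial_degree_le P n (\<lambda>z. \<Sum>j\<in>J. f j z)"
  using assms
  by (induction J rule: infinite_finite_induct) (auto intro: polynomial_degree_le_const add)

lemma polynomial_degree_le_mult:
  assumes "polynomial_degree_le P m f" "polynomial_degree_le P n g"
  shows "polynomial_degree_le P (m + n) (\<lambda>z. f z * g z)"
  using assms(1)
proof induction
  case left: (monomial e m c)
  from assms(2) show ?case
  proof induction
    case right: (monomial e' n c')
    have "polynomial_degree_le P (m + n) (\<lambda>z. c * c' * (\<Prod>i\<in>P. z i ^ (e i + e' i)))"
      using left right by (intro monomial) (simp add: sum.distrib)
    then show ?case by (simp add: power_add prod.distrib mult_ac)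
  qed (simp add: distrib_left polynomial_degree_le.add)
qed (simp add: distrib_right polynomial_degree_le.add)

lemma polynomial_degree_le_power:
  assumes "polynomial_degree_le P 1 f"
  shows "polynomial_degree_le P n (\<lambda>z. f z ^ n)"
proof (induction n)
  case (Suc n)
  show ?case using polynomial_degree_le_mult[OF assms Suc] by simp
qed (simp add: polynomial_degree_le_const)

lemma polynomial_degree_le_prod:
  assumes "finite J" "\<And>j. j \<in> J \<Longrightarrow> polynomial_degree_le P (d j) (f j)"
  shows "polynomial_degree_le P (sum d J) (\<lambda>z. \<Prod>j\<in>J. f j z)"
  using assms
  by (induction J rule: finite_induct)
    (auto intro: polynomial_degree_le_const polynomial_degree_le_mult)

lemma polynomial_degree_le_alternant:
  assumes Q: "finite Q" and linear: "\<And>j. j \<in> Q \<Longrightarrow> polynomial_degree_le P 1 (\<lambda>z. f z j)"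
  shows "polynomial_degree_le P (sum e Q) (\<lambda>z. alternant Q e (f z))"
  unfolding alternant_def
proof (rule polynomial_degree_le_sum)
  fix \<pi> assume "\<pi> \<in> {\<pi>. \<pi> permutes Q}"
  then have \<pi>: "\<pi> permutes Q" by simp
  have "polynomial_degree_le P (\<Sum>j\<in>Q. e (\<pi> j)) (\<lambda>z. \<Prod>j\<in>Q. f z j ^ e (\<pi> j))"
    using Q linear by (intro polynomial_degree_le_prod polynomial_degree_le_power)
  moreover have "(\<Sum>j\<in>Q. e (\<pi> j)) = sum e Q"
    using sum.permute[OF \<pi>, of e] by (simp add: o_def)
  ultimately show "polynomial_degree_le P (sum e Q) (\<lambda>z. of_int (sign \<pi>) * (\<Prod>j\<in>Q. f z j ^ e (\<pi> j)))"
    using polynomial_degree_le_mult[OF polynomial_degree_le_const[of P 0]] by fastforce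
qed

lemma antisymmetrization_eq_0:
  assumes P: "finite P" and f: "polynomial_degree_le P n f" and n: "n < \<Sum>{0..<card P}"
  shows "(\<Sum>\<sigma> | \<sigma> permutes P. of_int (sign \<sigma>) * f (z \<circ> \<sigma>)) = 0"
  using f n
proof induction
  case (monomial e n c)
  then have "\<not> inj_on e P"
    using card_sum_le_nat_sum[of "e ` P"] by (auto simp: card_image sum.reindex)
  then have "c * alternant P e z = 0" by (simp add: alternant_eq_0[OF P])
  then show ?case
    unfolding alternant_altdef[OF P] by (simp add: sum_distrib_left mult.left_commute)
next
  case (add n f g)
  then show ?case by (simp add: distrib_left sum.distrib)
qed

section \<open>Shuffles\<close>

lemma map_sorted_list_of_set_strict_mono_on:
  fixes s :: "'i::linorder \<Rightarrow> 'j::linorder"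
  assumes "finite A" "strict_mono_on A s"
  shows "map s (sorted_list_of_set A) = sorted_list_of_set (s ` A)"
proof -
  have "sorted_wrt (<) (map s (sorted_list_of_set A))"
    unfolding sorted_wrt_map
    by (rule sorted_wrt_mono_rel[OF _ strict_sorted_list_of_set]) (use assms in \<open>auto dest: strict_mono_onD\<close>)
  then show ?thesis
    using assms(1) sorted_list_of_set.idem_if_sorted_distinct[of "map s (sorted_list_of_set A)"]
    by (simp add: strict_sorted_iff)
qed

lemma strict_mono_on_unique:
  fixes s s' :: "'i::linorder \<Rightarrow> 'j::linorder"
  assumes "finite A" "strict_mono_on A s" "strict_mono_on A s'" "s ` A = s' ` A" "x \<in> A"
  shows "s x = s' x"
proof -
  have "map s (sorted_list_of_set A) = map s' (sorted_list_of_set A)"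
    using assms by (simp add: map_sorted_list_of_set_strict_mono_on)
  then show ?thesis using assms(1,5) by simp
qed

lemma ex_strict_mono_on_bij_betw:
  fixes B :: "nat set"
  assumes "finite B" "card B = n"
  shows "\<exists>f. bij_betw f {Suc a..a + n} B \<and> strict_mono_on {Suc a..a + n} f"
proof -
  obtain h where h: "bij_betw h {..<n} B" "strict_mono_on {..<n} h"
    using ex_bij_betw_strict_mono_card[OF assms(1)] assms(2) by blast
  have "bij_betw (\<lambda>m. m - Suc a) {Suc a..a + n} {..<n}"
    by (rule bij_betwI[where g = "\<lambda>m. m + Suc a"]) auto
  then have "bij_betw (h \<circ> (\<lambda>m. m - Suc a)) {Suc a..a + n} B" using h(1) by (rule bij_betw_trans)
  moreover have "strict_mono_on {Suc a..a + n} (h \<circ> (\<lambda>m. m - Suc a))"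
    by (intro strict_mono_onI) (auto intro!: strict_mono_onD[OF h(2)])
  ultimately show ?thesis by blast
qed

lemma ex1_shuffle:
  assumes \<sigma>: "\<sigma> permutes {1..k + l}"
  shows "\<exists>!s. s \<in> shuffle_perms k l \<and> s ` {1..k} = \<sigma> ` {1..k}"
proof (rule ex_ex1I)
  let ?A = "{1..k}" and ?B = "{k + 1..k + l}" and ?N = "{1..k + l}"
  have split: "?N = ?A \<union> ?B" "?A \<inter> ?B = {}" by auto
  obtain f where f: "bij_betw f ?A (\<sigma> ` ?A)" "strict_mono_on ?A f"
    using ex_strict_mono_on_bij_betw[of "\<sigma> ` ?A" k 0] permutes_inj_on[OF \<sigma>]
    by (auto simp: card_image)
  obtain g where g: "bij_betw g ?B (\<sigma> ` ?B)" "strict_mono_on ?B g"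
    using ex_strict_mono_on_bij_betw[of "\<sigma> ` ?B" l k] permutes_inj_on[OF \<sigma>]
    by (auto simp: card_image)
  define s where "s = restrict_id (\<lambda>x. if x \<in> ?A then f x else g x) ?N"
  have "\<sigma> ` ?A \<inter> \<sigma> ` ?B = {}"
    using split(2) by (simp add: image_Int[OF permutes_inj[OF \<sigma>], symmetric])
  then have "bij_betw (\<lambda>x. if x \<in> ?A then f x else g x) (?A \<union> ?B) (\<sigma> ` ?A \<union> \<sigma> ` ?B)"
    using bij_betw_disjoint_Un[OF f(1) g(1)] split(2) by simp
  then have "s permutes ?N"
    unfolding s_def image_Un[symmetric] split(1)[symmetric] permutes_image[OF \<sigma>]
    by (rule permutes_restrict_id)
  moreover have "strict_mono_on ?A s" "strict_mono_on ?B s"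
    using f(2) g(2) by (auto simp: s_def strict_mono_on_def)
  moreover have "s ` ?A = f ` ?A" by (rule image_cong) (auto simp: s_def)
  ultimately show "\<exists>s. s \<in> shuffle_perms k l \<and> s ` ?A = \<sigma> ` ?A"
    using f(1) by (auto simp: shuffle_perms_def bij_betw_def)
next
  let ?A = "{1..k}" and ?B = "{k + 1..k + l}"
  fix s s' assume s: "s \<in> shuffle_perms k l \<and> s ` ?A = \<sigma> ` ?A"
    and s': "s' \<in> shuffle_perms k l \<and> s' ` ?A = \<sigma> ` ?A"
  have B: "?B = {1..k + l} - ?A" by auto
  have perm: "s permutes {1..k + l}" "s' permutes {1..k + l}" using s s' by (auto simp: shuffle_perms_def)
  have "s ` ?B = s' ` ?B"
    unfolding B using s s' perm by (simp add: image_set_diff permutes_inj permutes_image)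
  then have "s x = s' x" if "x \<in> ?B" for x
    using s s' that by (intro strict_mono_on_unique[of ?B s s' x]) (simp_all add: shuffle_perms_def)
  moreover have "s x = s' x" if "x \<in> ?A" for x
    using s s' that by (intro strict_mono_on_unique[of ?A s s' x]) (simp_all add: shuffle_perms_def)
  moreover have "s x = s' x" if "x \<notin> {1..k + l}" for x
    using perm[THEN permutes_not_in, OF that] by simp
  ultimately show "s = s'" unfolding B by blast
qed

lemma shuffle_decomposition:
  "bij_betw (\<lambda>(s, \<tau>). s \<circ> \<tau>)
    (shuffle_perms k l \<times> {\<tau>. \<tau> permutes {1..k + l} \<and> \<tau> ` {1..k} = {1..k}})
    {\<sigma>. \<sigma> permutes {1..k + l}}"
proof (rule bij_betw_imageI)
  let ?A = "{1..k}" and ?N = "{1..k + l}"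
  let ?T = "{\<tau>. \<tau> permutes ?N \<and> \<tau> ` ?A = ?A}"
  have perm: "s permutes ?N" if "s \<in> shuffle_perms k l" for s using that by (simp add: shuffle_perms_def)
  show "inj_on (\<lambda>(s, \<tau>). s \<circ> \<tau>) (shuffle_perms k l \<times> ?T)"
  proof (rule inj_onI, clarify)
    fix s \<tau> s' \<tau>'
    assume s: "s \<in> shuffle_perms k l" and s': "s' \<in> shuffle_perms k l"
      and \<tau>: "\<tau> permutes ?N" "\<tau> ` ?A = ?A" and \<tau>': "\<tau>' permutes ?N" "\<tau>' ` ?A = ?A"
      and eq: "s \<circ> \<tau> = s' \<circ> \<tau>'"
    have "s ` ?A = s' ` ?A" using eq \<tau>(2) \<tau>'(2) by (metis image_comp)
    then have "s = s'" using ex1_shuffle[OF perm[OF s']] s s' by blast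
    moreover from this have "\<tau> = \<tau>'"
      using eq permutes_inj[OF perm[OF s]] by (metis comp_apply ext injD)
    ultimately show "s = s' \<and> \<tau> = \<tau>'" ..
  qed
  show "(\<lambda>(s, \<tau>). s \<circ> \<tau>) ` (shuffle_perms k l \<times> ?T) = {\<sigma>. \<sigma> permutes ?N}"
  proof (intro equalityI subsetI)
    fix \<sigma> assume "\<sigma> \<in> {\<sigma>. \<sigma> permutes ?N}"
    then have \<sigma>: "\<sigma> permutes ?N" by simp
    then obtain s where s: "s \<in> shuffle_perms k l" "s ` ?A = \<sigma> ` ?A" using ex1_shuffle by blast
    let ?\<tau> = "Hilbert_Choice.inv s \<circ> \<sigma>"
    have "?\<tau> permutes ?N" using \<sigma> perm[OF s(1)] by (intro permutes_compose permutes_inv)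
    moreover have "?\<tau> ` ?A = ?A"
      using s(2) permutes_inj[OF perm[OF s(1)]] by (metis image_comp image_inv_f_f)
    moreover have "s \<circ> ?\<tau> = \<sigma>"
      by (simp add: comp_assoc[symmetric] permutes_inv_o[OF perm[OF s(1)]])
    ultimately show "\<sigma> \<in> (\<lambda>(s, \<tau>). s \<circ> \<tau>) ` (shuffle_perms k l \<times> ?T)"
      using s(1) by (intro image_eqI[of _ _ "(s, ?\<tau>)"]) auto
  next
    fix \<sigma> assume "\<sigma> \<in> (\<lambda>(s, \<tau>). s \<circ> \<tau>) ` (shuffle_perms k l \<times> ?T)"
    then obtain s \<tau> where "\<sigma> = s \<circ> \<tau>" "s \<in> shuffle_perms k l" "\<tau> permutes ?N" by auto
    then show "\<sigma> \<in> {\<sigma>. \<sigma> permutes ?N}" by (simp only: mem_Collect_eq permutes_compose perm)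
  qed
qed

lemma block_permutation_decomposition:
  assumes "A \<inter> B = {}"
  shows "bij_betw (\<lambda>(\<pi>, \<rho>). \<pi> \<circ> \<rho>) ({\<pi>. \<pi> permutes A} \<times> {\<rho>. \<rho> permutes B})
    {\<tau>. \<tau> permutes A \<union> B \<and> \<tau> ` A = A}"
proof (rule bij_betw_byWitness[where f' = "\<lambda>\<tau>. (restrict_id \<tau> A, restrict_id \<tau> B)"])
  have fixed: "\<rho> x = x" if "\<rho> permutes B" "x \<in> A" for \<rho> x
    using permutes_not_in[OF that(1)] that(2) assms by blast
  have fixed': "\<pi> x = x" if "\<pi> permutes A" "x \<in> B" for \<pi> x
    using permutes_not_in[OF that(1)] that(2) assms by blast
  have eq: "restrict_id \<tau> C = \<pi>" if "\<pi> permutes C" "\<And>x. x \<in> C \<Longrightarrow> \<tau> x = \<pi> x" for \<tau> \<pi> C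
    using that permutes_not_in[OF that(1)] by (auto simp: restrict_id_def fun_eq_iff)
  show "\<forall>p\<in>{\<pi>. \<pi> permutes A} \<times> {\<rho>. \<rho> permutes B}.
      (restrict_id (case p of (\<pi>, \<rho>) \<Rightarrow> \<pi> \<circ> \<rho>) A, restrict_id (case p of (\<pi>, \<rho>) \<Rightarrow> \<pi> \<circ> \<rho>) B) = p"
    by (auto intro!: eq simp: fixed fixed' permutes_in_image)
  show "(\<lambda>(\<pi>, \<rho>). \<pi> \<circ> \<rho>) ` ({\<pi>. \<pi> permutes A} \<times> {\<rho>. \<rho> permutes B})
      \<subseteq> {\<tau>. \<tau> permutes A \<union> B \<and> \<tau> ` A = A}"
  proof clarify
    fix \<pi> \<rho> assume \<pi>: "\<pi> permutes A" and \<rho>: "\<rho> permutes B"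
    have "(\<pi> \<circ> \<rho>) ` A = \<pi> ` A" by (rule image_cong) (simp_all add: fixed[OF \<rho>])
    then show "\<pi> \<circ> \<rho> permutes A \<union> B \<and> (\<pi> \<circ> \<rho>) ` A = A"
      using \<pi> \<rho> by (auto simp only: permutes_image intro!: permutes_compose intro: permutes_subset)
  qed
  have B: "\<tau> ` B = B" if "\<tau> permutes A \<union> B" "\<tau> ` A = A" for \<tau>
  proof -
    have "\<tau> ` B = \<tau> ` (A \<union> B - A)" using assms by (intro arg_cong[where f = "image \<tau>"]) blast
    also have "\<dots> = A \<union> B - A"
      by (simp only: image_set_diff[OF permutes_inj[OF that(1)]] permutes_image[OF that(1)] that(2))
    also have "\<dots> = B" using assms by blast
    finally show ?thesis .
  qed
  show "\<forall>\<tau>\<in>{\<tau>. \<tau> permutes A \<union> B \<and> \<tau> ` A = A}.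
      (case (restrict_id \<tau> A, restrict_id \<tau> B) of (\<pi>, \<rho>) \<Rightarrow> \<pi> \<circ> \<rho>) = \<tau>"
    using B assms by (auto simp: fun_eq_iff restrict_id_def permutes_def disjoint_iff)
  show "(\<lambda>\<tau>. (restrict_id \<tau> A, restrict_id \<tau> B)) ` {\<tau>. \<tau> permutes A \<union> B \<and> \<tau> ` A = A}
      \<subseteq> {\<pi>. \<pi> permutes A} \<times> {\<rho>. \<rho> permutes B}"
    using B by (auto intro!: permutes_restrict_id simp: bij_betw_def intro: permutes_inj_on)
qed

lemma sum_permutations_eq_sum_shuffles:
  fixes g :: "(nat \<Rightarrow> nat) \<Rightarrow> 'a::{semiring_char_0,comm_semiring_1}"
  assumes left: "\<And>\<sigma> \<pi>. \<sigma> permutes {1..k + l} \<Longrightarrow> \<pi> permutes {1..k} \<Longrightarrow> g (\<sigma> \<circ> \<pi>) = g \<sigma>"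
    and right: "\<And>\<sigma> \<rho>. \<sigma> permutes {1..k + l} \<Longrightarrow> \<rho> permutes {k + 1..k + l} \<Longrightarrow> g (\<sigma> \<circ> \<rho>) = g \<sigma>"
  shows "(\<Sum>\<sigma> | \<sigma> permutes {1..k + l}. g \<sigma>) = fact k * fact l * (\<Sum>s\<in>shuffle_perms k l. g s)"
proof -
  let ?A = "{1..k}" and ?B = "{k + 1..k + l}" and ?N = "{1..k + l}"
  let ?T = "{\<tau>. \<tau> permutes ?N \<and> \<tau> ` ?A = ?A}"
  have split: "?A \<union> ?B = ?N" by auto
  have blocks: "bij_betw (\<lambda>(\<pi>, \<rho>). \<pi> \<circ> \<rho>) ({\<pi>. \<pi> permutes ?A} \<times> {\<rho>. \<rho> permutes ?B}) ?T"
    using block_permutation_decomposition[of ?A ?B] unfolding split by simp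
  have invariant: "g (s \<circ> \<tau>) = g s" if s: "s permutes ?N" and \<tau>: "\<tau> \<in> ?T" for s \<tau>
  proof -
    have "\<tau> \<in> (\<lambda>(\<pi>, \<rho>). \<pi> \<circ> \<rho>) ` ({\<pi>. \<pi> permutes ?A} \<times> {\<rho>. \<rho> permutes ?B})"
      unfolding bij_betw_imp_surj_on[OF blocks] by (rule \<tau>)
    then obtain \<pi> \<rho> where \<pi>: "\<pi> permutes ?A" and \<rho>: "\<rho> permutes ?B" and eq: "\<tau> = \<pi> \<circ> \<rho>"
      by clarify blast
    have "\<pi> permutes ?N" using \<pi> by (rule permutes_subset) auto
    then have "s \<circ> \<pi> permutes ?N" using s by (intro permutes_compose)
    then show ?thesis using left[OF s \<pi>] right[OF _ \<rho>, of "s \<circ> \<pi>"] by (simp add: eq comp_assoc)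
  qed
  have "card ?T = fact k * fact l"
    unfolding bij_betw_same_card[OF blocks, symmetric]
    by (simp add: card_cartesian_product card_permutations)
  then have T: "of_nat (card ?T) = (fact k * fact l :: 'a)" by simp
  have "(\<Sum>\<sigma> | \<sigma> permutes ?N. g \<sigma>) = (\<Sum>(s, \<tau>)\<in>shuffle_perms k l \<times> ?T. g (s \<circ> \<tau>))"
    by (subst sum.reindex_bij_betw[OF shuffle_decomposition, symmetric]) (simp add: case_prod_unfold)
  also have "\<dots> = (\<Sum>(s, \<tau>)\<in>shuffle_perms k l \<times> ?T. g s)"
    by (rule sum.cong[OF refl], clarify, rule invariant) (auto simp: shuffle_perms_def)
  also have "\<dots> = fact k * fact l * (\<Sum>s\<in>shuffle_perms k l. g s)"
    by (simp only: sum.cartesian_product[symmetric] sum_constant T sum_distrib_left)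
  finally show ?thesis .
qed

section \<open>The symbol of a nested Wronskian\<close>

text \<open>
  The symbol of \<open>V (a\<^sub>1, \<dots>, a\<^sub>k, V (a\<^sub>k\<^sub>+\<^sub>1, \<dots>, a\<^sub>k\<^sub>+\<^sub>q\<^sub>+\<^sub>1))\<close>: differentiating the
  inner Wronskian multiplies its symbol by the sum of its variables.
\<close>

definition nested_vandermonde :: "nat \<Rightarrow> nat \<Rightarrow> (nat \<Rightarrow> 'a::comm_ring_1) \<Rightarrow> 'a" where
  "nested_vandermonde k q z =
    alternant {1..k + 1} (\<lambda>i. i - 1) (z(k + 1 := \<Sum>m\<in>{k + 1..k + q + 1}. z m)) *
    alternant {k + 1..k + q + 1} (\<lambda>m. m - (k + 1)) z"

lemma nested_vandermonde_permute_outer: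
  assumes \<pi>: "\<pi> permutes {1..k}"
  shows "nested_vandermonde k q (z \<circ> \<pi>) = of_int (sign \<pi>) * nested_vandermonde k q z"
proof -
  have fixed: "\<pi> m = m" if "m > k" for m using permutes_not_in[OF \<pi>] that by simp
  have "\<pi> m \<noteq> k + 1" if "m \<noteq> k + 1" for m
    using permutes_inj[OF \<pi>] fixed[of "k + 1"] that by (metis injD less_add_one)
  then have "(z \<circ> \<pi>)(k + 1 := w) = z(k + 1 := w) \<circ> \<pi>" for w
    using fixed by (auto simp: fun_eq_iff)
  moreover have "\<pi> permutes {1..k + 1}" using \<pi> by (rule permutes_subset) auto
  moreover have "(\<Sum>m\<in>{k + 1..k + q + 1}. (z \<circ> \<pi>) m) = (\<Sum>m\<in>{k + 1..k + q + 1}. z m)"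
    using fixed by (intro sum.cong) auto
  moreover have "alternant {k + 1..k + q + 1} (\<lambda>m. m - (k + 1)) (z \<circ> \<pi>) =
      alternant {k + 1..k + q + 1} (\<lambda>m. m - (k + 1)) z"
    using fixed by (intro alternant_cong) auto
  ultimately show ?thesis
    unfolding nested_vandermonde_def by (simp only: alternant_permute_variables finite_atLeastAtMost mult.assoc)
qed

lemma nested_vandermonde_permute_inner:
  assumes \<pi>: "\<pi> permutes {k + 1..k + q + 1}"
  shows "nested_vandermonde k q (z \<circ> \<pi>) = of_int (sign \<pi>) * nested_vandermonde k q z"
proof -
  have "(\<Sum>m\<in>{k + 1..k + q + 1}. (z \<circ> \<pi>) m) = (\<Sum>m\<in>{k + 1..k + q + 1}. z m)"
    by (rule sum.permute[OF \<pi>, symmetric])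
  moreover have "alternant {1..k + 1} (\<lambda>i. i - 1) ((z \<circ> \<pi>)(k + 1 := w)) =
      alternant {1..k + 1} (\<lambda>i. i - 1) (z(k + 1 := w))" for w
    using permutes_not_in[OF \<pi>] by (intro alternant_cong) auto
  ultimately show ?thesis
    unfolding nested_vandermonde_def
    by (simp only: alternant_permute_variables[OF \<pi> finite_atLeastAtMost] mult.left_commute)
qed

lemma polynomial_degree_le_nested_vandermonde:
  assumes "\<And>m. polynomial_degree_le P 1 (\<lambda>z. f z m)"
  shows "polynomial_degree_le P (\<Sum>{0..k} + \<Sum>{0..q}) (\<lambda>z. nested_vandermonde k q (f z))"
proof -
  have outer: "(\<Sum>i\<in>{1..k + 1}. i - 1) = \<Sum>{0..k}"
    by (rule sum.reindex_bij_witness[where i = Suc and j = "\<lambda>i. i - 1"]) auto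
  have inner: "(\<Sum>m\<in>{k + 1..k + q + 1}. m - (k + 1)) = \<Sum>{0..q}"
    by (rule sum.reindex_bij_witness[where i = "\<lambda>m. k + 1 + m" and j = "\<lambda>m. m - (k + 1)"]) auto
  have "polynomial_degree_le P 1 (\<lambda>z. \<Sum>m\<in>{k + 1..k + q + 1}. f z m)"
    by (rule polynomial_degree_le_sum) (rule assms)
  then have "polynomial_degree_le P 1 (\<lambda>z. ((f z)(k + 1 := \<Sum>m\<in>{k + 1..k + q + 1}. f z m)) i)" for i
    using assms by (cases "i = k + 1") simp_all
  then show ?thesis
    unfolding nested_vandermonde_def outer[symmetric] inner[symmetric]
    by (intro polynomial_degree_le_mult polynomial_degree_le_alternant finite_atLeastAtMost assms)
qed

lemma nested_vandermonde_antisymmetrization: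
  assumes degree: "\<Sum>{0..k} + \<Sum>{0..q} < \<Sum>{0..<n}"
  shows "(\<Sum>\<sigma> | \<sigma> permutes {1..n}. of_int (sign \<sigma>) * nested_vandermonde k q (z \<circ> \<sigma>)) = 0"
proof -
  let ?P = "{1..n}"
  let ?f = "\<lambda>w. nested_vandermonde k q (\<lambda>m. if m \<in> ?P then w m else z m)"
  have "polynomial_degree_le ?P 1 (\<lambda>w. if m \<in> ?P then w m else z m)" for m
    using polynomial_degree_le_var[of ?P m] by (cases "m \<in> ?P") (auto simp: polynomial_degree_le_const)
  then have "polynomial_degree_le ?P (\<Sum>{0..k} + \<Sum>{0..q}) ?f"
    by (rule polynomial_degree_le_nested_vandermonde)
  then have "(\<Sum>\<sigma> | \<sigma> permutes ?P. of_int (sign \<sigma>) * ?f (z \<circ> \<sigma>)) = 0"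
    by (rule antisymmetrization_eq_0[rotated]) (use degree in auto)
  moreover have "(\<lambda>m. if m \<in> ?P then (z \<circ> \<sigma>) m else z m) = z \<circ> \<sigma>" if "\<sigma> permutes ?P" for \<sigma>
    using permutes_not_in[OF that] by (auto simp: fun_eq_iff)
  ultimately show ?thesis by simp
qed

lemma nested_vandermonde_shuffle_sum:
  fixes z :: "nat \<Rightarrow> 'a::{idom,ring_char_0}"
  assumes "k > 0" "q > 0"
  shows "(\<Sum>\<sigma>\<in>shuffle_perms k (q + 1). of_int (sign \<sigma>) * nested_vandermonde k q (z \<circ> \<sigma>)) = 0"
proof -
  let ?N = "{1..k + (q + 1)}" and ?g = "\<lambda>\<sigma>. of_int (sign \<sigma>) * nested_vandermonde k q (z \<circ> \<sigma>)"
  have invariant: "?g (\<sigma> \<circ> \<pi>) = ?g \<sigma>"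
    if "\<sigma> permutes ?N" "\<pi> permutes ?N"
      and "nested_vandermonde k q ((z \<circ> \<sigma>) \<circ> \<pi>) = of_int (sign \<pi>) * nested_vandermonde k q (z \<circ> \<sigma>)" for \<sigma> \<pi>
  proof -
    have "?g (\<sigma> \<circ> \<pi>) = of_int (sign \<sigma> * (sign \<pi> * sign \<pi>)) * nested_vandermonde k q (z \<circ> \<sigma>)"
      using that(3) sign_compose_permutes[OF that(1,2)]
      by (simp only: comp_assoc of_int_mult mult.assoc) simp
    then show ?thesis by (simp only: sign_idempotent mult_1_right)
  qed
  have "(\<Sum>\<sigma> | \<sigma> permutes ?N. ?g \<sigma>) = fact k * fact (q + 1) * (\<Sum>s\<in>shuffle_perms k (q + 1). ?g s)"
  proof (rule sum_permutations_eq_sum_shuffles)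
    fix \<sigma> \<pi> assume \<sigma>: "\<sigma> permutes ?N"
    show "?g (\<sigma> \<circ> \<pi>) = ?g \<sigma>" if \<pi>: "\<pi> permutes {1..k}"
      using \<sigma> permutes_subset[OF \<pi>] nested_vandermonde_permute_outer[OF \<pi>] by (intro invariant) auto
    show "?g (\<sigma> \<circ> \<pi>) = ?g \<sigma>" if \<pi>: "\<pi> permutes {k + 1..k + (q + 1)}"
      using \<sigma> permutes_subset[OF \<pi>] nested_vandermonde_permute_inner[of \<pi> k q] \<pi>
      by (intro invariant) (auto simp: add.assoc)
  qed
  moreover have "(\<Sum>\<sigma> | \<sigma> permutes ?N. ?g \<sigma>) = 0"
  proof (rule nested_vandermonde_antisymmetrization)
    have "k * q > 0" using assms by simp
    then have "2 * (\<Sum>{0..k} + \<Sum>{0..q}) < 2 * \<Sum>{0..k + q}"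
      using double_gauss_sum[of k, where 'a = nat] double_gauss_sum[of q, where 'a = nat]
        double_gauss_sum[of "k + q", where 'a = nat] by (simp add: algebra_simps)
    then show "\<Sum>{0..k} + \<Sum>{0..q} < \<Sum>{0..<k + (q + 1)}"
      by (simp add: atLeastLessThanSuc_atLeastAtMost)
  qed
  ultimately have "fact k * fact (q + 1) * (\<Sum>s\<in>shuffle_perms k (q + 1). ?g s) = 0" by simp
  then show ?thesis by (simp only: mult_eq_0_iff fact_nonzero) simp
qed

lemma nested_vandermonde_left_commutative_sum:
  assumes "k \<ge> 3"
  shows "(\<Sum>\<sigma> | \<sigma> permutes {1..2 * k}. of_int (sign \<sigma>) * nested_vandermonde k k (z \<circ> \<sigma>)) = 0"
proof (rule nested_vandermonde_antisymmetrization)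
  obtain m where m: "k = m + 3" using assms by (metis add.commute le_Suc_ex)
  have "{0..<2 * k} = {0..2 * m + 5}" by (auto simp: m)
  then show "\<Sum>{0..k} + \<Sum>{0..k} < \<Sum>{0..<2 * k}"
    using double_gauss_sum[of k, where 'a = nat] double_gauss_sum[of "2 * m + 5", where 'a = nat]
    by (simp add: m algebra_simps)
qed

text \<open>Exchanging the two outer arguments leaves each summand unchanged.\<close>

lemma even_nested_vandermonde_left_commutative_sum:
  "2 dvd (\<Sum>\<sigma> | \<sigma> permutes {1..4}. of_int (sign \<sigma>) * nested_vandermonde 2 2 (z \<circ> \<sigma>))"
proof (rule even_sum_permutations[of _ 1 2])
  let ?t = "transpose 1 (2::nat)"
  have t: "?t permutes {1..2}" by (intro permutes_swap_id) auto
  fix \<sigma> :: "nat \<Rightarrow> nat" assume \<sigma>: "\<sigma> permutes {1..4}"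
  then have "sign (\<sigma> \<circ> ?t) = - sign \<sigma>" by (rule sign_compose_transpose) auto
  then show "of_int (sign (\<sigma> \<circ> ?t)) * nested_vandermonde 2 2 (z \<circ> (\<sigma> \<circ> ?t)) =
      of_int (sign \<sigma>) * nested_vandermonde 2 2 (z \<circ> \<sigma>)"
    using nested_vandermonde_permute_outer[OF t, of 2 "z \<circ> \<sigma>"] by (simp add: sign_swap_id comp_assoc)
qed auto

section \<open>The symbol of the \<open>n\<close>-Lie identity\<close>

definition lie_defect :: "nat \<Rightarrow> (nat \<Rightarrow> 'a::comm_ring_1) \<Rightarrow> (nat \<Rightarrow> 'a) \<Rightarrow> 'a" where
  "lie_defect k s t =
    vandermonde k (s(k := \<Sum>j\<in>{0..k}. t j)) * vandermonde k t -
    (\<Sum>i\<in>{0..k}. vandermonde k (t(i := t i + (\<Sum>j\<in>{0..<k}. s j))) * vandermonde k (s(k := t i)))"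

lemma vandermonde_upd_last:
  "vandermonde k (s(k := x)) = x ^ k * alternant {0..<k} id s -
    (\<Sum>n\<in>{0..<k}. x ^ n * alternant {0..<k} (id(n := k)) s)"
proof -
  have "{0..k} = insert k {0..<k}" by auto
  moreover have "alternant {0..<k} e (s(k := x)) = alternant {0..<k} e s" for e
    by (rule alternant_cong) auto
  ultimately show ?thesis by (simp add: alternant_insert)
qed

lemma alternant_raise_last:
  assumes "k > 0"
  shows "alternant {0..<k} (id(k - 1 := k)) s = (\<Sum>j\<in>{0..<k}. s j) * alternant {0..<k} id s"
proof -
  have "alternant {0..<k} (id(m := Suc m)) s = 0" if "m < k - 1" for m
    using that by (intro alternant_eq_0) (auto simp: inj_on_def intro!: bexI[of _ m] bexI[of _ "Suc m"])
  moreover have "{0..<k} = insert (k - 1) {0..<k - 1}" using assms by auto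
  ultimately have "(\<Sum>m\<in>{0..<k}. alternant {0..<k} (id(m := Suc m)) s) = alternant {0..<k} (id(k - 1 := k)) s"
    using assms by simp
  then show ?thesis by (simp add: sum_variables_times_alternant del: fun_upd_apply)
qed

text \<open>The coefficients of the defect as a combination of the cofactors of \<open>s k\<close> in \<open>vandermonde k s\<close>.\<close>

definition lie_defect_coeff :: "nat \<Rightarrow> 'a::comm_ring_1 \<Rightarrow> (nat \<Rightarrow> 'a) \<Rightarrow> nat \<Rightarrow> 'a" where
  "lie_defect_coeff k S t n = (\<Sum>j\<in>{0..k}. t j) ^ n * vandermonde k t -
    (\<Sum>i\<in>{0..k}. t i ^ n * vandermonde k (t(i := t i + S)))"

lemma lie_defect_eq:
  fixes k s defines "S \<equiv> \<Sum>j\<in>{0..<k}. s j"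
  assumes "k > 0"
  shows "lie_defect k s t =
    alternant {0..<k} id s * (lie_defect_coeff k S t k - S * lie_defect_coeff k S t (k - 1)) -
    (\<Sum>n\<in>{0..<k - 1}. alternant {0..<k} (id(n := k)) s * lie_defect_coeff k S t n)"
proof -
  let ?G = "lie_defect_coeff k S t" and ?A = "\<lambda>n. alternant {0..<k} (id(n := k)) s"
  have "lie_defect k s t = alternant {0..<k} id s * ?G k - (\<Sum>n\<in>{0..<k}. ?A n * ?G n)"
    unfolding lie_defect_def lie_defect_coeff_def vandermonde_upd_last S_def[symmetric]
    by (simp add: algebra_simps sum_subtractf sum_distrib_left sum.swap[of _ "{0..<k}"] del: fun_upd_apply)
  also have "(\<Sum>n\<in>{0..<k}. ?A n * ?G n) = (\<Sum>n\<in>{0..<k - 1}. ?A n * ?G n) + ?A (k - 1) * ?G (k - 1)"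
    using assms(2) by (cases k) simp_all
  finally show ?thesis
    unfolding alternant_raise_last[OF assms(2), of s] S_def[symmetric] by (simp only: algebra_simps)
qed

lemma dvd_lie_defect:
  fixes k s defines "S \<equiv> \<Sum>j\<in>{0..<k}. s j"
  assumes "k > 0" and "\<And>n. n < k - 1 \<Longrightarrow> p dvd lie_defect_coeff k S t n"
    and "p dvd lie_defect_coeff k S t k - S * lie_defect_coeff k S t (k - 1)"
  shows "p dvd lie_defect k s t"
  unfolding lie_defect_eq[OF assms(2)] S_def[symmetric]
  by (intro dvd_diff[OF dvd_mult[OF assms(4)]] dvd_sum dvd_mult assms(3)) simp

definition list_alternant :: "(nat \<Rightarrow> 'a::comm_ring_1) \<Rightarrow> nat list \<Rightarrow> 'a" where
  "list_alternant z es = alternant {0..<length es} ((!) es) z"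

lemma alternant_eq_list_alternant: "alternant {0..k} e z = list_alternant z (map e [0..<Suc k])"
  unfolding list_alternant_def by (simp add: atLeastLessThanSuc_atLeastAtMost del: upt_Suc)
    (rule alternant_cong, auto simp del: upt_Suc)

lemma list_alternant_eq_0:
  assumes "\<not> distinct es"
  shows "list_alternant z es = 0"
proof -
  obtain i j where "i < length es" "j < length es" "i \<noteq> j" "es ! i = es ! j"
    using assms by (auto simp: distinct_conv_nth)
  then have "\<not> inj_on ((!) es) {0..<length es}" by (auto dest: inj_onD)
  then show ?thesis unfolding list_alternant_def by (intro alternant_eq_0) auto
qed

lemma list_alternant_swap:
  "list_alternant z (xs @ a # b # ys) = - list_alternant z (xs @ b # a # ys)"
proof -
  let ?n = "length xs" and ?N = "{0..<length xs + length ys + 2}" and ?es = "xs @ b # a # ys"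
  have "alternant ?N ((!) (xs @ a # b # ys)) z = alternant ?N ((!) ?es \<circ> transpose ?n (Suc ?n)) z"
    by (rule alternant_cong) (auto simp: nth_append transpose_def nth_Cons split: nat.splits)
  also have "\<dots> = - alternant ?N ((!) ?es) z"
    by (subst alternant_permute_exponents) (auto intro!: permutes_swap_id simp: sign_swap_id)
  finally show ?thesis by (simp add: list_alternant_def)
qed

lemma list_alternant_sort:
  "b < a \<Longrightarrow> list_alternant z (a # b # ys) = - list_alternant z (b # a # ys)"
  "b < a \<Longrightarrow> list_alternant z (u # a # b # ys) = - list_alternant z (u # b # a # ys)"
  "b < a \<Longrightarrow> list_alternant z (u # v # a # b # ys) = - list_alternant z (u # v # b # a # ys)"
  "b < a \<Longrightarrow> list_alternant z (u # v # w # a # b # ys) = - list_alternant z (u # v # w # b # a # ys)"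
  by (rule list_alternant_swap[of z "[]", unfolded append.simps]
      list_alternant_swap[of z "[u]", unfolded append.simps]
      list_alternant_swap[of z "[u, v]", unfolded append.simps]
      list_alternant_swap[of z "[u, v, w]", unfolded append.simps])+

primrec increments :: "nat list \<Rightarrow> nat list list" where
  "increments [] = []"
| "increments (e # es) = (Suc e # es) # map ((#) e) (increments es)"

lemma increments_eq: "increments es = map (\<lambda>m. es[m := Suc (es ! m)]) [0..<length es]"
  by (induction es) (simp_all add: map_upt_Suc o_def del: upt_Suc)

lemma sum_variables_times_list_alternant:
  assumes "length es = Suc k"
  shows "(\<Sum>i\<in>{0..k}. z i) * list_alternant z es = sum_list (map (list_alternant z) (increments es))"
proof -
  have set: "{0..k} = {0..<length es}" using assms by auto
  have "alternant {0..<length es} (((!) es)(m := Suc (es ! m))) z = list_alternant z (es[m := Suc (es ! m)])"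
    if "m < length es" for m
    unfolding list_alternant_def using that by (simp, intro alternant_cong) (auto simp: nth_list_update)
  then show ?thesis
    unfolding set list_alternant_def[of z es]
    by (simp add: sum_variables_times_alternant increments_eq sum_list_distinct_conv_sum_set o_def
      cong: map_cong)
qed

lemma sum_list_concat: "sum_list (concat xss) = (\<Sum>xs\<leftarrow>xss. sum_list (xs :: 'a::monoid_add list))"
  by (induction xss) simp_all

text \<open>The Pieri rule keeps the exponents increasing, so that adding boxes needs no sorting.\<close>

primrec add_boxes :: "nat \<Rightarrow> nat list \<Rightarrow> nat list list" where
  "add_boxes 0 es = [es]"
| "add_boxes (Suc n) es = concat (map (add_boxes n) (filter distinct (increments es)))"

lemma sum_variables_power_times_list_alternant:
  assumes "length es = Suc k"
  shows "(\<Sum>i\<in>{0..k}. z i) ^ n * list_alternant z es = (\<Sum>ds\<leftarrow>add_boxes n es. list_alternant z ds)"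
  using assms
proof (induction n arbitrary: es)
  case (Suc n)
  let ?T = "\<Sum>i\<in>{0..k}. z i"
  have "?T * list_alternant z es = (\<Sum>ds\<leftarrow>filter distinct (increments es). list_alternant z ds)"
    unfolding sum_variables_times_list_alternant[OF Suc.prems]
    by (rule sum_list_map_filter[symmetric]) (auto simp: list_alternant_eq_0)
  then have "?T ^ Suc n * list_alternant z es =
      (\<Sum>ds\<leftarrow>filter distinct (increments es). ?T ^ n * list_alternant z ds)"
    by (simp add: sum_list_const_mult mult.assoc mult.left_commute[of ?T])
  also have "\<dots> = (\<Sum>ds\<leftarrow>filter distinct (increments es). \<Sum>ds'\<leftarrow>add_boxes n ds. list_alternant z ds')"
    using Suc by (intro arg_cong[where f = sum_list] map_cong refl) (auto simp: increments_eq simp del: upt_Suc)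
  also have "\<dots> = (\<Sum>ds\<leftarrow>add_boxes (Suc n) es. list_alternant z ds)"
    by (simp add: map_concat sum_list_concat o_def)
  finally show ?case .
qed simp

lemma vandermonde_1: "vandermonde 1 z = z 1 - z 0"
proof -
  have "{0..1} = insert 1 {0 :: nat}" by auto
  then show ?thesis by (simp add: alternant_insert) (simp add: alternant_def)
qed

lemma lie_defect_1: "lie_defect 1 s t = 0"
  unfolding lie_defect_def vandermonde_1 by (simp add: algebra_simps)

lemma lie_defect_coeff_eq:
  "lie_defect_coeff k S t n = (\<Sum>es\<leftarrow>add_boxes n [0..<Suc k]. list_alternant t es) -
    (\<Sum>m\<in>{0..k}. \<Sum>r\<le>m. of_nat (m choose r) * S ^ r * list_alternant t ([0..<Suc k][m := m - r + n]))"
proof -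
  have "map (id(m := e)) [0..<Suc k] = [0..<Suc k][m := e]" for m e
    by (rule nth_equalityI) (auto simp: nth_list_update simp del: upt_Suc)
  then show ?thesis
    unfolding lie_defect_coeff_def sum_vandermonde_shift unfolding alternant_eq_list_alternant
    by (simp add: sum_variables_power_times_list_alternant del: upt_Suc)
qed

lemma lie_defect_coeff_2:
  shows "lie_defect_coeff 2 S t 0 = 2 * (- list_alternant t [0, 1, 2])"
    and "lie_defect_coeff 2 S t 2 - S * lie_defect_coeff 2 S t 1 =
      2 * (list_alternant t [0, 2, 3] + S ^ 2 * list_alternant t [0, 1, 2] - S * list_alternant t [0, 1, 3])"
  by (simp_all add: lie_defect_coeff_eq eval_nat_numeral list_alternant_eq_0 list_alternant_sort algebra_simps)

lemma lie_defect_coeff_3: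
  shows "lie_defect_coeff 3 S t 0 = 3 * (- list_alternant t [0, 1, 2, 3])"
    and "lie_defect_coeff 3 S t 1 = 3 * (- (2 * S * list_alternant t [0, 1, 2, 3]))"
    and "lie_defect_coeff 3 S t 3 - S * lie_defect_coeff 3 S t 2 =
      3 * (list_alternant t [0, 1, 3, 5] + S ^ 3 * list_alternant t [0, 1, 2, 3] -
        S * list_alternant t [0, 1, 2, 5])"
  by (simp_all add: lie_defect_coeff_eq eval_nat_numeral list_alternant_eq_0 list_alternant_sort algebra_simps)

lemma lie_defect_coeff_4:
  shows "lie_defect_coeff 4 S t 0 = 2 * (- (2 * list_alternant t [0, 1, 2, 3, 4]))"
    and "lie_defect_coeff 4 S t 1 = 2 * (- (5 * S * list_alternant t [0, 1, 2, 3, 4]))"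
    and "lie_defect_coeff 4 S t 2 = 2 * (list_alternant t [0, 1, 2, 4, 5] -
      2 * S * list_alternant t [0, 1, 2, 3, 5] - 5 * S ^ 2 * list_alternant t [0, 1, 2, 3, 4])"
    and "lie_defect_coeff 4 S t 4 - S * lie_defect_coeff 4 S t 3 =
      2 * (list_alternant t [0, 1, 2, 5, 6] + list_alternant t [0, 1, 3, 4, 6] +
        list_alternant t [0, 2, 3, 4, 5] + 2 * list_alternant t [0, 1, 2, 4, 7] +
        S ^ 3 * list_alternant t [0, 1, 2, 3, 5] + 2 * S ^ 4 * list_alternant t [0, 1, 2, 3, 4] -
        S * list_alternant t [0, 1, 3, 4, 5] - 2 * S * list_alternant t [0, 1, 2, 3, 7] -
        S ^ 2 * list_alternant t [0, 1, 2, 3, 6])"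
  by (simp_all add: lie_defect_coeff_eq eval_nat_numeral list_alternant_eq_0 list_alternant_sort algebra_simps)

lemma two_dvd_lie_defect_2: "2 dvd lie_defect 2 s t"
proof (rule dvd_lie_defect)
  fix n :: nat assume "n < 2 - 1"
  then have "n = 0" by simp
  then show "2 dvd lie_defect_coeff 2 (\<Sum>j\<in>{0..<2}. s j) t n" by (simp only: lie_defect_coeff_2 dvd_triv_left)
qed (use lie_defect_coeff_2(2)[THEN dvdI, of "\<Sum>j\<in>{0..<2}. s j" t] in simp_all)

lemma three_dvd_lie_defect_3: "3 dvd lie_defect 3 s t"
proof (rule dvd_lie_defect)
  fix n :: nat assume "n < 3 - 1"
  then consider "n = 0" | "n = 1" by linarith
  then show "3 dvd lie_defect_coeff 3 (\<Sum>j\<in>{0..<3}. s j) t n"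
    by cases (simp_all only: lie_defect_coeff_3 dvd_triv_left)
qed (use lie_defect_coeff_3(3)[THEN dvdI, of "\<Sum>j\<in>{0..<3}. s j" t] in simp_all)

lemma two_dvd_lie_defect_4: "2 dvd lie_defect 4 s t"
proof (rule dvd_lie_defect)
  fix n :: nat assume "n < 4 - 1"
  then consider "n = 0" | "n = 1" | "n = 2" by linarith
  then show "2 dvd lie_defect_coeff 4 (\<Sum>j\<in>{0..<4}. s j) t n"
    by cases (simp_all only: lie_defect_coeff_4 dvd_triv_left)
qed (use lie_defect_coeff_4(4)[THEN dvdI, of "\<Sum>j\<in>{0..<4}. s j" t] in simp_all)

section \<open>Linear maps and multilinear operations\<close>

context module
begin

definition linear_maps :: "('c \<Rightarrow> 'c) set" where
  "linear_maps = {\<phi> \<in> carrier M \<rightarrow> carrier M.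
    (\<forall>x\<in>carrier M. \<forall>y\<in>carrier M. \<phi> (x \<oplus>\<^bsub>M\<^esub> y) = \<phi> x \<oplus>\<^bsub>M\<^esub> \<phi> y) \<and>
    (\<forall>c\<in>carrier R. \<forall>x\<in>carrier M. \<phi> (c \<odot>\<^bsub>M\<^esub> x) = c \<odot>\<^bsub>M\<^esub> \<phi> x)}"

lemma linear_mapsI:
  assumes "\<And>x. x \<in> carrier M \<Longrightarrow> \<phi> x \<in> carrier M"
    and "\<And>x y. x \<in> carrier M \<Longrightarrow> y \<in> carrier M \<Longrightarrow> \<phi> (x \<oplus>\<^bsub>M\<^esub> y) = \<phi> x \<oplus>\<^bsub>M\<^esub> \<phi> y"
    and "\<And>c x. c \<in> carrier R \<Longrightarrow> x \<in> carrier M \<Longrightarrow> \<phi> (c \<odot>\<^bsub>M\<^esub> x) = c \<odot>\<^bsub>M\<^esub> \<phi> x"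
  shows "\<phi> \<in> linear_maps"
  using assms by (auto simp: linear_maps_def)

lemma
  assumes "\<phi> \<in> linear_maps"
  shows linear_closed: "x \<in> carrier M \<Longrightarrow> \<phi> x \<in> carrier M"
    and linear_add: "x \<in> carrier M \<Longrightarrow> y \<in> carrier M \<Longrightarrow> \<phi> (x \<oplus>\<^bsub>M\<^esub> y) = \<phi> x \<oplus>\<^bsub>M\<^esub> \<phi> y"
    and linear_smult: "c \<in> carrier R \<Longrightarrow> x \<in> carrier M \<Longrightarrow> \<phi> (c \<odot>\<^bsub>M\<^esub> x) = c \<odot>\<^bsub>M\<^esub> \<phi> x"
  using assms by (auto simp: linear_maps_def)

lemma linear_abelian_group_hom:
  assumes "\<phi> \<in> linear_maps"
  shows "abelian_group_hom M M \<phi>"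
  by (rule abelian_group_homI[OF M.abelian_group_axioms M.abelian_group_axioms], rule group_hom.intro)
    (use assms in \<open>auto simp: group_hom_axioms_def hom_def linear_closed linear_add intro: M.a_group\<close>)

lemma
  assumes \<phi>: "\<phi> \<in> linear_maps"
  shows linear_zero: "\<phi> \<zero>\<^bsub>M\<^esub> = \<zero>\<^bsub>M\<^esub>"
    and linear_minus: "x \<in> carrier M \<Longrightarrow> y \<in> carrier M \<Longrightarrow> \<phi> (x \<ominus>\<^bsub>M\<^esub> y) = \<phi> x \<ominus>\<^bsub>M\<^esub> \<phi> y"
    and linear_int_pow: "x \<in> carrier M \<Longrightarrow> \<phi> ([(n::int)] \<cdot>\<^bsub>M\<^esub> x) = [n] \<cdot>\<^bsub>M\<^esub> \<phi> x"
    and linear_finsum: "f \<in> A \<rightarrow> carrier M \<Longrightarrow> \<phi> (\<Oplus>\<^bsub>M\<^esub>i\<in>A. f i) = (\<Oplus>\<^bsub>M\<^esub>i\<in>A. \<phi> (f i))"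
proof -
  interpret \<phi>: abelian_group_hom M M \<phi> by (rule linear_abelian_group_hom[OF \<phi>])
  show "\<phi> \<zero>\<^bsub>M\<^esub> = \<zero>\<^bsub>M\<^esub>" by simp
  show "\<phi> (x \<ominus>\<^bsub>M\<^esub> y) = \<phi> x \<ominus>\<^bsub>M\<^esub> \<phi> y" if "x \<in> carrier M" "y \<in> carrier M" for x y
    using that by (simp add: a_minus_def)
  show "\<phi> ([(n::int)] \<cdot>\<^bsub>M\<^esub> x) = [n] \<cdot>\<^bsub>M\<^esub> \<phi> x" if "x \<in> carrier M" for x n
    using group_hom.hom_int_pow[OF \<phi>.a_group_hom] that by (simp add: add_pow_def)
  show "\<phi> (\<Oplus>\<^bsub>M\<^esub>i\<in>A. f i) = (\<Oplus>\<^bsub>M\<^esub>i\<in>A. \<phi> (f i))" if "f \<in> A \<rightarrow> carrier M" for f A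
    using that
  proof (induction A rule: infinite_finite_induct)
    case (insert i A)
    then show ?case by (simp add: Pi_iff)
  qed simp_all
qed

lemma linear_maps_comp: "\<phi> \<in> linear_maps \<Longrightarrow> \<psi> \<in> linear_maps \<Longrightarrow> (\<lambda>x. \<phi> (\<psi> x)) \<in> linear_maps"
  by (rule linear_mapsI) (simp_all add: linear_closed linear_add linear_smult)

lemma linear_maps_funpow: "\<phi> \<in> linear_maps \<Longrightarrow> \<phi> ^^ n \<in> linear_maps"
proof (induction n)
  case 0
  show ?case by (rule linear_mapsI) simp_all
next
  case (Suc n)
  then show ?case using linear_maps_comp[of \<phi> "\<phi> ^^ n"] by (simp add: comp_def)
qed

lemma linear_maps_smult: "c \<in> carrier R \<Longrightarrow> (\<lambda>x. c \<odot>\<^bsub>M\<^esub> x) \<in> linear_maps"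
  by (rule linear_mapsI) (simp_all add: smult_r_distr smult_assoc1[symmetric] R.m_comm)

lemma linear_maps_int_pow: "(\<lambda>x. [(n::int)] \<cdot>\<^bsub>M\<^esub> x) \<in> linear_maps"
  by (rule linear_mapsI) (simp_all add: M.add.int_pow_distrib linear_int_pow[OF linear_maps_smult])

lemma linear_maps_finsum:
  assumes "\<And>i. i \<in> A \<Longrightarrow> \<phi> i \<in> linear_maps"
  shows "(\<lambda>x. \<Oplus>\<^bsub>M\<^esub>i\<in>A. \<phi> i x) \<in> linear_maps"
proof (rule linear_mapsI)
  have closed: "(\<lambda>i. \<phi> i x) \<in> A \<rightarrow> carrier M" if "x \<in> carrier M" for x
    using assms that by (auto intro: linear_closed)
  show "(\<Oplus>\<^bsub>M\<^esub>i\<in>A. \<phi> i x) \<in> carrier M" if "x \<in> carrier M" for x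
    using closed[OF that] by (rule M.finsum_closed)
  show "(\<Oplus>\<^bsub>M\<^esub>i\<in>A. \<phi> i (x \<oplus>\<^bsub>M\<^esub> y)) = (\<Oplus>\<^bsub>M\<^esub>i\<in>A. \<phi> i x) \<oplus>\<^bsub>M\<^esub> (\<Oplus>\<^bsub>M\<^esub>i\<in>A. \<phi> i y)"
    if x: "x \<in> carrier M" and y: "y \<in> carrier M" for x y
    unfolding M.finsum_addf[OF closed[OF x] closed[OF y], symmetric]
    using assms x y by (intro M.finsum_cong') (auto simp: linear_add linear_closed)
  show "(\<Oplus>\<^bsub>M\<^esub>i\<in>A. \<phi> i (c \<odot>\<^bsub>M\<^esub> x)) = c \<odot>\<^bsub>M\<^esub> (\<Oplus>\<^bsub>M\<^esub>i\<in>A. \<phi> i x)"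
    if c: "c \<in> carrier R" and x: "x \<in> carrier M" for c x
    unfolding linear_finsum[OF linear_maps_smult[OF c] closed[OF x]]
    using assms c x by (intro M.finsum_cong') (auto simp: linear_smult linear_closed)
qed

lemma multilinearI:
  assumes "\<And>as. length as = n \<Longrightarrow> set as \<subseteq> carrier M \<Longrightarrow> \<omega> as \<in> carrier M"
    and "\<And>as i. length as = n \<Longrightarrow> set as \<subseteq> carrier M \<Longrightarrow> i < n \<Longrightarrow> (\<lambda>x. \<omega> (as[i := x])) \<in> linear_maps"
  shows "multilinear R M n \<omega>"
  unfolding multilinear_def
proof (intro allI impI conjI ballI; elim conjE)
  fix as assume as: "length as = n" "set as \<subseteq> carrier M"
  then show "\<omega> as \<in> carrier M" by (rule assms(1))
  fix i x assume slot: "i < n" "x \<in> carrier M"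
  show "\<omega> (as[i := x \<oplus>\<^bsub>M\<^esub> y]) = \<omega> (as[i := x]) \<oplus>\<^bsub>M\<^esub> \<omega> (as[i := y])" if "y \<in> carrier M" for y
    using linear_add[OF assms(2)[OF as slot(1)] slot(2) that] .
  show "\<omega> (as[i := c \<odot>\<^bsub>M\<^esub> x]) = c \<odot>\<^bsub>M\<^esub> \<omega> (as[i := x])" if "c \<in> carrier R" for c
    using linear_smult[OF assms(2)[OF as slot(1)] that slot(2)] .
qed

lemma multilinear_closed:
  "multilinear R M n \<omega> \<Longrightarrow> length as = n \<Longrightarrow> set as \<subseteq> carrier M \<Longrightarrow> \<omega> as \<in> carrier M"
  by (simp add: multilinear_def)

lemma multilinear_slot_linear:
  assumes "multilinear R M n \<omega>" "length as = n" "set as \<subseteq> carrier M" "i < n"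
  shows "(\<lambda>x. \<omega> (as[i := x])) \<in> linear_maps"
proof (rule linear_mapsI)
  show "\<omega> (as[i := x]) \<in> carrier M" if "x \<in> carrier M" for x
    using assms that set_update_subset_insert[of as i x] by (intro multilinear_closed) auto
qed (use assms in \<open>auto simp: multilinear_def\<close>)

lemma multilinear_last_linear:
  assumes "multilinear R M (Suc n) \<omega>" "length as = n" "set as \<subseteq> carrier M"
  shows "(\<lambda>x. \<omega> (as @ [x])) \<in> linear_maps"
  using multilinear_slot_linear[OF assms(1), of "as @ [\<zero>\<^bsub>M\<^esub>]" n] assms(2,3) by (simp add: list_update_append)

lemma cochain_multilinear: "\<omega> \<in> cochains R M n \<Longrightarrow> multilinear R M n \<omega>"
  by (simp add: cochains_def)

lemma zero_cochain: "(\<lambda>as. \<zero>\<^bsub>M\<^esub>) \<in> cochains R M n"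
  by (simp add: cochains_def multilinear_def smult_r_null)

lemma smult_cochain:
  assumes \<omega>: "\<omega> \<in> cochains R M n" and c: "c \<in> carrier R"
  shows "(\<lambda>as. c \<odot>\<^bsub>M\<^esub> \<omega> as) \<in> cochains R M n"
  unfolding cochains_def
proof (intro CollectI conjI allI impI multilinearI; (elim conjE)?)
  note multilinear = cochain_multilinear[OF \<omega>]
  show "c \<odot>\<^bsub>M\<^esub> \<omega> as \<in> carrier M" if "length as = n" "set as \<subseteq> carrier M" for as
    using multilinear_closed[OF multilinear that] c by simp
  show "(\<lambda>x. c \<odot>\<^bsub>M\<^esub> \<omega> (as[i := x])) \<in> linear_maps"
    if "length as = n" "set as \<subseteq> carrier M" "i < n" for as i
    by (rule linear_maps_comp[OF linear_maps_smult[OF c] multilinear_slot_linear[OF multilinear that]])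
  show "c \<odot>\<^bsub>M\<^esub> \<omega> as = \<zero>\<^bsub>M\<^esub>" if "length as = n" "set as \<subseteq> carrier M" "\<not> distinct as" for as
    using \<omega> that c by (simp add: cochains_def smult_r_null)
qed

lemma shuffle_closed:
  assumes "a \<in> {1..i + j} \<rightarrow> carrier M" "\<sigma> \<in> shuffle_perms i j"
  shows "set (map (\<lambda>m. a (\<sigma> m)) [1..<Suc i]) \<subseteq> carrier M"
    and "set (map (\<lambda>m. a (\<sigma> m)) [Suc i..<Suc i + j]) \<subseteq> carrier M"
proof -
  have "a (\<sigma> m) \<in> carrier M" if "m \<in> {1..i + j}" for m
    using assms that permutes_in_image[of \<sigma> "{1..i + j}" m] by (auto simp: shuffle_perms_def)
  then show "set (map (\<lambda>m. a (\<sigma> m)) [1..<Suc i]) \<subseteq> carrier M"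
    "set (map (\<lambda>m. a (\<sigma> m)) [Suc i..<Suc i + j]) \<subseteq> carrier M" by auto
qed

lemma shuffle_identity_zero_left: "shuffle_identity M i j (\<lambda>as. \<zero>\<^bsub>M\<^esub>) \<omega>"
  by (simp add: shuffle_identity_def M.add.int_pow_one)

lemma shuffle_identity_zero_right:
  assumes \<omega>: "multilinear R M (Suc i) \<omega>"
  shows "shuffle_identity M (Suc i) j \<omega> (\<lambda>as. \<zero>\<^bsub>M\<^esub>)"
  unfolding shuffle_identity_def
proof
  fix a assume "a \<in> {1..Suc i + j - 1} \<rightarrow> carrier M"
  then have a: "a \<in> {1..i + j} \<rightarrow> carrier M" by simp
  have "\<omega> (map (\<lambda>m. a (\<sigma> m)) [1..<Suc i] @ [\<zero>\<^bsub>M\<^esub>]) = \<zero>\<^bsub>M\<^esub>" if "\<sigma> \<in> shuffle_perms i j" for \<sigma>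
    using linear_zero[OF multilinear_last_linear[OF \<omega> _ shuffle_closed(1)[OF a that]]] by simp
  then have "(\<Oplus>\<^bsub>M\<^esub>\<sigma>\<in>shuffle_perms i j. [sign \<sigma>] \<cdot>\<^bsub>M\<^esub> \<omega> (map (\<lambda>m. a (\<sigma> m)) [1..<Suc i] @ [\<zero>\<^bsub>M\<^esub>])) =
      (\<Oplus>\<^bsub>M\<^esub>\<sigma>\<in>shuffle_perms i j. \<zero>\<^bsub>M\<^esub>)"
    by (intro M.finsum_cong') (simp_all add: M.add.int_pow_one)
  then show "(\<Oplus>\<^bsub>M\<^esub>\<sigma>\<in>shuffle_perms (Suc i - 1) j. [sign \<sigma>] \<cdot>\<^bsub>M\<^esub>
      \<omega> (map (\<lambda>m. a (\<sigma> m)) [1..<Suc i] @ [\<zero>\<^bsub>M\<^esub>])) = \<zero>\<^bsub>M\<^esub>" by simp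
qed

lemma shuffle_identity_smult:
  assumes \<omega>: "multilinear R M (Suc i) \<omega>" and \<omega>': "multilinear R M j \<omega>'"
    and identity: "shuffle_identity M (Suc i) j \<omega> \<omega>'" and c: "c \<in> carrier R" and d: "d \<in> carrier R"
  shows "shuffle_identity M (Suc i) j (\<lambda>as. c \<odot>\<^bsub>M\<^esub> \<omega> as) (\<lambda>as. d \<odot>\<^bsub>M\<^esub> \<omega>' as)"
  unfolding shuffle_identity_def
proof
  fix a assume a: "a \<in> {1..Suc i + j - 1} \<rightarrow> carrier M"
  then have a': "a \<in> {1..i + j} \<rightarrow> carrier M" by simp
  let ?S = "shuffle_perms (Suc i - 1) j"
  let ?xs = "\<lambda>\<sigma>. map (\<lambda>m. a (\<sigma> m)) [1..<Suc i]" and ?ys = "\<lambda>\<sigma>. map (\<lambda>m. a (\<sigma> m)) [Suc i..<Suc i + j]"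
  have ys: "\<omega>' (?ys \<sigma>) \<in> carrier M" if "\<sigma> \<in> ?S" for \<sigma>
    using that by (intro multilinear_closed[OF \<omega>'] shuffle_closed[OF a']) simp_all
  have last: "(\<lambda>x. \<omega> (?xs \<sigma> @ [x])) \<in> linear_maps" if "\<sigma> \<in> ?S" for \<sigma>
    using that by (intro multilinear_last_linear[OF \<omega>] shuffle_closed[OF a']) simp_all
  have closed: "\<omega> (?xs \<sigma> @ [\<omega>' (?ys \<sigma>)]) \<in> carrier M" if "\<sigma> \<in> ?S" for \<sigma>
    using linear_closed[OF last[OF that] ys[OF that]] .
  have "(\<Oplus>\<^bsub>M\<^esub>\<sigma>\<in>?S. [sign \<sigma>] \<cdot>\<^bsub>M\<^esub> (c \<odot>\<^bsub>M\<^esub> \<omega> (?xs \<sigma> @ [d \<odot>\<^bsub>M\<^esub> \<omega>' (?ys \<sigma>)]))) =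
      (\<Oplus>\<^bsub>M\<^esub>\<sigma>\<in>?S. (c \<otimes>\<^bsub>R\<^esub> d) \<odot>\<^bsub>M\<^esub> ([sign \<sigma>] \<cdot>\<^bsub>M\<^esub> \<omega> (?xs \<sigma> @ [\<omega>' (?ys \<sigma>)])))"
  proof (rule M.finsum_cong')
    fix \<sigma> assume \<sigma>: "\<sigma> \<in> ?S"
    have "c \<odot>\<^bsub>M\<^esub> \<omega> (?xs \<sigma> @ [d \<odot>\<^bsub>M\<^esub> \<omega>' (?ys \<sigma>)]) = (c \<otimes>\<^bsub>R\<^esub> d) \<odot>\<^bsub>M\<^esub> \<omega> (?xs \<sigma> @ [\<omega>' (?ys \<sigma>)])"
      using linear_smult[OF last[OF \<sigma>] d ys[OF \<sigma>]] smult_assoc1[OF c d closed[OF \<sigma>]] by simp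
    then show "[sign \<sigma>] \<cdot>\<^bsub>M\<^esub> (c \<odot>\<^bsub>M\<^esub> \<omega> (?xs \<sigma> @ [d \<odot>\<^bsub>M\<^esub> \<omega>' (?ys \<sigma>)])) =
        (c \<otimes>\<^bsub>R\<^esub> d) \<odot>\<^bsub>M\<^esub> ([sign \<sigma>] \<cdot>\<^bsub>M\<^esub> \<omega> (?xs \<sigma> @ [\<omega>' (?ys \<sigma>)]))"
      using linear_int_pow[OF linear_maps_smult closed[OF \<sigma>]] c d by simp
  qed (use c d closed in auto)
  also have "\<dots> = (c \<otimes>\<^bsub>R\<^esub> d) \<odot>\<^bsub>M\<^esub> (\<Oplus>\<^bsub>M\<^esub>\<sigma>\<in>?S. [sign \<sigma>] \<cdot>\<^bsub>M\<^esub> \<omega> (?xs \<sigma> @ [\<omega>' (?ys \<sigma>)]))"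
    using c d closed by (intro linear_finsum[OF linear_maps_smult, symmetric]) auto
  also have "\<dots> = \<zero>\<^bsub>M\<^esub>"
    using identity a c d unfolding shuffle_identity_def by (simp add: smult_r_null del: upt_Suc)
  finally show "(\<Oplus>\<^bsub>M\<^esub>\<sigma>\<in>?S. [sign \<sigma>] \<cdot>\<^bsub>M\<^esub> (c \<odot>\<^bsub>M\<^esub> \<omega> (?xs \<sigma> @ [d \<odot>\<^bsub>M\<^esub> \<omega>' (?ys \<sigma>)]))) = \<zero>\<^bsub>M\<^esub>" .
qed

end

lemma (in abelian_group) signed_finsum_permutations_eq_zero:
  assumes P: "finite P" "i \<in> P" "j \<in> P" "i \<noteq> j"
    and f: "\<And>\<pi>. \<pi> permutes P \<Longrightarrow> f \<pi> \<in> carrier G"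
    and invariant: "\<And>\<pi>. \<pi> permutes P \<Longrightarrow> f (\<pi> \<circ> transpose i j) = f \<pi>"
  shows "(\<Oplus>\<pi>\<in>{\<pi>. \<pi> permutes P}. [sign \<pi>] \<cdot> f \<pi>) = \<zero>"
proof -
  let ?even = "{\<pi>. \<pi> permutes P \<and> evenperm \<pi>}" and ?odd = "{\<pi>. \<pi> permutes P \<and> \<not> evenperm \<pi>}"
  have closed: "(\<lambda>\<pi>. [sign \<pi>] \<cdot> f \<pi>) \<in> ?even \<rightarrow> carrier G" "(\<lambda>\<pi>. [sign \<pi>] \<cdot> f \<pi>) \<in> ?odd \<rightarrow> carrier G"
    "(\<lambda>\<pi>. \<ominus> ([sign \<pi>] \<cdot> f \<pi>)) \<in> ?even \<rightarrow> carrier G" using f by auto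
  have "finite ?even" "finite ?odd" using finite_permutations[OF P(1)] by auto
  moreover have "?even \<inter> ?odd = {}" by blast
  ultimately have "(\<Oplus>\<pi>\<in>?even \<union> ?odd. [sign \<pi>] \<cdot> f \<pi>) =
      (\<Oplus>\<pi>\<in>?even. [sign \<pi>] \<cdot> f \<pi>) \<oplus> (\<Oplus>\<pi>\<in>?odd. [sign \<pi>] \<cdot> f \<pi>)"
    using closed by (intro finsum_Un_disjoint)
  moreover have "(\<Oplus>\<pi>\<in>?odd. [sign \<pi>] \<cdot> f \<pi>) =
      (\<Oplus>\<pi>\<in>?even. [sign (\<pi> \<circ> transpose i j)] \<cdot> f (\<pi> \<circ> transpose i j))"
    using closed(2) unfolding odd_permutations_eq_image[OF P]
    by (rule finsum_reindex) (rule inj_on_inverseI[where g = "\<lambda>\<pi>. \<pi> \<circ> transpose i j"], simp add: comp_assoc)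
  moreover have "\<dots> = (\<Oplus>\<pi>\<in>?even. \<ominus> ([sign \<pi>] \<cdot> f \<pi>))"
    using closed(3) by (intro finsum_cong')
      (auto simp: invariant sign_compose_transpose P add.int_pow_neg f)
  moreover have "(\<Oplus>\<pi>\<in>?even. [sign \<pi>] \<cdot> f \<pi>) \<oplus> (\<Oplus>\<pi>\<in>?even. \<ominus> ([sign \<pi>] \<cdot> f \<pi>)) = (\<Oplus>\<pi>\<in>?even. \<zero>)"
    unfolding finsum_addf[OF closed(1,3), symmetric] using f by (intro finsum_cong') (auto simp: r_neg)
  moreover have "?even \<union> ?odd = {\<pi>. \<pi> permutes P}" by blast
  ultimately show ?thesis by (simp only:) simp
qed

section \<open>Products over finite families in algebras without unit\<close>

text \<open>
  Adjoining a unit to the multiplicative semigroup of \<open>U\<close> makes products over arbitrary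
  finite index sets available.
\<close>

definition adjoin_unit :: "('u, 'm) ring_scheme \<Rightarrow> 'u option monoid" where
  "adjoin_unit U = \<lparr>carrier = insert None (Some ` carrier U),
    monoid.mult = (\<lambda>x y. case x of None \<Rightarrow> y | Some a \<Rightarrow>
      (case y of None \<Rightarrow> x | Some b \<Rightarrow> Some (a \<otimes>\<^bsub>U\<^esub> b))),
    one = None\<rparr>"

definition set_prod :: "('u, 'm) ring_scheme \<Rightarrow> ('i \<Rightarrow> 'u) \<Rightarrow> 'i set \<Rightarrow> 'u" where
  "set_prod U f S = the (finprod (adjoin_unit U) (\<lambda>s. Some (f s)) S)"

definition finite_family :: "('u, 'm) ring_scheme \<Rightarrow> ('i \<Rightarrow> 'u) \<Rightarrow> 'i set \<Rightarrow> bool" where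
  "finite_family U f S \<longleftrightarrow> finite S \<and> S \<noteq> {} \<and> f \<in> S \<rightarrow> carrier U"

lemma finite_family_subset: "finite_family U f S \<Longrightarrow> T \<subseteq> S \<Longrightarrow> T \<noteq> {} \<Longrightarrow> finite_family U f T"
  by (auto simp: finite_family_def intro: finite_subset)

lemma finite_family_UN:
  assumes "finite I" "I \<noteq> {}" "\<And>i. i \<in> I \<Longrightarrow> finite_family U f (S i)"
  shows "finite_family U f (\<Union>i\<in>I. S i)"
  using assms by (fastforce simp: finite_family_def)

context assoc_comm_algebra
begin

lemma mult_right_linear: "x \<in> carrier U \<Longrightarrow> (\<lambda>y. y \<otimes>\<^bsub>U\<^esub> x) \<in> linear_maps"
  by (rule linear_mapsI) (simp_all add: mult_closed mult_distr mult_smult)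

lemma mult_left_linear:
  assumes "x \<in> carrier U"
  shows "(\<lambda>y. x \<otimes>\<^bsub>U\<^esub> y) \<in> linear_maps"
proof (rule linear_mapsI)
  fix y z assume "y \<in> carrier U" "z \<in> carrier U"
  then show "x \<otimes>\<^bsub>U\<^esub> (y \<oplus>\<^bsub>U\<^esub> z) = x \<otimes>\<^bsub>U\<^esub> y \<oplus>\<^bsub>U\<^esub> x \<otimes>\<^bsub>U\<^esub> z"
    using assms by (simp add: mult_comm[of x] mult_distr)
next
  fix c y assume "c \<in> carrier K" "y \<in> carrier U"
  then show "x \<otimes>\<^bsub>U\<^esub> (c \<odot>\<^bsub>U\<^esub> y) = c \<odot>\<^bsub>U\<^esub> (x \<otimes>\<^bsub>U\<^esub> y)"
    using assms by (simp add: mult_comm[of x] mult_smult)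
qed (simp add: mult_closed assms)

lemma comm_monoid_adjoin_unit: "comm_monoid (adjoin_unit U)"
  by (rule comm_monoidI)
    (auto simp: adjoin_unit_def mult_assoc mult_closed split: option.splits intro: mult_comm)

lemma adjoin_unit_simps:
  "Some x \<in> carrier (adjoin_unit U) \<longleftrightarrow> x \<in> carrier U"
  "Some x \<otimes>\<^bsub>adjoin_unit U\<^esub> Some y = Some (x \<otimes>\<^bsub>U\<^esub> y)"
  by (auto simp: adjoin_unit_def)

lemma
  assumes "finite_family U f S"
  shows finprod_adjoin_unit: "finprod (adjoin_unit U) (\<lambda>s. Some (f s)) S = Some (set_prod U f S)"
    and set_prod_closed: "set_prod U f S \<in> carrier U"
proof -
  interpret A: comm_monoid "adjoin_unit U" by (rule comm_monoid_adjoin_unit)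
  have "finite S" "S \<noteq> {}" "f \<in> S \<rightarrow> carrier U" using assms by (simp_all add: finite_family_def)
  then have "\<exists>x\<in>carrier U. finprod (adjoin_unit U) (\<lambda>s. Some (f s)) S = Some x"
  proof (induction S rule: finite_ne_induct)
    case (singleton s)
    then show ?case using A.finprod_insert[of "{}" s "\<lambda>s. Some (f s)"]
      by (simp add: adjoin_unit_simps)
  next
    case (insert s S)
    then obtain x where x: "x \<in> carrier U" "finprod (adjoin_unit U) (\<lambda>s. Some (f s)) S = Some x" by auto
    have "finprod (adjoin_unit U) (\<lambda>s. Some (f s)) (insert s S) = Some (f s \<otimes>\<^bsub>U\<^esub> x)"
      using insert x by (subst A.finprod_insert) (auto simp: adjoin_unit_simps)
    then show ?case using x insert by (auto intro: mult_closed)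
  qed
  then show "finprod (adjoin_unit U) (\<lambda>s. Some (f s)) S = Some (set_prod U f S)"
    "set_prod U f S \<in> carrier U"
    by (auto simp: set_prod_def)
qed

lemma set_prod_singleton: "f s \<in> carrier U \<Longrightarrow> set_prod U f {s} = f s"
proof -
  interpret A: comm_monoid "adjoin_unit U" by (rule comm_monoid_adjoin_unit)
  assume "f s \<in> carrier U"
  then show ?thesis
    unfolding set_prod_def using A.finprod_insert[of "{}" s "\<lambda>s. Some (f s)"]
    by (simp add: adjoin_unit_simps)
qed

lemma set_prod_Un:
  assumes S: "finite_family U f S" and T: "finite_family U f T" and disjoint: "S \<inter> T = {}"
  shows "set_prod U f (S \<union> T) = set_prod U f S \<otimes>\<^bsub>U\<^esub> set_prod U f T"
proof -
  interpret A: comm_monoid "adjoin_unit U" by (rule comm_monoid_adjoin_unit)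
  have "finprod (adjoin_unit U) (\<lambda>s. Some (f s)) (S \<union> T) =
      Some (set_prod U f S) \<otimes>\<^bsub>adjoin_unit U\<^esub> Some (set_prod U f T)"
    unfolding finprod_adjoin_unit[OF S, symmetric] finprod_adjoin_unit[OF T, symmetric]
    using S T disjoint by (intro A.finprod_Un_disjoint) (auto simp: adjoin_unit_simps finite_family_def)
  then show ?thesis by (simp add: set_prod_def adjoin_unit_simps)
qed

lemma set_prod_cong:
  assumes "\<And>s. s \<in> S \<Longrightarrow> f s = g s" "g \<in> S \<rightarrow> carrier U"
  shows "set_prod U f S = set_prod U g S"
proof -
  interpret A: comm_monoid "adjoin_unit U" by (rule comm_monoid_adjoin_unit)
  show ?thesis
    unfolding set_prod_def using assms
    by (intro arg_cong[where f = the] A.finprod_cong') (auto simp: adjoin_unit_simps)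
qed

lemma set_prod_insert:
  assumes "finite_family U f (insert s S)" "s \<notin> S" "S \<noteq> {}"
  shows "set_prod U f (insert s S) = f s \<otimes>\<^bsub>U\<^esub> set_prod U f S"
  using set_prod_Un[of f "{s}" S] set_prod_singleton[of f s] assms by (simp add: finite_family_def)

lemma set_prod_permute:
  assumes \<tau>: "\<tau> permutes S" and f: "f \<in> S \<rightarrow> carrier U"
  shows "set_prod U (f \<circ> \<tau>) S = set_prod U f S"
proof -
  interpret A: comm_monoid "adjoin_unit U" by (rule comm_monoid_adjoin_unit)
  have "finprod (adjoin_unit U) (\<lambda>s. Some (f s)) (\<tau> ` S) =
      finprod (adjoin_unit U) (\<lambda>s. Some ((f \<circ> \<tau>) s)) S"
    using f permutes_inj_on[OF \<tau>] permutes_image[OF \<tau>]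
    unfolding comp_def by (intro A.finprod_reindex) (auto simp: adjoin_unit_simps)
  then show ?thesis using permutes_image[OF \<tau>] by (simp add: set_prod_def)
qed

lemma nonempty_prod_cong: "(\<And>j. j \<le> k \<Longrightarrow> f j = g j) \<Longrightarrow> nonempty_prod U f k = nonempty_prod U g k"
  by (induction k) auto

lemma nonempty_prod_closed: "(\<And>j. j \<le> k \<Longrightarrow> f j \<in> carrier U) \<Longrightarrow> nonempty_prod U f k \<in> carrier U"
  by (induction k) (auto simp: mult_closed)

lemma nonempty_prod_eq_set_prod:
  "(\<And>j. j \<le> k \<Longrightarrow> f j \<in> carrier U) \<Longrightarrow> nonempty_prod U f k = set_prod U f {0..k}"
proof (induction k)
  case (Suc k)
  have family: "finite_family U f {0..k}" "finite_family U f (insert (Suc k) {0..k})"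
    using Suc.prems by (auto simp: finite_family_def)
  then show ?case
    using Suc set_prod_closed[OF family(1)] set_prod_insert[OF family(2)]
    by (simp add: atLeast0_atMost_Suc mult_comm)
qed (simp add: set_prod_singleton)

lemma nonempty_prod_permute:
  assumes \<tau>: "\<tau> permutes {0..k}" and f: "\<And>j. j \<le> k \<Longrightarrow> f j \<in> carrier U"
  shows "nonempty_prod U (f \<circ> \<tau>) k = nonempty_prod U f k"
proof -
  have "(f \<circ> \<tau>) j \<in> carrier U" if "j \<le> k" for j
    using f permutes_in_image[OF \<tau>, of j] that by simp
  then show ?thesis using f by (simp add: nonempty_prod_eq_set_prod set_prod_permute[OF \<tau>])
qed

lemma nonempty_prod_slot_linear:
  assumes "i \<le> k" "\<And>j. j \<le> k \<Longrightarrow> f j \<in> carrier U"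
  shows "(\<lambda>x. nonempty_prod U (f(i := x)) k) \<in> linear_maps"
  using assms
proof (induction k)
  case 0
  then show ?case by (auto intro: linear_mapsI)
next
  case (Suc k)
  show ?case
  proof (cases "i = Suc k")
    case True
    have "nonempty_prod U (f(i := x)) k = nonempty_prod U f k" for x
      using True by (intro nonempty_prod_cong) auto
    moreover have "nonempty_prod U f k \<in> carrier U" using Suc.prems by (intro nonempty_prod_closed) auto
    ultimately show ?thesis using mult_left_linear True by (simp del: fun_upd_apply add: fun_upd_same)
  next
    case False
    then show ?thesis
      using linear_maps_comp[OF mult_right_linear[of "f (Suc k)"] Suc.IH] Suc.prems by simp
  qed
qed

end

section \<open>Wronskians are cochains\<close>

context differential_algebra
begin

lemma D_linear: "D \<in> linear_maps"
  by (rule linear_mapsI) (simp_all add: D_closed D_add D_smult)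

lemma funpow_D_closed: "x \<in> carrier U \<Longrightarrow> (D ^^ n) x \<in> carrier U"
  by (rule linear_closed[OF linear_maps_funpow[OF D_linear]])

lemma wronskian_factor_closed:
  assumes "length us = Suc k" "set us \<subseteq> carrier U" "j \<le> k"
  shows "(D ^^ n) (us ! j) \<in> carrier U"
  using assms nth_mem[of j us] by (intro funpow_D_closed) auto

lemma wronskian_closed:
  assumes "length us = Suc k" "set us \<subseteq> carrier U"
  shows "wronskian U D k us \<in> carrier U"
  unfolding wronskian_def using wronskian_factor_closed[OF assms]
  by (intro M.finsum_closed Pi_I M.add.int_pow_closed nonempty_prod_closed)

lemma wronskian_slot_linear:
  assumes us: "length us = Suc k" "set us \<subseteq> carrier U" and i: "i \<le> k"
  shows "(\<lambda>x. wronskian U D k (us[i := x])) \<in> linear_maps"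
proof -
  have "nonempty_prod U (\<lambda>j. (D ^^ \<pi> j) (us[i := x] ! j)) k =
      nonempty_prod U ((\<lambda>j. (D ^^ \<pi> j) (us ! j))(i := (D ^^ \<pi> i) x)) k" for \<pi> x
    using us(1) i by (intro nonempty_prod_cong) (auto simp: nth_list_update)
  moreover have "(\<lambda>x. nonempty_prod U ((\<lambda>j. (D ^^ \<pi> j) (us ! j))(i := (D ^^ \<pi> i) x)) k) \<in> linear_maps" for \<pi>
    using wronskian_factor_closed[OF us] i
    by (intro linear_maps_comp[OF nonempty_prod_slot_linear linear_maps_funpow[OF D_linear]])
  ultimately show ?thesis
    unfolding wronskian_def by (auto intro!: linear_maps_finsum linear_maps_comp[OF linear_maps_int_pow])
qed

lemma wronskian_alternating:
  assumes us: "length us = Suc k" "set us \<subseteq> carrier U" and "\<not> distinct us"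
  shows "wronskian U D k us = \<zero>\<^bsub>U\<^esub>"
proof -
  obtain i j where ij: "i \<le> k" "j \<le> k" "i \<noteq> j" "us ! i = us ! j"
    using assms by (auto simp: distinct_conv_nth less_Suc_eq_le)
  let ?t = "transpose i j" and ?f = "\<lambda>\<pi> j. (D ^^ \<pi> j) (us ! j)"
  have t: "?t permutes {0..k}" using ij by (intro permutes_swap_id) auto
  have "us ! m = us ! ?t m" for m using ij(4) by (simp add: transpose_def)
  then have "?f (\<pi> \<circ> ?t) = ?f \<pi> \<circ> ?t" for \<pi> by (simp add: fun_eq_iff)
  then show ?thesis
    unfolding wronskian_def using ij wronskian_factor_closed[OF us]
    by (intro M.signed_finsum_permutations_eq_zero[of _ i j])
      (auto intro!: nonempty_prod_closed nonempty_prod_permute[OF t])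
qed

lemma wronskian_cochain: "wronskian U D k \<in> cochains K U (Suc k)"
  unfolding cochains_def
  by (auto intro!: multilinearI wronskian_closed wronskian_slot_linear wronskian_alternating)

lemma D_set_prod:
  assumes "finite_family U f S"
  shows "D (set_prod U f S) = (\<Oplus>\<^bsub>U\<^esub>s\<in>S. set_prod U (f(s := D (f s))) S)"
proof -
  have "finite S" "S \<noteq> {}" "f \<in> S \<rightarrow> carrier U" using assms by (simp_all add: finite_family_def)
  then show ?thesis
  proof (induction S rule: finite_ne_induct)
    case (singleton s)
    then show ?case by (simp add: set_prod_singleton D_closed)
  next
    case (insert x S)
    let ?D = "\<lambda>s. f(s := D (f s))"
    have fx: "f x \<in> carrier U" using insert.prems by simp
    have family: "finite_family U f S" "finite_family U f (insert x S)"
      using insert by (auto simp: finite_family_def)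
    have family_D: "finite_family U (?D s) S" "finite_family U (?D s) (insert x S)" if "s \<in> insert x S" for s
      using insert that by (auto simp: finite_family_def Pi_iff D_closed)
    note closed = set_prod_closed[OF family(1)] set_prod_closed[OF family_D(1)]
    have first: "set_prod U (?D x) (insert x S) = D (f x) \<otimes>\<^bsub>U\<^esub> set_prod U f S"
    proof -
      have "set_prod U (?D x) S = set_prod U f S"
        by (rule set_prod_cong) (use insert in auto)
      then show ?thesis using insert family_D(2)[of x] by (simp add: set_prod_insert)
    qed
    have rest: "set_prod U (?D s) (insert x S) = f x \<otimes>\<^bsub>U\<^esub> set_prod U (?D s) S" if "s \<in> S" for s
      using insert that family_D(2)[of s] by (subst set_prod_insert) auto
    have "D (set_prod U f (insert x S)) =
        D (f x) \<otimes>\<^bsub>U\<^esub> set_prod U f S \<oplus>\<^bsub>U\<^esub> f x \<otimes>\<^bsub>U\<^esub> (\<Oplus>\<^bsub>U\<^esub>s\<in>S. set_prod U (?D s) S)"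
      using insert family fx closed by (simp add: set_prod_insert D_mult del: fun_upd_apply)
    also have "f x \<otimes>\<^bsub>U\<^esub> (\<Oplus>\<^bsub>U\<^esub>s\<in>S. set_prod U (?D s) S) = (\<Oplus>\<^bsub>U\<^esub>s\<in>S. set_prod U (?D s) (insert x S))"
      using closed fx by (subst linear_finsum[OF mult_left_linear])
        (auto intro!: M.finsum_cong' simp: rest mult_closed)
    finally show ?case
      using insert.hyps closed fx by (subst M.finsum_insert) (auto simp: first rest mult_closed D_closed)
  qed
qed

end

section \<open>Symbols of multilinear differential expressions\<close>

type_synonym symbol = "(nat \<Rightarrow>\<^sub>0 nat) \<Rightarrow>\<^sub>0 int"

definition var :: "nat \<Rightarrow> symbol" where
  "var s = frag_of (Poly_Mapping.single s 1)"

definition vars_in :: "nat set \<Rightarrow> symbol \<Rightarrow> bool" where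
  "vars_in S c \<longleftrightarrow> Poly_Mapping.keys c \<subseteq> {e. Poly_Mapping.keys e \<subseteq> S}"

lemma vars_in_0 [simp]: "vars_in S 0"
  by (simp add: vars_in_def)

lemma vars_in_1 [simp]: "vars_in S 1"
  by (simp add: vars_in_def)

lemma vars_in_var: "s \<in> S \<Longrightarrow> vars_in S (var s)"
  by (simp add: vars_in_def var_def)

lemma vars_in_add: "vars_in S c \<Longrightarrow> vars_in S d \<Longrightarrow> vars_in S (c + d)"
  unfolding vars_in_def using Poly_Mapping.keys_add[of c d] by blast

lemma vars_in_mult:
  assumes "vars_in S c" "vars_in S d"
  shows "vars_in S (c * d)"
  unfolding vars_in_def
proof
  fix e assume "e \<in> Poly_Mapping.keys (c * d)"
  then obtain e1 e2 where "e = e1 + e2" "e1 \<in> Poly_Mapping.keys c" "e2 \<in> Poly_Mapping.keys d"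
    using keys_mult[of c d] by blast
  then show "e \<in> {e. Poly_Mapping.keys e \<subseteq> S}"
    using assms Poly_Mapping.keys_add[of e1 e2] unfolding vars_in_def by blast
qed

lemma vars_in_sum: "(\<And>i. i \<in> I \<Longrightarrow> vars_in S (f i)) \<Longrightarrow> vars_in S (\<Sum>i\<in>I. f i)"
  by (induction I rule: infinite_finite_induct) (auto intro: vars_in_add)

lemma vars_in_prod: "(\<And>i. i \<in> I \<Longrightarrow> vars_in S (f i)) \<Longrightarrow> vars_in S (\<Prod>i\<in>I. f i)"
  by (induction I rule: infinite_finite_induct) (auto intro: vars_in_mult)

lemma vars_in_power: "vars_in S c \<Longrightarrow> vars_in S (c ^ n)"
  by (induction n) (auto intro: vars_in_mult)

lemma vars_in_of_int: "vars_in S (of_int n)"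
  unfolding vars_in_def single_of_int[symmetric] by (simp add: keys_single)

lemma vars_in_mono: "vars_in S c \<Longrightarrow> S \<subseteq> T \<Longrightarrow> vars_in T c"
  unfolding vars_in_def by blast

lemma vars_in_alternant: "(\<And>i. i \<in> P \<Longrightarrow> vars_in S (z i)) \<Longrightarrow> vars_in S (alternant P e z)"
  unfolding alternant_def
  by (intro vars_in_sum vars_in_mult vars_in_of_int vars_in_prod vars_in_power)

lemma lookup_of_int_mult:
  "Poly_Mapping.lookup (of_int n * c) e = n * Poly_Mapping.lookup (c :: symbol) e"
proof -
  have "of_int n * c = Poly_Mapping.map ((*) n) c"
    unfolding mult_map_scale_conv_mult by (simp only: single_of_int[symmetric] of_int_eq_id id_apply)
  then show ?thesis by (simp add: Poly_Mapping.map.rep_eq when_def)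
qed

context differential_algebra
begin

definition monomial_value :: "(nat \<Rightarrow> 'c) \<Rightarrow> nat set \<Rightarrow> (nat \<Rightarrow>\<^sub>0 nat) \<Rightarrow> 'c" where
  "monomial_value a S e = set_prod U (\<lambda>s. (D ^^ Poly_Mapping.lookup e s) (a s)) S"

definition symbol_value :: "(nat \<Rightarrow> 'c) \<Rightarrow> nat set \<Rightarrow> symbol \<Rightarrow> 'c" where
  "symbol_value a S c =
    (\<Oplus>\<^bsub>U\<^esub>e\<in>Poly_Mapping.keys c. [Poly_Mapping.lookup c e] \<cdot>\<^bsub>U\<^esub> monomial_value a S e)"

lemma finite_family_funpow_D:
  "finite_family U a S \<Longrightarrow> finite_family U (\<lambda>s. (D ^^ n s) (a s)) S"
  by (auto simp: finite_family_def intro: funpow_D_closed)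

lemma monomial_value_closed: "finite_family U a S \<Longrightarrow> monomial_value a S e \<in> carrier U"
  unfolding monomial_value_def by (intro set_prod_closed finite_family_funpow_D)

lemma monomial_value_mult:
  assumes S: "finite_family U a S" and T: "finite_family U a T" and disjoint: "S \<inter> T = {}"
    and e: "Poly_Mapping.keys e \<subseteq> S" "Poly_Mapping.keys e' \<subseteq> T"
  shows "monomial_value a S e \<otimes>\<^bsub>U\<^esub> monomial_value a T e' = monomial_value a (S \<union> T) (e + e')"
proof -
  have e_T: "Poly_Mapping.lookup e s = 0" if "s \<in> T" for s
    using that e disjoint by (auto simp: not_in_keys_iff_lookup_eq_zero[symmetric])
  have e'_S: "Poly_Mapping.lookup e' s = 0" if "s \<in> S" for s
    using that e disjoint by (auto simp: not_in_keys_iff_lookup_eq_zero[symmetric])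
  have "monomial_value a S e = monomial_value a S (e + e')"
    "monomial_value a T e' = monomial_value a T (e + e')"
    unfolding monomial_value_def using S T
    by (auto intro!: set_prod_cong simp: finite_family_def Pi_iff lookup_add e_T e'_S funpow_D_closed)
  then show ?thesis
    unfolding monomial_value_def using S T disjoint
    by (simp only:) (intro set_prod_Un[symmetric] finite_family_funpow_D)
qed

lemma D_monomial_value:
  assumes "finite_family U a S"
  shows "D (monomial_value a S e) =
    (\<Oplus>\<^bsub>U\<^esub>s\<in>S. monomial_value a S (Poly_Mapping.single s 1 + e))"
proof -
  let ?f = "\<lambda>e s. (D ^^ Poly_Mapping.lookup e s) (a s)"
  have "(?f e)(s := D (?f e s)) = ?f (Poly_Mapping.single s 1 + e)" for s
    by (auto simp: fun_eq_iff lookup_add lookup_single)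
  then show ?thesis
    unfolding monomial_value_def D_set_prod[OF finite_family_funpow_D[OF assms]] by simp
qed

lemma symbol_value_closed: "finite_family U a S \<Longrightarrow> symbol_value a S c \<in> carrier U"
  unfolding symbol_value_def by (intro M.finsum_closed) (auto simp: monomial_value_closed)

lemma symbol_value_superset:
  assumes "finite_family U a S" "finite A" "Poly_Mapping.keys c \<subseteq> A"
  shows "symbol_value a S c =
    (\<Oplus>\<^bsub>U\<^esub>e\<in>A. [Poly_Mapping.lookup c e] \<cdot>\<^bsub>U\<^esub> monomial_value a S e)"
  unfolding symbol_value_def using assms
  by (intro M.add.finprod_mono_neutral_cong_left)
    (auto simp: monomial_value_closed not_in_keys_iff_lookup_eq_zero add_pow_int_ge)

lemma symbol_value_0 [simp]: "symbol_value a S 0 = \<zero>\<^bsub>U\<^esub>"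
  by (simp add: symbol_value_def)

lemma symbol_value_frag_of:
  "finite_family U a S \<Longrightarrow> symbol_value a S (frag_of e) = monomial_value a S e"
  by (simp add: symbol_value_def keys_frag_of monomial_value_closed)

lemma symbol_value_add:
  assumes family: "finite_family U a S"
  shows "symbol_value a S (c + d) = symbol_value a S c \<oplus>\<^bsub>U\<^esub> symbol_value a S d"
proof -
  let ?A = "Poly_Mapping.keys c \<union> Poly_Mapping.keys d"
  note superset = symbol_value_superset[OF family, of ?A]
  have "symbol_value a S (c + d) =
      (\<Oplus>\<^bsub>U\<^esub>e\<in>?A. [Poly_Mapping.lookup (c + d) e] \<cdot>\<^bsub>U\<^esub> monomial_value a S e)"
    using Poly_Mapping.keys_add[of c d] by (intro superset) auto
  also have "\<dots> = (\<Oplus>\<^bsub>U\<^esub>e\<in>?A. [Poly_Mapping.lookup c e] \<cdot>\<^bsub>U\<^esub> monomial_value a S e \<oplus>\<^bsub>U\<^esub>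
      [Poly_Mapping.lookup d e] \<cdot>\<^bsub>U\<^esub> monomial_value a S e)"
    using family by (intro M.finsum_cong') (auto simp: monomial_value_closed lookup_add M.add.int_pow_mult)
  also have "\<dots> = symbol_value a S c \<oplus>\<^bsub>U\<^esub> symbol_value a S d"
    using family by (subst M.finsum_addf) (auto simp: monomial_value_closed superset)
  finally show ?thesis .
qed

lemma symbol_value_of_int_mult:
  assumes family: "finite_family U a S"
  shows "symbol_value a S (of_int n * c) = [n] \<cdot>\<^bsub>U\<^esub> symbol_value a S c"
proof -
  have "symbol_value a S (of_int n * c) =
      (\<Oplus>\<^bsub>U\<^esub>e\<in>Poly_Mapping.keys c. [Poly_Mapping.lookup (of_int n * c) e] \<cdot>\<^bsub>U\<^esub> monomial_value a S e)"
    using family by (intro symbol_value_superset) (auto simp: in_keys_iff lookup_of_int_mult)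
  also have "\<dots> = (\<Oplus>\<^bsub>U\<^esub>e\<in>Poly_Mapping.keys c. [n] \<cdot>\<^bsub>U\<^esub> ([Poly_Mapping.lookup c e] \<cdot>\<^bsub>U\<^esub> monomial_value a S e))"
    using family by (intro M.finsum_cong')
      (auto simp: monomial_value_closed lookup_of_int_mult M.add.int_pow_pow mult.commute[of n])
  also have "\<dots> = [n] \<cdot>\<^bsub>U\<^esub> symbol_value a S c"
    unfolding symbol_value_def using family
    by (intro linear_finsum[OF linear_maps_int_pow, symmetric]) (auto simp: monomial_value_closed)
  finally show ?thesis .
qed

lemma symbol_value_diff:
  assumes "finite_family U a S"
  shows "symbol_value a S (c - d) = symbol_value a S c \<ominus>\<^bsub>U\<^esub> symbol_value a S d"
proof -
  have "symbol_value a S (c - d) = symbol_value a S (c + of_int (-1) * d)" by simp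
  also have "\<dots> = symbol_value a S c \<oplus>\<^bsub>U\<^esub> [(-1::int)] \<cdot>\<^bsub>U\<^esub> symbol_value a S d"
    by (simp only: symbol_value_add[OF assms] symbol_value_of_int_mult[OF assms])
  finally show ?thesis
    using assms by (simp add: M.add.int_pow_neg symbol_value_closed a_minus_def)
qed

lemma symbol_value_sum:
  assumes "finite_family U a S"
  shows "symbol_value a S (\<Sum>i\<in>I. f i) = (\<Oplus>\<^bsub>U\<^esub>i\<in>I. symbol_value a S (f i))"
  by (induction I rule: infinite_finite_induct)
    (auto simp: symbol_value_add symbol_value_closed assms)

lemma symbol_value_signed_sum:
  assumes "finite_family U a S" "\<And>\<sigma>. \<sigma> \<in> I \<Longrightarrow> w \<sigma> = symbol_value a S (f \<sigma>)"
  shows "(\<Oplus>\<^bsub>U\<^esub>\<sigma>\<in>I. [sign \<sigma>] \<cdot>\<^bsub>U\<^esub> w \<sigma>) = symbol_value a S (\<Sum>\<sigma>\<in>I. of_int (sign \<sigma>) * f \<sigma>)"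
  unfolding symbol_value_sum[OF assms(1)] using assms
  by (intro M.finsum_cong') (auto simp: symbol_value_of_int_mult symbol_value_closed)

lemma symbol_value_mult:
  assumes S: "finite_family U a S" and T: "finite_family U a T" and disjoint: "S \<inter> T = {}"
    and c: "vars_in S c" and d: "vars_in T d"
  shows "symbol_value a S c \<otimes>\<^bsub>U\<^esub> symbol_value a T d = symbol_value a (S \<union> T) (c * d)"
proof -
  have ST: "finite_family U a (S \<union> T)" using S T by (auto simp: finite_family_def)
  note closed = symbol_value_closed[OF S] symbol_value_closed[OF T]
  note right_linear = mult_right_linear[OF symbol_value_closed[OF T]]
  show ?thesis
    using c unfolding vars_in_def
  proof (induction c rule: frag_induction)
    case zero
    show ?case using linear_zero[OF right_linear] by simp
  next
    case (one e)
    note left_linear = mult_left_linear[OF symbol_value_closed[OF S]]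
    show ?case
      using d unfolding vars_in_def
    proof (induction d rule: frag_induction)
      case zero
      show ?case using linear_zero[OF left_linear] by simp
    next
      case (one e')
      then show ?case
        using \<open>e \<in> _\<close> S T disjoint ST by (simp add: symbol_value_frag_of monomial_value_mult mult_single)
    next
      case (diff d d')
      then show ?case
        using linear_minus[OF left_linear] T ST by (simp add: symbol_value_diff right_diff_distrib closed)
    qed
  next
    case (diff c c')
    then show ?case
      using linear_minus[OF right_linear] S ST by (simp add: symbol_value_diff left_diff_distrib closed)
  qed
qed

lemma D_symbol_value:
  assumes S: "finite_family U a S"
  shows "D (symbol_value a S c) = symbol_value a S ((\<Sum>s\<in>S. var s) * c)"
proof -
  have "Poly_Mapping.keys c \<subseteq> UNIV" by simp
  then show ?thesis
  proof (induction c rule: frag_induction)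
    case zero
    show ?case by (simp add: linear_zero[OF D_linear])
  next
    case (one e)
    have "symbol_value a S ((\<Sum>s\<in>S. var s) * frag_of e) =
        symbol_value a S (\<Sum>s\<in>S. frag_of (Poly_Mapping.single s 1 + e))"
      by (simp add: sum_distrib_right var_def mult_single)
    also have "\<dots> = (\<Oplus>\<^bsub>U\<^esub>s\<in>S. monomial_value a S (Poly_Mapping.single s 1 + e))"
      by (simp add: symbol_value_sum[OF S] symbol_value_frag_of[OF S])
    finally show ?case by (simp add: symbol_value_frag_of[OF S] D_monomial_value[OF S])
  next
    case (diff c d)
    then show ?case
      by (simp add: symbol_value_diff[OF S] right_diff_distrib linear_minus[OF D_linear]
          symbol_value_closed[OF S])
  qed
qed

lemma funpow_D_symbol_value:
  assumes "finite_family U a S"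
  shows "(D ^^ n) (symbol_value a S c) = symbol_value a S ((\<Sum>s\<in>S. var s) ^ n * c)"
  by (induction n) (simp_all add: D_symbol_value[OF assms] mult.assoc)

lemma symbol_value_dvd:
  assumes p: "has_characteristic K p" and S: "finite_family U a S" and dvd: "of_nat p dvd c"
  shows "symbol_value a S c = \<zero>\<^bsub>U\<^esub>"
proof -
  obtain d where "c = of_nat p * d" using dvd by (rule dvdE)
  then have "symbol_value a S c = [int p] \<cdot>\<^bsub>U\<^esub> symbol_value a S d"
    using symbol_value_of_int_mult[OF S, of "int p" d] by simp
  also have "\<dots> = [p] \<cdot>\<^bsub>U\<^esub> symbol_value a S d" by (simp add: add_pow_int_ge)
  also have "\<dots> = ([p] \<cdot>\<^bsub>K\<^esub> \<one>\<^bsub>K\<^esub>) \<odot>\<^bsub>U\<^esub> symbol_value a S d"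
  proof -
    have "[n] \<cdot>\<^bsub>U\<^esub> x = ([n] \<cdot>\<^bsub>K\<^esub> \<one>\<^bsub>K\<^esub>) \<odot>\<^bsub>U\<^esub> x" if "x \<in> carrier U" for n :: nat and x
      using that by (induction n) (auto simp: smult_l_distr smult_l_null)
    then show ?thesis by (simp add: symbol_value_closed[OF S])
  qed
  also have "[p] \<cdot>\<^bsub>K\<^esub> \<one>\<^bsub>K\<^esub> = \<zero>\<^bsub>K\<^esub>" using p by (simp add: has_characteristic_def)
  finally show ?thesis by (simp add: smult_l_null symbol_value_closed[OF S])
qed

section \<open>Symbols of Wronskians\<close>

lemma nonempty_prod_symbol_value:
  assumes "\<And>j. j \<le> k \<Longrightarrow> finite_family U a (S j)" "\<And>j. j \<le> k \<Longrightarrow> vars_in (S j) (c j)"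
    and "\<And>i j. i < j \<Longrightarrow> j \<le> k \<Longrightarrow> S i \<inter> S j = {}"
  shows "nonempty_prod U (\<lambda>j. symbol_value a (S j) (c j)) k =
    symbol_value a (\<Union>j\<in>{0..k}. S j) (\<Prod>j\<in>{0..k}. c j)"
  using assms
proof (induction k)
  case (Suc k)
  have "nonempty_prod U (\<lambda>j. symbol_value a (S j) (c j)) (Suc k) =
      symbol_value a (\<Union>j\<in>{0..k}. S j) (\<Prod>j\<in>{0..k}. c j) \<otimes>\<^bsub>U\<^esub> symbol_value a (S (Suc k)) (c (Suc k))"
    using Suc by simp
  also have "\<dots> = symbol_value a ((\<Union>j\<in>{0..k}. S j) \<union> S (Suc k)) ((\<Prod>j\<in>{0..k}. c j) * c (Suc k))"
  proof (rule symbol_value_mult)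
    show "finite_family U a (\<Union>j\<in>{0..k}. S j)"
      using Suc.prems(1) by (intro finite_family_UN) auto
    show "(\<Union>j\<in>{0..k}. S j) \<inter> S (Suc k) = {}"
    proof -
      have "\<forall>j\<in>{0..k}. S j \<inter> S (Suc k) = {}" using Suc.prems(3) by simp
      then show ?thesis by blast
    qed
    show "vars_in (\<Union>j\<in>{0..k}. S j) (\<Prod>j\<in>{0..k}. c j)"
      by (intro vars_in_prod vars_in_mono[OF Suc.prems(2)]) auto
  qed (use Suc.prems in auto)
  finally show ?case by (simp add: atLeast0_atMost_Suc Un_commute mult.commute)
qed simp

lemma wronskian_symbol_value:
  assumes family: "\<And>j. j \<le> k \<Longrightarrow> finite_family U a (S j)" and c: "\<And>j. j \<le> k \<Longrightarrow> vars_in (S j) (c j)"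
    and disjoint: "\<And>i j. i < j \<Longrightarrow> j \<le> k \<Longrightarrow> S i \<inter> S j = {}"
    and us: "\<And>j. j \<le> k \<Longrightarrow> us ! j = symbol_value a (S j) (c j)"
  shows "wronskian U D k us = symbol_value a (\<Union>j\<in>{0..k}. S j)
    (vandermonde k (\<lambda>j. \<Sum>s\<in>S j. var s) * (\<Prod>j\<in>{0..k}. c j))"
proof -
  let ?S = "\<Union>j\<in>{0..k}. S j" and ?c = "\<lambda>\<pi> j. (\<Sum>s\<in>S j. var s) ^ \<pi> j * c j"
  have "nonempty_prod U (\<lambda>j. (D ^^ \<pi> j) (us ! j)) k = symbol_value a ?S (\<Prod>j\<in>{0..k}. ?c \<pi> j)" for \<pi>
  proof -
    have "nonempty_prod U (\<lambda>j. (D ^^ \<pi> j) (us ! j)) k = nonempty_prod U (\<lambda>j. symbol_value a (S j) (?c \<pi> j)) k"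
      using family us by (intro nonempty_prod_cong) (simp add: funpow_D_symbol_value)
    also have "\<dots> = symbol_value a ?S (\<Prod>j\<in>{0..k}. ?c \<pi> j)"
      using family disjoint c by (intro nonempty_prod_symbol_value)
        (auto intro!: vars_in_mult vars_in_power vars_in_sum vars_in_var)
    finally show ?thesis .
  qed
  moreover have "finite_family U a ?S"
    using family by (intro finite_family_UN) auto
  ultimately have "wronskian U D k us =
      symbol_value a ?S (\<Sum>\<pi> | \<pi> permutes {0..k}. of_int (sign \<pi>) * (\<Prod>j\<in>{0..k}. ?c \<pi> j))"
    unfolding wronskian_def by (intro symbol_value_signed_sum)
  then show ?thesis
    by (simp add: alternant_def sum_distrib_right prod.distrib mult.assoc)
qed

lemma symbol_value_singleton: "a s \<in> carrier U \<Longrightarrow> symbol_value a {s} 1 = a s"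
  using symbol_value_frag_of[of a "{s}" 0]
  by (simp add: finite_family_def monomial_value_def set_prod_singleton)

lemma wronskian_map:
  assumes "distinct ys" "length ys = Suc q" "finite_family U a (set ys)"
  shows "wronskian U D q (map a ys) = symbol_value a (set ys) (vandermonde q (\<lambda>j. var (ys ! j)))"
proof -
  have "a (ys ! j) \<in> carrier U" if "j \<le> q" for j
    using assms that nth_mem[of j ys] by (auto simp: finite_family_def)
  then have "wronskian U D q (map a ys) = symbol_value a (\<Union>j\<in>{0..q}. {ys ! j})
      (vandermonde q (\<lambda>j. \<Sum>s\<in>{ys ! j}. var s) * (\<Prod>j\<in>{0..q}. 1))"
    using assms by (intro wronskian_symbol_value)
      (auto simp: symbol_value_singleton nth_eq_iff_index_eq finite_family_def)
  moreover have "(\<Union>j\<in>{0..q}. {ys ! j}) = set ys"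
    using assms by (auto simp: set_conv_nth less_Suc_eq_le)
  ultimately show ?thesis by simp
qed

text \<open>The entry \<open>zs ! i\<close> is a placeholder for the inner Wronskian.\<close>

lemma wronskian_nested:
  assumes zs: "distinct zs" "length zs = Suc k" and ys: "distinct ys" "length ys = Suc q"
    and i: "i \<le> k" and disjoint: "set ys \<inter> (set zs - {zs ! i}) = {}"
    and family: "finite_family U a (set zs - {zs ! i} \<union> set ys)"
  shows "wronskian U D k ((map a zs)[i := wronskian U D q (map a ys)]) =
    symbol_value a (set zs - {zs ! i} \<union> set ys)
      (vandermonde k ((\<lambda>j. var (zs ! j))(i := \<Sum>y\<in>set ys. var y)) * vandermonde q (\<lambda>j. var (ys ! j)))"
proof -
  let ?S = "(\<lambda>j. {zs ! j})(i := set ys)"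
  let ?c = "(\<lambda>j. 1)(i := vandermonde q (\<lambda>j. var (ys ! j)))"
  have zs_image: "set zs - {zs ! i} = (\<lambda>j. zs ! j) ` ({0..k} - {i})"
    using zs i by (auto simp: set_conv_nth less_Suc_eq_le nth_eq_iff_index_eq)
  then have other: "zs ! j \<in> set zs - {zs ! i}" if "j \<le> k" "j \<noteq> i" for j using that by auto
  have family_ys: "finite_family U a (set ys)" using ys by (intro finite_family_subset[OF family]) auto
  have "wronskian U D k ((map a zs)[i := wronskian U D q (map a ys)]) =
    symbol_value a (\<Union>j\<in>{0..k}. ?S j) (vandermonde k (\<lambda>j. \<Sum>s\<in>?S j. var s) * (\<Prod>j\<in>{0..k}. ?c j))"
  proof (rule wronskian_symbol_value)
    show "finite_family U a (?S j)" if "j \<le> k" for j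
      using that other[of j] family_ys by (auto intro: finite_family_subset[OF family])
    show "vars_in (?S j) (?c j)" for j
      using ys by (auto intro!: vars_in_alternant vars_in_var)
    show "?S j \<inter> ?S j' = {}" if "j < j'" "j' \<le> k" for j j'
      using that zs disjoint other[of j] other[of j'] by (auto simp: nth_eq_iff_index_eq)
    show "(map a zs)[i := wronskian U D q (map a ys)] ! j = symbol_value a (?S j) (?c j)" if "j \<le> k" for j
    proof (cases "j = i")
      case False
      then have "a (zs ! j) \<in> carrier U" using other[OF that] family by (auto simp: finite_family_def)
      then show ?thesis using False that zs by (simp add: symbol_value_singleton)
    qed (use zs i ys family_ys in \<open>simp add: wronskian_map\<close>)
  qed
  moreover have "(\<Union>j\<in>{0..k}. ?S j) = set zs - {zs ! i} \<union> set ys"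
    unfolding zs_image using i by (auto split: if_splits)
  moreover have "(\<Prod>j\<in>{0..k}. ?c j) = vandermonde q (\<lambda>j. var (ys ! j))"
    using i by (simp add: fun_upd_def)
  moreover have "(\<lambda>j. \<Sum>s\<in>?S j. var s) = (\<lambda>j. var (zs ! j))(i := \<Sum>y\<in>set ys. var y)"
    by auto
  ultimately show ?thesis by (simp only:)
qed

lemma wronskian_nested_last:
  assumes \<sigma>: "inj_on \<sigma> {1..k + q + 1}" and family: "finite_family U a (\<sigma> ` {1..k + q + 1})"
  shows "wronskian U D k (map (\<lambda>m. a (\<sigma> m)) [1..<k + 1] @
      [wronskian U D q (map (\<lambda>m. a (\<sigma> m)) [k + 1..<k + q + 2])]) =
    symbol_value a (\<sigma> ` {1..k + q + 1}) (nested_vandermonde k q (var \<circ> \<sigma>))"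
proof -
  let ?zs = "map \<sigma> [1..<k + 2]" and ?ys = "map \<sigma> [k + 1..<k + q + 2]"
  have distinct: "distinct ?zs" "distinct ?ys"
    using inj_on_subset[OF \<sigma>, of "{1..<k + 2}"] inj_on_subset[OF \<sigma>, of "{k + 1..<k + q + 2}"]
    by (auto simp: distinct_map subset_iff simp del: upt_Suc)
  have set_ys: "set ?ys = \<sigma> ` {k + 1..k + q + 1}" by (auto simp: less_Suc_eq_le simp del: upt_Suc)
  have "set ?zs - {?zs ! k} = \<sigma> ` {1..k + 1} - \<sigma> ` {k + 1}" by (auto simp: less_Suc_eq_le simp del: upt_Suc)
  also have "\<dots> = \<sigma> ` ({1..k + 1} - {k + 1})"
    by (rule inj_on_image_set_diff[OF \<sigma>, symmetric]) auto
  also have "{1..k + 1} - {k + 1} = {1..k}" by auto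
  finally have set_zs: "set ?zs - {?zs ! k} = \<sigma> ` {1..k}" .
  have disjoint: "set ?ys \<inter> (set ?zs - {?zs ! k}) = {}"
    unfolding set_ys set_zs by (subst inj_on_image_Int[OF \<sigma>, symmetric]) auto
  have union: "set ?zs - {?zs ! k} \<union> set ?ys = \<sigma> ` {1..k + q + 1}"
    unfolding set_ys set_zs image_Un[symmetric] by (rule arg_cong[where f = "image \<sigma>"]) auto
  have sum: "(\<Sum>y\<in>set ?ys. var y) = (\<Sum>m\<in>{k + 1..k + q + 1}. (var \<circ> \<sigma>) m)"
    unfolding set_ys by (rule sum.reindex) (rule inj_on_subset[OF \<sigma>], auto)
  have outer: "vandermonde k ((\<lambda>j. var (?zs ! j))(k := w)) =
      alternant {1..k + 1} (\<lambda>i. i - 1) ((var \<circ> \<sigma>)(k + 1 := w))" for w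
  proof -
    have "{1..k + 1} = Suc ` {0..k}" by (simp add: image_Suc_atLeastAtMost)
    then show ?thesis by (simp only:) (subst alternant_reindex, auto intro!: alternant_cong simp del: upt_Suc)
  qed
  have inner: "vandermonde q (\<lambda>j. var (?ys ! j)) = alternant {k + 1..k + q + 1} (\<lambda>m. m - (k + 1)) (var \<circ> \<sigma>)"
  proof -
    have "{k + 1..k + q + 1} = (+) (k + 1) ` {0..q}" unfolding image_add_atLeastAtMost by (simp add: add_ac)
    then show ?thesis by (simp only:) (subst alternant_reindex, auto intro!: alternant_cong simp del: upt_Suc)
  qed
  have "map (\<lambda>m. a (\<sigma> m)) [1..<k + 1] @ [w] = (map a ?zs)[k := w]" for w
    by (simp add: o_def list_update_append)
  then show ?thesis
    using wronskian_nested[OF distinct(1) _ distinct(2) _ _ disjoint, where a = a] family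
    unfolding nested_vandermonde_def outer[symmetric] inner[symmetric] sum[symmetric] union
    by (simp add: o_def del: upt_Suc)
qed

end

section \<open>The Wronskian identities\<close>

context differential_algebra
begin

lemma shuffle_identity_wronskian:
  assumes "k > 0" "q > 0"
  shows "shuffle_identity U (k + 1) (q + 1) (wronskian U D k) (wronskian U D q)"
  unfolding shuffle_identity_def
proof
  let ?N = "{1..k + q + 1}"
  fix a assume "a \<in> {1..k + 1 + (q + 1) - 1} \<rightarrow> carrier U"
  then have family: "finite_family U a ?N" by (simp add: finite_family_def)
  have "wronskian U D k (map (\<lambda>m. a (\<sigma> m)) [1..<k + 1] @
        [wronskian U D q (map (\<lambda>m. a (\<sigma> m)) [k + 1..<k + q + 2])]) =
      symbol_value a ?N (nested_vandermonde k q (var \<circ> \<sigma>))"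
    if "\<sigma> \<in> shuffle_perms k (q + 1)" for \<sigma>
  proof -
    have "\<sigma> permutes ?N" using that by (simp add: shuffle_perms_def)
    then show ?thesis
      using wronskian_nested_last[of \<sigma> k q a, OF permutes_inj_on] family by (simp only: permutes_image)
  qed
  then have "(\<Oplus>\<^bsub>U\<^esub>\<sigma>\<in>shuffle_perms k (q + 1). [sign \<sigma>] \<cdot>\<^bsub>U\<^esub>
      wronskian U D k (map (\<lambda>m. a (\<sigma> m)) [1..<k + 1] @
        [wronskian U D q (map (\<lambda>m. a (\<sigma> m)) [k + 1..<k + q + 2])])) =
      symbol_value a ?N (\<Sum>\<sigma>\<in>shuffle_perms k (q + 1). of_int (sign \<sigma>) * nested_vandermonde k q (var \<circ> \<sigma>))"
    by (rule symbol_value_signed_sum[OF family])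
  also have "\<dots> = \<zero>\<^bsub>U\<^esub>"
    unfolding nested_vandermonde_shuffle_sum[OF assms] by (rule symbol_value_0)
  finally show "(\<Oplus>\<^bsub>U\<^esub>\<sigma>\<in>shuffle_perms (k + 1 - 1) (q + 1). [sign \<sigma>] \<cdot>\<^bsub>U\<^esub>
      wronskian U D k (map (\<lambda>m. a (\<sigma> m)) [1..<k + 1] @
        [wronskian U D q (map (\<lambda>m. a (\<sigma> m)) [k + 1..<k + 1 + (q + 1)])])) = \<zero>\<^bsub>U\<^esub>"
    by (simp add: add.assoc del: upt_Suc)
qed

lemma homotopical_n_lie_wronskian:
  assumes "k > 0"
  shows "homotopical_n_lie K U (k + 1) (wronskian U D k)"
  unfolding homotopical_n_lie_def
  using wronskian_cochain[of k] shuffle_identity_wronskian[OF assms assms] by simp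

lemma homotopical_lie_wronskian:
  assumes l: "l \<in> {2..} \<rightarrow> carrier K"
  shows "homotopical_lie K U (\<lambda>i us. if i \<le> 1 then \<zero>\<^bsub>U\<^esub> else l i \<odot>\<^bsub>U\<^esub> wronskian U D (i - 1) us)"
    (is "homotopical_lie K U ?\<omega>")
proof -
  have unary: "?\<omega> 1 = (\<lambda>us. \<zero>\<^bsub>U\<^esub>)" by simp
  have higher: "?\<omega> (Suc k) = (\<lambda>us. l (Suc k) \<odot>\<^bsub>U\<^esub> wronskian U D k us)" if "k > 0" for k
    using that by simp
  have closed: "l (Suc k) \<in> carrier K" if "k > 0" for k using l that by auto
  have multilinear: "multilinear K U (Suc k) (wronskian U D k)" for k
    by (rule cochain_multilinear[OF wronskian_cochain])
  have cochain: "?\<omega> (Suc k) \<in> cochains K U (Suc k)" for k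
  proof (cases "k = 0")
    case False
    then show ?thesis by (simp add: smult_cochain wronskian_cochain closed)
  qed (simp add: zero_cochain)
  have "shuffle_identity U (Suc i) (Suc j) (?\<omega> (Suc i)) (?\<omega> (Suc j))" for i j
  proof -
    consider (left) "i = 0" | (right) "j = 0" | (both) "i > 0" "j > 0" by blast
    then show ?thesis
    proof cases
      case left
      then show ?thesis using shuffle_identity_zero_left unary by simp
    next
      case right
      then show ?thesis using shuffle_identity_zero_right[OF cochain_multilinear[OF cochain]] unary by simp
    next
      case both
      then show ?thesis
        unfolding higher[OF both(1)] higher[OF both(2)] using shuffle_identity_wronskian[OF both]
        by (intro shuffle_identity_smult multilinear closed) simp_all
    qed
  qed
  then show ?thesis
    using cochain unfolding homotopical_lie_def by (metis One_nat_def Suc_le_D)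
qed

lemma left_commutative_wronskian:
  assumes p: "has_characteristic K p"
    and dvd: "of_nat p dvd (\<Sum>\<sigma> | \<sigma> permutes {1..2 * k}. of_int (sign \<sigma>) * nested_vandermonde k k (var \<circ> \<sigma>))"
  shows "left_commutative U k (wronskian U D k)"
  unfolding left_commutative_def
proof
  let ?N = "{1..2 * k + 1}"
  fix a assume "a \<in> ?N \<rightarrow> carrier U"
  then have family: "finite_family U a ?N" by (simp add: finite_family_def)
  have "wronskian U D k (map (\<lambda>m. a (\<sigma> m)) [1..<k + 1] @
        [wronskian U D k (map (\<lambda>m. a (\<sigma> m)) [k + 1..<2 * k + 1] @ [a (2 * k + 1)])]) =
      symbol_value a ?N (nested_vandermonde k k (var \<circ> \<sigma>))"
    if \<sigma>: "\<sigma> permutes {1..2 * k}" for \<sigma>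
  proof -
    have "\<sigma> (2 * k + 1) = 2 * k + 1" using permutes_not_in[OF \<sigma>] by simp
    then have "map (\<lambda>m. a (\<sigma> m)) [k + 1..<2 * k + 1] @ [a (2 * k + 1)] = map (\<lambda>m. a (\<sigma> m)) [k + 1..<k + k + 2]"
      by (simp add: mult_2)
    moreover have "\<sigma> permutes ?N" using \<sigma> by (rule permutes_subset) auto
    moreover have "?N = {1..k + k + 1}" by auto
    ultimately show ?thesis
      using wronskian_nested_last[of \<sigma> k k a, OF permutes_inj_on] family by (simp only: permutes_image)
  qed
  then have "(\<Oplus>\<^bsub>U\<^esub>\<sigma>\<in>{\<sigma>. \<sigma> permutes {1..2 * k}}. [sign \<sigma>] \<cdot>\<^bsub>U\<^esub>
      wronskian U D k (map (\<lambda>m. a (\<sigma> m)) [1..<k + 1] @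
        [wronskian U D k (map (\<lambda>m. a (\<sigma> m)) [k + 1..<2 * k + 1] @ [a (2 * k + 1)])])) =
      symbol_value a ?N (\<Sum>\<sigma> | \<sigma> permutes {1..2 * k}. of_int (sign \<sigma>) * nested_vandermonde k k (var \<circ> \<sigma>))"
    by (intro symbol_value_signed_sum[OF family]) simp
  also have "\<dots> = \<zero>\<^bsub>U\<^esub>" by (rule symbol_value_dvd[OF p family dvd])
  finally show "(\<Oplus>\<^bsub>U\<^esub>\<sigma>\<in>{\<sigma>. \<sigma> permutes {1..2 * k}}. [sign \<sigma>] \<cdot>\<^bsub>U\<^esub>
      wronskian U D k (map (\<lambda>m. a (\<sigma> m)) [1..<k + 1] @
        [wronskian U D k (map (\<lambda>m. a (\<sigma> m)) [k + 1..<2 * k + 1] @ [a (2 * k + 1)])])) = \<zero>\<^bsub>U\<^esub>" .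
qed

lemma left_commutative_wronskian_if:
  assumes p: "has_characteristic K p" and k: "k > 0" "k \<noteq> 1" "k \<noteq> 2 \<or> p = 2"
  shows "left_commutative U k (wronskian U D k)"
proof (rule left_commutative_wronskian[OF p], cases "k = 2")
  case True
  then show "of_nat p dvd (\<Sum>\<sigma> | \<sigma> permutes {1..2 * k}. of_int (sign \<sigma>) * nested_vandermonde k k (var \<circ> \<sigma>))"
    using k even_nested_vandermonde_left_commutative_sum[of var] by simp
next
  case False
  then have "k \<ge> 3" using k by simp
  then show "of_nat p dvd (\<Sum>\<sigma> | \<sigma> permutes {1..2 * k}. of_int (sign \<sigma>) * nested_vandermonde k k (var \<circ> \<sigma>))"
    by (simp only: nested_vandermonde_left_commutative_sum dvd_0_right)
qed

lemma wronskian_lie_lhs: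
  assumes family: "finite_family U a {0..2 * k}"
  shows "wronskian U D k (map a [0..<k] @ [wronskian U D k (map a [k..<2 * k + 1])]) =
    symbol_value a {0..2 * k}
      (vandermonde k (var(k := \<Sum>j\<in>{0..k}. var (k + j))) * vandermonde k (\<lambda>j. var (k + j)))"
proof -
  have sets: "set [k..<2 * k + 1] = {k..2 * k}"
    "set [0..<k + 1] - {[0..<k + 1] ! k} \<union> {k..2 * k} = {0..2 * k}"
    "{k..2 * k} \<inter> (set [0..<k + 1] - {[0..<k + 1] ! k}) = {}" by (auto simp del: upt_Suc)
  have sum: "(\<Sum>y\<in>{k..2 * k}. var y) = (\<Sum>j\<in>{0..k}. var (k + j))"
    using sum.shift_bounds_cl_nat_ivl[of var 0 k k] by (simp add: mult_2 add.commute)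
  have cong: "vandermonde k ((\<lambda>j. var ([0..<k + 1] ! j))(k := w)) = vandermonde k (var(k := w))"
    "vandermonde k (\<lambda>j. var ([k..<2 * k + 1] ! j)) = vandermonde k (\<lambda>j. var (k + j))" for w
    by (auto intro!: alternant_cong simp del: upt_Suc)
  have "map a [0..<k] @ [w] = (map a [0..<k + 1])[k := w]" for w
    by (simp add: list_update_append)
  then show ?thesis
    using wronskian_nested[of "[0..<k + 1]" k "[k..<2 * k + 1]" k k a] family
    unfolding sets sum cong by (simp del: upt_Suc)
qed

lemma wronskian_lie_rhs:
  assumes family: "finite_family U a {0..2 * k}" and i: "i \<le> k"
  shows "wronskian U D k ((map a [k..<2 * k + 1])[i := wronskian U D k (map a [0..<k] @ [a (k + i)])]) =
    symbol_value a {0..2 * k}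
      (vandermonde k ((\<lambda>j. var (k + j))(i := var (k + i) + (\<Sum>j\<in>{0..<k}. var j))) *
       vandermonde k (var(k := var (k + i))))"
proof -
  have sets: "set ([0..<k] @ [k + i]) = insert (k + i) {0..<k}"
    "set [k..<2 * k + 1] - {[k..<2 * k + 1] ! i} \<union> insert (k + i) {0..<k} = {0..2 * k}"
    "insert (k + i) {0..<k} \<inter> (set [k..<2 * k + 1] - {[k..<2 * k + 1] ! i}) = {}"
    using i by (auto simp del: upt_Suc)
  have cong: "vandermonde k ((\<lambda>j. var ([k..<2 * k + 1] ! j))(i := w)) = vandermonde k ((\<lambda>j. var (k + j))(i := w))"
    "vandermonde k (\<lambda>j. var (([0..<k] @ [k + i]) ! j)) = vandermonde k (var(k := var (k + i)))" for w
    by (auto intro!: alternant_cong simp: nth_append simp del: upt_Suc)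
  show ?thesis
    using wronskian_nested[of "[k..<2 * k + 1]" k "[0..<k] @ [k + i]" k i a] family i
    unfolding sets cong by (simp add: add.commute del: upt_Suc)
qed

lemma wronskian_lie_defect:
  fixes k a defines "as \<equiv> map a [0..<k]" and "bs \<equiv> map a [k..<2 * k + 1]"
  assumes family: "finite_family U a {0..2 * k}"
  shows "wronskian U D k (as @ [wronskian U D k bs]) \<ominus>\<^bsub>U\<^esub>
      (\<Oplus>\<^bsub>U\<^esub>i\<in>{..<k + 1}. wronskian U D k (bs[i := wronskian U D k (as @ [bs ! i])])) =
    symbol_value a {0..2 * k} (lie_defect k var (\<lambda>j. var (k + j)))"
proof -
  have "wronskian U D k (bs[i := wronskian U D k (as @ [bs ! i])]) = symbol_value a {0..2 * k}
      (vandermonde k ((\<lambda>j. var (k + j))(i := var (k + i) + (\<Sum>j\<in>{0..<k}. var j))) *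
       vandermonde k (var(k := var (k + i))))" if "i \<in> {..<k + 1}" for i
    using that wronskian_lie_rhs[OF family, of i] by (simp add: as_def bs_def del: upt_Suc)
  moreover have "{..<k + 1} = {0..k}" by auto
  ultimately have "(\<Oplus>\<^bsub>U\<^esub>i\<in>{..<k + 1}. wronskian U D k (bs[i := wronskian U D k (as @ [bs ! i])])) =
      symbol_value a {0..2 * k} (\<Sum>i\<in>{0..k}.
        vandermonde k ((\<lambda>j. var (k + j))(i := var (k + i) + (\<Sum>j\<in>{0..<k}. var j))) *
        vandermonde k (var(k := var (k + i))))"
    unfolding symbol_value_sum[OF family]
    by (intro M.finsum_cong') (simp_all add: symbol_value_closed[OF family])
  then show ?thesis
    unfolding lie_defect_def symbol_value_diff[OF family]
    using wronskian_lie_lhs[OF family] by (simp only: as_def bs_def)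
qed

lemma n_lie_wronskian:
  assumes p: "has_characteristic K p" and dvd: "of_nat p dvd lie_defect k var (\<lambda>j. var (k + j))"
  shows "n_lie K U (k + 1) (wronskian U D k)"
  unfolding n_lie_def
proof (intro conjI allI impI; (elim conjE)?)
  show "wronskian U D k \<in> cochains K U (k + 1)" using wronskian_cochain[of k] by simp
  fix as bs
  assume as: "length as = k + 1 - 1" "set as \<subseteq> carrier U" and bs: "length bs = k + 1" "set bs \<subseteq> carrier U"
  let ?a = "(!) (as @ bs)"
  let ?lhs = "wronskian U D k (as @ [wronskian U D k bs])"
  let ?rhs = "\<Oplus>\<^bsub>U\<^esub>i\<in>{..<k + 1}. wronskian U D k (bs[i := wronskian U D k (as @ [bs ! i])])"
  have "?a s \<in> carrier U" if "s \<le> 2 * k" for s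
    using that as bs nth_mem[of s "as @ bs"] by auto
  then have family: "finite_family U ?a {0..2 * k}" by (simp add: finite_family_def)
  have args: "map ?a [0..<k] = as" "map ?a [k..<2 * k + 1] = bs"
    using as bs by (auto intro!: nth_equalityI simp: nth_append simp del: upt_Suc)
  have "?lhs \<ominus>\<^bsub>U\<^esub> ?rhs = symbol_value ?a {0..2 * k} (lie_defect k var (\<lambda>j. var (k + j)))"
    using wronskian_lie_defect[OF family] unfolding args .
  also have "\<dots> = \<zero>\<^bsub>U\<^esub>" by (rule symbol_value_dvd[OF p family dvd])
  finally have "?lhs \<ominus>\<^bsub>U\<^esub> ?rhs = \<zero>\<^bsub>U\<^esub>" .
  moreover have closed: "wronskian U D k (as @ [x]) \<in> carrier U" if "x \<in> carrier U" for x
    using as that by (intro wronskian_closed) auto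
  moreover have "?rhs \<in> carrier U"
  proof (intro M.finsum_closed Pi_I)
    fix i assume "i \<in> {..<k + 1}"
    then have "bs ! i \<in> carrier U" using bs nth_mem[of i bs] by auto
    then show "wronskian U D k (bs[i := wronskian U D k (as @ [bs ! i])]) \<in> carrier U"
      using bs set_update_subset_insert[of bs i] closed by (intro wronskian_closed) auto
  qed
  moreover have "?lhs \<in> carrier U" using bs by (intro closed wronskian_closed) auto
  ultimately show "?lhs = ?rhs" using M.minus_equality[of ?lhs "\<ominus>\<^bsub>U\<^esub> ?rhs"] by (simp add: a_minus_def)
qed

lemma n_lie_wronskian_if:
  assumes p: "has_characteristic K p"
    and k: "k = 1 \<or> k = 2 \<and> p = 2 \<or> k = 3 \<and> p = 3 \<or> k = 4 \<and> p = 2"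
  shows "n_lie K U (k + 1) (wronskian U D k)"
proof (rule n_lie_wronskian[OF p])
  show "of_nat p dvd lie_defect k var (\<lambda>j. var (k + j))"
    using k
    by (elim disjE conjE) (simp_all only: lie_defect_1 dvd_0_right of_nat_numeral
      two_dvd_lie_defect_2 three_dvd_lie_defect_3 two_dvd_lie_defect_4)
qed

end

section \<open>The algebra of divided powers\<close>

locale divided_powers = differential_algebra +
  fixes x :: "nat \<Rightarrow> 'c"
  assumes x_closed: "x n \<in> carrier U"
    and D_x_0: "D (x 0) = \<zero>\<^bsub>U\<^esub>"
    and D_x_Suc: "D (x (Suc n)) = x n"
    and x_mult: "x m \<otimes>\<^bsub>U\<^esub> x n = [((m + n) choose n)] \<cdot>\<^bsub>U\<^esub> x (m + n)"
    and x_faithful: "[c] \<cdot>\<^bsub>U\<^esub> x 0 = \<zero>\<^bsub>U\<^esub> \<Longrightarrow> [(c::nat)] \<cdot>\<^bsub>K\<^esub> \<one>\<^bsub>K\<^esub> = \<zero>\<^bsub>K\<^esub>"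

text \<open>
  The Hurwitz product of sequences, for which the shift is a derivation; in closed form the
  \<open>n\<close>-th entry is the sum of \<open>(n choose i) f\<^sub>i g\<^sub>n\<^sub>-\<^sub>i\<close>.
\<close>

fun hurwitz_mult :: "('k, 'm) ring_scheme \<Rightarrow> nat \<Rightarrow> (nat \<Rightarrow> 'k) \<Rightarrow> (nat \<Rightarrow> 'k) \<Rightarrow> 'k" where
  "hurwitz_mult K 0 f g = f 0 \<otimes>\<^bsub>K\<^esub> g 0"
| "hurwitz_mult K (Suc n) f g =
    hurwitz_mult K n (\<lambda>i. f (Suc i)) g \<oplus>\<^bsub>K\<^esub> hurwitz_mult K n f (\<lambda>i. g (Suc i))"

definition finite_sequences :: "('k, 'm) ring_scheme \<Rightarrow> (nat \<Rightarrow> 'k) set" where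
  "finite_sequences K = {f. (\<forall>n. f n \<in> carrier K) \<and> (\<exists>N. \<forall>n\<ge>N. f n = \<zero>\<^bsub>K\<^esub>)}"

definition unit_sequence :: "('k, 'm) ring_scheme \<Rightarrow> nat \<Rightarrow> nat \<Rightarrow> 'k" where
  "unit_sequence K m n = (if n = m then \<one>\<^bsub>K\<^esub> else \<zero>\<^bsub>K\<^esub>)"

definition hurwitz_algebra :: "('k, 'm) ring_scheme \<Rightarrow> ('k, nat \<Rightarrow> 'k) module" where
  "hurwitz_algebra K = \<lparr>carrier = finite_sequences K, monoid.mult = (\<lambda>f g n. hurwitz_mult K n f g),
    one = unit_sequence K 0, zero = (\<lambda>n. \<zero>\<^bsub>K\<^esub>), add = (\<lambda>f g n. f n \<oplus>\<^bsub>K\<^esub> g n),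
    smult = (\<lambda>c f n. c \<otimes>\<^bsub>K\<^esub> f n)\<rparr>"

context cring
begin

lemma hurwitz_mult_closed:
  "(\<And>n. f n \<in> carrier R) \<Longrightarrow> (\<And>n. g n \<in> carrier R) \<Longrightarrow> hurwitz_mult R n f g \<in> carrier R"
  by (induction n arbitrary: f g) auto

lemma hurwitz_mult_comm:
  assumes "\<And>n. f n \<in> carrier R" "\<And>n. g n \<in> carrier R"
  shows "hurwitz_mult R n f g = hurwitz_mult R n g f"
  using assms
proof (induction n arbitrary: f g)
  case 0
  then show ?case by (simp add: m_comm)
next
  case (Suc n)
  have "hurwitz_mult R (Suc n) f g =
      hurwitz_mult R n g (\<lambda>i. f (Suc i)) \<oplus> hurwitz_mult R n (\<lambda>i. g (Suc i)) f"
    using Suc.IH[of "\<lambda>i. f (Suc i)" g] Suc.IH[of f "\<lambda>i. g (Suc i)"] Suc.prems by simp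
  then show ?case using Suc.prems by (simp add: a_comm hurwitz_mult_closed)
qed

lemma hurwitz_mult_add_left:
  assumes "\<And>n. f n \<in> carrier R" "\<And>n. g n \<in> carrier R" "\<And>n. h n \<in> carrier R"
  shows "hurwitz_mult R n (\<lambda>i. f i \<oplus> g i) h = hurwitz_mult R n f h \<oplus> hurwitz_mult R n g h"
  using assms
proof (induction n arbitrary: f g h)
  case 0
  then show ?case by (simp add: l_distr)
next
  case (Suc n)
  then show ?case
    using Suc.IH[of "\<lambda>i. f (Suc i)" "\<lambda>i. g (Suc i)" h] Suc.IH[of f g "\<lambda>i. h (Suc i)"]
    by (simp add: a_ac hurwitz_mult_closed)
qed

lemma hurwitz_mult_add_right:
  assumes "\<And>n. f n \<in> carrier R" "\<And>n. g n \<in> carrier R" "\<And>n. h n \<in> carrier R"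
  shows "hurwitz_mult R n h (\<lambda>i. f i \<oplus> g i) = hurwitz_mult R n h f \<oplus> hurwitz_mult R n h g"
  using assms hurwitz_mult_add_left[of f g h n]
  by (simp add: hurwitz_mult_comm[of h])

lemma hurwitz_mult_smult_left:
  assumes "c \<in> carrier R" "\<And>n. f n \<in> carrier R" "\<And>n. g n \<in> carrier R"
  shows "hurwitz_mult R n (\<lambda>i. c \<otimes> f i) g = c \<otimes> hurwitz_mult R n f g"
  using assms
proof (induction n arbitrary: f g)
  case 0
  then show ?case by (simp add: m_assoc)
next
  case (Suc n)
  then show ?case
    using Suc.IH[of "\<lambda>i. f (Suc i)" g] Suc.IH[of f "\<lambda>i. g (Suc i)"]
    by (simp add: r_distr hurwitz_mult_closed)
qed

lemma hurwitz_mult_assoc: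
  assumes "\<And>n. f n \<in> carrier R" "\<And>n. g n \<in> carrier R" "\<And>n. h n \<in> carrier R"
  shows "hurwitz_mult R n (\<lambda>i. hurwitz_mult R i f g) h = hurwitz_mult R n f (\<lambda>i. hurwitz_mult R i g h)"
  using assms
proof (induction n arbitrary: f g h)
  case 0
  then show ?case by (simp add: m_assoc)
next
  case (Suc n)
  note closed = Suc.prems hurwitz_mult_closed
  have "hurwitz_mult R (Suc n) (\<lambda>i. hurwitz_mult R i f g) h =
      (hurwitz_mult R n (\<lambda>i. hurwitz_mult R i (\<lambda>i. f (Suc i)) g) h \<oplus>
       hurwitz_mult R n (\<lambda>i. hurwitz_mult R i f (\<lambda>i. g (Suc i))) h) \<oplus>
      hurwitz_mult R n (\<lambda>i. hurwitz_mult R i f g) (\<lambda>i. h (Suc i))"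
    by (simp add: hurwitz_mult_add_left closed)
  also have "\<dots> = (hurwitz_mult R n (\<lambda>i. f (Suc i)) (\<lambda>i. hurwitz_mult R i g h) \<oplus>
       hurwitz_mult R n f (\<lambda>i. hurwitz_mult R i (\<lambda>i. g (Suc i)) h)) \<oplus>
      hurwitz_mult R n f (\<lambda>i. hurwitz_mult R i g (\<lambda>i. h (Suc i)))"
    using Suc.IH[of "\<lambda>i. f (Suc i)" g h] Suc.IH[of f "\<lambda>i. g (Suc i)" h] Suc.IH[of f g "\<lambda>i. h (Suc i)"]
      Suc.prems by simp
  also have "\<dots> = hurwitz_mult R (Suc n) f (\<lambda>i. hurwitz_mult R i g h)"
    by (simp add: hurwitz_mult_add_right closed a_assoc)
  finally show ?case .
qed

lemma hurwitz_mult_zero: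
  "(\<And>n. g n \<in> carrier R) \<Longrightarrow> hurwitz_mult R n (\<lambda>i. \<zero>) g = \<zero>"
  by (induction n arbitrary: g) auto

lemma hurwitz_mult_eq_0:
  assumes "\<And>n. f n \<in> carrier R" "\<And>n. g n \<in> carrier R"
    and "\<And>n. n \<ge> a \<Longrightarrow> f n = \<zero>" "\<And>n. n \<ge> b \<Longrightarrow> g n = \<zero>" and "n \<ge> a + b"
  shows "hurwitz_mult R n f g = \<zero>"
  using assms
proof (induction n arbitrary: f g a b)
  case 0
  then show ?case by simp
next
  case (Suc n)
  show ?case
  proof (cases "a = 0 \<or> b = 0")
    case True
    then consider (left) "f = (\<lambda>i. \<zero>)" | (right) "g = (\<lambda>i. \<zero>)" using Suc.prems(3,4) by fastforce
    then show ?thesis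
    proof cases
      case left
      then show ?thesis using hurwitz_mult_zero[OF Suc.prems(2)] by simp
    next
      case right
      then show ?thesis using hurwitz_mult_zero[OF Suc.prems(1)] Suc.prems(1)
        by (simp only: hurwitz_mult_comm[of f "\<lambda>i. \<zero>"] zero_closed)
    qed
  next
    case False
    have "hurwitz_mult R n (\<lambda>i. f (Suc i)) g = \<zero>"
      using False Suc.prems by (intro Suc.IH[where a = "a - 1" and b = b]) auto
    moreover have "hurwitz_mult R n f (\<lambda>i. g (Suc i)) = \<zero>"
      using False Suc.prems by (intro Suc.IH[where a = a and b = "b - 1"]) auto
    ultimately show ?thesis by simp
  qed
qed

lemma hurwitz_mult_unit_sequences:
  "hurwitz_mult R r (unit_sequence R m) (unit_sequence R n) =
    (if r = m + n then [((m + n) choose n)] \<cdot> \<one> else \<zero>)"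
proof (induction r arbitrary: m n)
  case 0
  show ?case by (auto simp: unit_sequence_def)
next
  case (Suc r)
  have shift: "(\<lambda>i. unit_sequence R m (Suc i)) = (case m of 0 \<Rightarrow> (\<lambda>i. \<zero>) | Suc m' \<Rightarrow> unit_sequence R m')" for m
    by (auto simp: unit_sequence_def split: nat.splits)
  have zero: "hurwitz_mult R r (\<lambda>i. \<zero>) (unit_sequence R m) = \<zero>"
    "hurwitz_mult R r (unit_sequence R m) (\<lambda>i. \<zero>) = \<zero>" for m
    by (auto simp: unit_sequence_def hurwitz_mult_comm[of "unit_sequence R m"] intro!: hurwitz_mult_zero)
  show ?case
    by (cases m; cases n) (simp_all add: shift Suc zero add.nat_pow_mult add.commute)
qed

lemma finite_sequencesI:
  "(\<And>n. f n \<in> carrier R) \<Longrightarrow> (\<And>n. n \<ge> N \<Longrightarrow> f n = \<zero>) \<Longrightarrow> f \<in> finite_sequences R"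
  by (auto simp: finite_sequences_def)

lemma finite_sequencesE:
  assumes "f \<in> finite_sequences R"
  obtains N where "\<And>n. f n \<in> carrier R" "\<And>n. n \<ge> N \<Longrightarrow> f n = \<zero>"
  using assms by (auto simp: finite_sequences_def)

lemma finite_sequences_closed: "f \<in> finite_sequences R \<Longrightarrow> f n \<in> carrier R"
  by (simp add: finite_sequences_def)

lemma finite_sequences_zero: "(\<lambda>n. \<zero>) \<in> finite_sequences R"
  by (rule finite_sequencesI[of _ 0]) simp_all

lemma finite_sequences_unit: "unit_sequence R m \<in> finite_sequences R"
  by (rule finite_sequencesI[of _ "Suc m"]) (simp_all add: unit_sequence_def)

lemma finite_sequences_add:
  assumes "f \<in> finite_sequences R" "g \<in> finite_sequences R"
  shows "(\<lambda>n. f n \<oplus> g n) \<in> finite_sequences R"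
proof -
  obtain M N where "\<And>n. n \<ge> M \<Longrightarrow> f n = \<zero>" "\<And>n. n \<ge> N \<Longrightarrow> g n = \<zero>"
    using assms by (metis finite_sequencesE)
  then show ?thesis
    using assms by (intro finite_sequencesI[of _ "max M N"]) (simp_all add: finite_sequences_closed)
qed

lemma finite_sequences_smult:
  assumes "f \<in> finite_sequences R" "c \<in> carrier R"
  shows "(\<lambda>n. c \<otimes> f n) \<in> finite_sequences R"
  using assms by (force simp: finite_sequences_def)

lemma finite_sequences_minus: "f \<in> finite_sequences R \<Longrightarrow> (\<lambda>n. \<ominus> f n) \<in> finite_sequences R"
  by (force simp: finite_sequences_def)

lemma finite_sequences_shift: "f \<in> finite_sequences R \<Longrightarrow> (\<lambda>n. f (Suc n)) \<in> finite_sequences R"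
  by (auto simp: finite_sequences_def) (meson le_SucI)

lemma finite_sequences_hurwitz_mult:
  assumes "f \<in> finite_sequences R" "g \<in> finite_sequences R"
  shows "(\<lambda>n. hurwitz_mult R n f g) \<in> finite_sequences R"
proof -
  obtain M where f: "\<And>n. f n \<in> carrier R" "\<And>n. n \<ge> M \<Longrightarrow> f n = \<zero>"
    using finite_sequencesE[OF assms(1)] by blast
  obtain N where g: "\<And>n. g n \<in> carrier R" "\<And>n. n \<ge> N \<Longrightarrow> g n = \<zero>"
    using finite_sequencesE[OF assms(2)] by blast
  show ?thesis
    using hurwitz_mult_closed[OF f(1) g(1)] hurwitz_mult_eq_0[OF f(1) g(1) f(2) g(2)]
    by (rule finite_sequencesI[of _ "M + N"])
qed

lemmas finite_sequences_intros =
  finite_sequences_zero finite_sequences_unit finite_sequences_add finite_sequences_smult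
  finite_sequences_minus finite_sequences_shift finite_sequences_hurwitz_mult

lemma differential_algebra_hurwitz: "differential_algebra R (hurwitz_algebra R) (\<lambda>f n. f (Suc n))"
proof -
  note simps = hurwitz_algebra_def finite_sequences_intros finite_sequences_closed
  have comm: "(\<lambda>n. hurwitz_mult R n f g) = (\<lambda>n. hurwitz_mult R n g f)"
    if "f \<in> finite_sequences R" "g \<in> finite_sequences R" for f g
    using that by (intro ext hurwitz_mult_comm finite_sequences_closed)
  have "abelian_group (hurwitz_algebra R)"
  proof (rule abelian_groupI)
    fix f assume f: "f \<in> carrier (hurwitz_algebra R)"
    show "\<exists>g\<in>carrier (hurwitz_algebra R). g \<oplus>\<^bsub>hurwitz_algebra R\<^esub> f = \<zero>\<^bsub>hurwitz_algebra R\<^esub>"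
      by (rule bexI[of _ "\<lambda>n. \<ominus> f n"]) (use f in \<open>simp_all add: simps l_neg\<close>)
  qed (auto simp: simps a_ac)
  then have "module R (hurwitz_algebra R)"
    by (intro moduleI is_cring) (auto simp: simps l_distr r_distr m_assoc)
  then have "assoc_comm_algebra R (hurwitz_algebra R)"
    by (rule assoc_comm_algebra.intro, unfold_locales)
      (auto simp: simps hurwitz_mult_assoc hurwitz_mult_add_left hurwitz_mult_smult_left intro: comm)
  then show ?thesis
    by (intro differential_algebra.intro differential_algebra_axioms.intro) (auto simp: simps)
qed

lemma divided_powers_hurwitz:
  "divided_powers R (hurwitz_algebra R) (\<lambda>f n. f (Suc n)) (unit_sequence R)"
proof -
  interpret differential_algebra R "hurwitz_algebra R" "\<lambda>f n. f (Suc n)"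
    by (rule differential_algebra_hurwitz)
  have pow: "[c] \<cdot>\<^bsub>hurwitz_algebra R\<^esub> unit_sequence R m = (\<lambda>n. if n = m then [c] \<cdot> \<one> else \<zero>)" for c m :: nat
  proof (induction c)
    case 0
    have "\<zero>\<^bsub>hurwitz_algebra R\<^esub> = (\<lambda>n. \<zero>)" by (simp add: hurwitz_algebra_def)
    then show ?case by (simp add: M.add.nat_pow_0 add.nat_pow_0 cong: if_cong)
  next
    case (Suc c)
    then show ?case
      by (simp add: M.add.nat_pow_Suc) (auto simp: hurwitz_algebra_def unit_sequence_def fun_eq_iff)
  qed
  show ?thesis
  proof
    show "unit_sequence R n \<in> carrier (hurwitz_algebra R)" for n
      by (simp add: hurwitz_algebra_def finite_sequences_unit)
    show "(\<lambda>n. unit_sequence R 0 (Suc n)) = \<zero>\<^bsub>hurwitz_algebra R\<^esub>"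
      by (auto simp: hurwitz_algebra_def unit_sequence_def)
    show "(\<lambda>i. unit_sequence R (Suc n) (Suc i)) = unit_sequence R n" for n
      by (auto simp: unit_sequence_def)
    show "unit_sequence R m \<otimes>\<^bsub>hurwitz_algebra R\<^esub> unit_sequence R n =
        [((m + n) choose n)] \<cdot>\<^bsub>hurwitz_algebra R\<^esub> unit_sequence R (m + n)" for m n
      unfolding pow by (simp add: hurwitz_algebra_def hurwitz_mult_unit_sequences)
    show "[c] \<cdot> \<one> = \<zero>" if "[c] \<cdot>\<^bsub>hurwitz_algebra R\<^esub> unit_sequence R 0 = \<zero>\<^bsub>hurwitz_algebra R\<^esub>" for c :: nat
      using that unfolding pow by (auto simp: hurwitz_algebra_def dest: fun_cong[of _ _ 0])
  qed
qed

lemma ex_inj_on_finite_sequences: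
  fixes e :: "'a list \<Rightarrow> 'u"
  assumes "inj e"
  shows "\<exists>h :: (nat \<Rightarrow> 'a) \<Rightarrow> 'u. inj_on h (finite_sequences R)"
proof
  define len where "len f = (LEAST N. \<forall>n\<ge>N. f n = \<zero>)" for f :: "nat \<Rightarrow> 'a"
  have len: "f n = \<zero>" if "f \<in> finite_sequences R" "n \<ge> len f" for f n
  proof -
    have "\<exists>N. \<forall>n\<ge>N. f n = \<zero>" using that(1) by (simp add: finite_sequences_def)
    then have "\<forall>n\<ge>len f. f n = \<zero>" unfolding len_def by (rule LeastI_ex)
    then show ?thesis using that(2) by blast
  qed
  show "inj_on (\<lambda>f. e (map f [0..<len f])) (finite_sequences R)"
  proof (rule inj_onI, rule ext)
    fix f g n assume f: "f \<in> finite_sequences R" and g: "g \<in> finite_sequences R"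
      and "e (map f [0..<len f]) = e (map g [0..<len g])"
    then have eq: "map f [0..<len f] = map g [0..<len g]" using assms by (simp add: inj_eq)
    then have "len f = len g" using map_eq_imp_length_eq by fastforce
    then show "f n = g n"
      using eq len[OF f, of n] len[OF g, of n] by (cases "n < len f") (auto simp: map_eq_conv)
  qed
qed

end

definition transport_module :: "('c \<Rightarrow> 'd) \<Rightarrow> ('k, 'c, 'n) module_scheme \<Rightarrow> ('k, 'd) module" where
  "transport_module h U = (let g = inv_into (carrier U) h in
    \<lparr>carrier = h ` carrier U, monoid.mult = (\<lambda>u v. h (g u \<otimes>\<^bsub>U\<^esub> g v)), one = h \<one>\<^bsub>U\<^esub>,
      zero = h \<zero>\<^bsub>U\<^esub>, add = (\<lambda>u v. h (g u \<oplus>\<^bsub>U\<^esub> g v)), smult = (\<lambda>c u. h (c \<odot>\<^bsub>U\<^esub> g u))\<rparr>)"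

lemma transport_module_simps:
  assumes "inj_on h (carrier U)"
  shows "carrier (transport_module h U) = h ` carrier U"
    and "\<zero>\<^bsub>transport_module h U\<^esub> = h \<zero>\<^bsub>U\<^esub>"
    and "u \<in> carrier U \<Longrightarrow> v \<in> carrier U \<Longrightarrow> h u \<otimes>\<^bsub>transport_module h U\<^esub> h v = h (u \<otimes>\<^bsub>U\<^esub> v)"
    and "u \<in> carrier U \<Longrightarrow> v \<in> carrier U \<Longrightarrow> h u \<oplus>\<^bsub>transport_module h U\<^esub> h v = h (u \<oplus>\<^bsub>U\<^esub> v)"
    and "u \<in> carrier U \<Longrightarrow> c \<odot>\<^bsub>transport_module h U\<^esub> h u = h (c \<odot>\<^bsub>U\<^esub> u)"
  using assms by (simp_all add: transport_module_def Let_def)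

lemma (in differential_algebra) differential_algebra_transport:
  assumes h: "inj_on h (carrier U)"
  shows "differential_algebra K (transport_module h U) (\<lambda>u. h (D (inv_into (carrier U) h u)))"
proof -
  note simps = transport_module_simps[OF h] inv_into_f_f[OF h]
  have "abelian_group (transport_module h U)"
  proof (rule abelian_groupI)
    fix u' assume "u' \<in> carrier (transport_module h U)"
    then obtain u where u: "u \<in> carrier U" "u' = h u" by (auto simp: simps)
    show "\<exists>v\<in>carrier (transport_module h U). v \<oplus>\<^bsub>transport_module h U\<^esub> u' = \<zero>\<^bsub>transport_module h U\<^esub>"
      by (rule bexI[of _ "h (\<ominus>\<^bsub>U\<^esub> u)"]) (use u in \<open>simp_all add: simps M.l_neg\<close>)
  qed (auto simp: simps M.a_ac)
  then have "module K (transport_module h U)"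
    by (intro moduleI R.is_cring) (auto simp: simps smult_l_distr smult_r_distr smult_assoc1)
  then have "assoc_comm_algebra K (transport_module h U)"
    by (rule assoc_comm_algebra.intro, unfold_locales)
      (auto simp: simps mult_closed mult_assoc mult_distr mult_smult intro: arg_cong[OF mult_comm])
  then show ?thesis
    by (intro differential_algebra.intro differential_algebra_axioms.intro)
      (auto simp: simps D_closed D_add D_smult D_mult mult_closed)
qed

lemma (in divided_powers) divided_powers_transport:
  assumes h: "inj_on h (carrier U)"
  shows "divided_powers K (transport_module h U) (\<lambda>u. h (D (inv_into (carrier U) h u))) (\<lambda>n. h (x n))"
proof -
  interpret T: differential_algebra K "transport_module h U" "\<lambda>u. h (D (inv_into (carrier U) h u))"
    by (rule differential_algebra_transport[OF h])
  note simps = transport_module_simps[OF h] inv_into_f_f[OF h] x_closed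
  have pow: "[c] \<cdot>\<^bsub>transport_module h U\<^esub> h u = h ([c] \<cdot>\<^bsub>U\<^esub> u)" if "u \<in> carrier U" for c :: nat and u
    using that by (induction c) (simp_all add: simps)
  show ?thesis
  proof
    fix c :: nat assume "[c] \<cdot>\<^bsub>transport_module h U\<^esub> h (x 0) = \<zero>\<^bsub>transport_module h U\<^esub>"
    then have "[c] \<cdot>\<^bsub>U\<^esub> x 0 = \<zero>\<^bsub>U\<^esub>"
      using inj_onD[OF h, of "[c] \<cdot>\<^bsub>U\<^esub> x 0" "\<zero>\<^bsub>U\<^esub>"] by (simp add: pow simps)
    then show "[c] \<cdot>\<^bsub>K\<^esub> \<one>\<^bsub>K\<^esub> = \<zero>\<^bsub>K\<^esub>" by (rule x_faithful)
  qed (simp_all add: simps pow D_x_0 D_x_Suc x_mult)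
qed

lemma (in cring) ex_divided_powers:
  assumes "large_universe TYPE('a) TYPE('u)"
  shows "\<exists>(U :: ('a, 'u) module) D x. divided_powers R U D x"
proof -
  obtain h :: "(nat \<Rightarrow> 'a) \<Rightarrow> 'u" where "inj_on h (finite_sequences R)"
    using assms ex_inj_on_finite_sequences unfolding large_universe_def by blast
  then show ?thesis
    using divided_powers.divided_powers_transport[OF divided_powers_hurwitz, of h]
    by (auto simp: hurwitz_algebra_def)
qed

section \<open>Wronskians of divided powers\<close>

primrec multinomial_coeff :: "(nat \<Rightarrow> nat) \<Rightarrow> nat \<Rightarrow> nat" where
  "multinomial_coeff d 0 = 1"
| "multinomial_coeff d (Suc k) = multinomial_coeff d k * (sum d {..Suc k} choose d (Suc k))"

text \<open>
  The case distinction discards the terms in which some \<open>x\<^sub>e\<^sub>j\<close> is differentiated away, which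
  truncated subtraction would count.
\<close>

definition derivative_coeff :: "nat list \<Rightarrow> (nat \<Rightarrow> nat) \<Rightarrow> nat \<Rightarrow> int" where
  "derivative_coeff es \<pi> k =
    (if \<forall>j\<le>k. \<pi> j \<le> es ! j then int (multinomial_coeff (\<lambda>j. es ! j - \<pi> j) k) else 0)"

definition wronskian_coeff :: "nat \<Rightarrow> nat list \<Rightarrow> int" where
  "wronskian_coeff k es = (\<Sum>\<pi> | \<pi> permutes {0..k}. sign \<pi> * derivative_coeff es \<pi> k)"

lemma multinomial_coeff_cong:
  "(\<And>j. j \<le> k \<Longrightarrow> d j = d' j) \<Longrightarrow> multinomial_coeff d k = multinomial_coeff d' k"
  by (induction k) simp_all

lemma multinomial_coeff_shift:
  assumes "d 0 = 0"
  shows "multinomial_coeff d (Suc k) = multinomial_coeff (\<lambda>j. d (Suc j)) k"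
proof (induction k)
  case 0
  then show ?case by (simp add: assms)
next
  case (Suc k)
  have "sum d {..Suc (Suc k)} = (\<Sum>j\<le>Suc k. d (Suc j))" by (subst sum.atMost_Suc_shift) (simp add: assms)
  then show ?case
    by (simp only: multinomial_coeff.simps(2)[of d "Suc k"]
      multinomial_coeff.simps(2)[of "\<lambda>j. d (Suc j)" k] Suc.IH)
qed

lemma derivative_coeff_map_permutation_Suc:
  assumes "\<pi> permutes {0..k}" "length es = Suc k"
  shows "derivative_coeff (0 # map Suc es) (map_permutation {0..k} Suc \<pi>) (Suc k) = derivative_coeff es \<pi> k"
proof -
  let ?es = "0 # map Suc es" and ?\<pi> = "map_permutation {0..k} Suc \<pi>"
  have zero: "?\<pi> 0 = 0" by (simp add: map_permutation_def)
  have Suc: "?\<pi> (Suc j) = Suc (\<pi> j)" if "j \<le> k" for j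
    using that by (intro map_permutation_apply) auto
  have "multinomial_coeff (\<lambda>j. ?es ! j - ?\<pi> j) (Suc k) = multinomial_coeff (\<lambda>j. ?es ! Suc j - ?\<pi> (Suc j)) k"
    by (rule multinomial_coeff_shift) simp
  also have "\<dots> = multinomial_coeff (\<lambda>j. es ! j - \<pi> j) k"
    using assms Suc by (intro multinomial_coeff_cong) simp
  finally have "multinomial_coeff (\<lambda>j. ?es ! j - ?\<pi> j) (Suc k) = multinomial_coeff (\<lambda>j. es ! j - \<pi> j) k" .
  moreover have "(\<forall>j\<le>Suc k. ?\<pi> j \<le> ?es ! j) \<longleftrightarrow> (\<forall>j\<le>k. \<pi> j \<le> es ! j)"
    using All_less_Suc2[of "Suc k" "\<lambda>j. ?\<pi> j \<le> ?es ! j"] assms by (simp add: less_Suc_eq_le zero Suc)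
  ultimately show ?thesis by (simp only: derivative_coeff_def)
qed

lemma wronskian_coeff_Cons_0:
  assumes "length es = Suc k"
  shows "wronskian_coeff (Suc k) (0 # map Suc es) = wronskian_coeff k es"
proof -
  let ?c = "\<lambda>\<pi>. derivative_coeff (0 # map Suc es) \<pi> (Suc k)"
  have split: "{0..Suc k} = insert 0 (Suc ` {0..k})"
    by (simp add: image_Suc_atLeastAtMost atLeast0_atMost_Suc_eq_insert_0)
  have "?c (transpose 0 j \<circ> \<pi>) = 0" if "\<pi> permutes Suc ` {0..k}" "j \<in> Suc ` {0..k}" for j \<pi>
    using permutes_not_in[OF that(1), of 0] that(2) by (auto simp: derivative_coeff_def)
  then have "wronskian_coeff (Suc k) (0 # map Suc es) = (\<Sum>\<pi> | \<pi> permutes Suc ` {0..k}. sign \<pi> * ?c \<pi>)"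
    unfolding wronskian_coeff_def split
    using signed_sum_permutations_insert[of "Suc ` {0..k}" 0 ?c] by (simp add: image_iff)
  also have "\<dots> = (\<Sum>\<pi> | \<pi> permutes {0..k}.
      sign (map_permutation {0..k} Suc \<pi>) * ?c (map_permutation {0..k} Suc \<pi>))"
    by (rule sum.reindex_bij_betw[symmetric]) (rule bij_betw_map_permutation, simp)
  also have "\<dots> = wronskian_coeff k es"
    unfolding wronskian_coeff_def using assms
    by (intro sum.cong) (auto simp: derivative_coeff_map_permutation_Suc sign_map_permutation)
  finally show ?thesis .
qed

lemma wronskian_coeff_upt_append:
  assumes "length es = Suc k"
  shows "wronskian_coeff (m + k) ([0..<m] @ map ((+) m) es) = wronskian_coeff k es"
proof (induction m)
  case 0
  then show ?case by (simp add: map_idI)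
next
  case (Suc m)
  let ?es = "[0..<m] @ map ((+) m) es"
  have "[0..<Suc m] @ map ((+) (Suc m)) es = 0 # map Suc ?es"
    by (simp add: upt_conv_Cons map_Suc_upt o_def del: upt_Suc)
  moreover have "length ?es = Suc (m + k)" using assms by simp
  ultimately show ?case
    using wronskian_coeff_Cons_0[of ?es "m + k"] Suc.IH by (simp only: add_Suc[of m k])
qed

lemma wronskian_coeff_degree:
  assumes "length es = Suc k" "sum_list es < \<Sum>{0..k}"
  shows "wronskian_coeff k es = 0"
  unfolding wronskian_coeff_def
proof (rule sum.neutral, rule ballI)
  fix \<pi> assume "\<pi> \<in> {\<pi>. \<pi> permutes {0..k}}"
  then have \<pi>: "\<pi> permutes {0..k}" by simp
  have "\<not> (\<forall>j\<le>k. \<pi> j \<le> es ! j)"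
  proof
    assume "\<forall>j\<le>k. \<pi> j \<le> es ! j"
    then have "(\<Sum>j\<in>{0..k}. \<pi> j) \<le> (\<Sum>j\<in>{0..k}. es ! j)" by (intro sum_mono) auto
    moreover have "(\<Sum>j\<in>{0..k}. \<pi> j) = \<Sum>{0..k}" using sum.permute[OF \<pi>, of id] by simp
    moreover have "(\<Sum>j\<in>{0..k}. es ! j) = sum_list es"
      unfolding sum_list_sum_nth assms(1) by (simp add: atLeastLessThanSuc_atLeastAtMost)
    ultimately show False using assms(2) by simp
  qed
  then show "sign \<pi> * derivative_coeff es \<pi> k = 0"
    by (simp only: derivative_coeff_def if_False mult_zero_right)
qed

lemma wronskian_coeff_0: "wronskian_coeff 0 [u] = 1"
  by (simp add: wronskian_coeff_def derivative_coeff_def)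

lemma wronskian_coeff_1:
  fixes u v :: nat
  defines "t \<equiv> \<lambda>a b. if a \<le> u \<and> b \<le> v then int ((u - a) + (v - b) choose (v - b)) else 0"
  shows "wronskian_coeff 1 [u, v] = t 0 1 - t 1 0"
proof -
  have all: "(\<forall>j\<le>1. P j) \<longleftrightarrow> P 0 \<and> P 1" for P :: "nat \<Rightarrow> bool" by (auto simp: le_Suc_eq)
  have "wronskian_coeff 1 [u, v] = (\<Sum>\<pi> | \<pi> permutes {0..1}. sign \<pi> * t (\<pi> 0) (\<pi> 1))"
    unfolding wronskian_coeff_def derivative_coeff_def t_def all
    by (intro sum.cong) simp_all
  moreover have "{0..1} = insert 0 {1::nat}" by auto
  ultimately show ?thesis by (simp add: signed_int_sum_permutations_insert)
qed

lemma wronskian_coeff_2: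
  fixes u v w :: nat
  defines "t \<equiv> \<lambda>a b c. if a \<le> u \<and> b \<le> v \<and> c \<le> w
    then int (((u - a) + (v - b) choose (v - b)) * ((u - a) + (v - b) + (w - c) choose (w - c))) else 0"
  shows "wronskian_coeff 2 [u, v, w] = t 0 1 2 - t 0 2 1 - t 1 0 2 + t 1 2 0 + t 2 0 1 - t 2 1 0"
proof -
  have all: "(\<forall>j\<le>2. P j) \<longleftrightarrow> P 0 \<and> P 1 \<and> P 2" for P :: "nat \<Rightarrow> bool"
    by (auto simp: numeral_2_eq_2 le_Suc_eq)
  have "wronskian_coeff 2 [u, v, w] = (\<Sum>\<pi> | \<pi> permutes {0..2}. sign \<pi> * t (\<pi> 0) (\<pi> 1) (\<pi> 2))"
    unfolding wronskian_coeff_def derivative_coeff_def t_def all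
    by (intro sum.cong) (simp_all add: numeral_2_eq_2)
  moreover have "{0..2} = insert 0 (insert 1 {2::nat})" by auto
  ultimately show ?thesis
    by (simp add: signed_int_sum_permutations_insert)
qed

lemma sum_list_upt: "sum_list [0..<m] = \<Sum>{0..<m}"
  by (simp add: sum_list_distinct_conv_sum_set)

lemma (in abelian_group) finsum_int_pow:
  assumes "y \<in> carrier G"
  shows "(\<Oplus>i\<in>A. [(f i :: int)] \<cdot> y) = [(sum f A)] \<cdot> y"
  by (induction A rule: infinite_finite_induct) (auto simp: assms add.int_pow_mult add_pow_int_ge)

context divided_powers
begin

lemma funpow_D_x: "(D ^^ r) (x n) = (if r \<le> n then x (n - r) else \<zero>\<^bsub>U\<^esub>)"
proof (induction r)
  case (Suc r)
  consider "n < r" | "n = r" | m where "n = r + Suc m"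
    by (metis less_iff_Suc_add linorder_neqE_nat add_Suc_right)
  then show ?case
    by cases (use Suc in \<open>auto simp: linear_zero[OF D_linear] D_x_0 D_x_Suc Suc_diff_le\<close>)
qed simp

lemma int_pow_x_eq_zero:
  assumes p: "has_characteristic K p" and zero: "[(c::int)] \<cdot>\<^bsub>U\<^esub> x n = \<zero>\<^bsub>U\<^esub>"
  shows "int p dvd c"
proof -
  have "[c] \<cdot>\<^bsub>U\<^esub> x 0 = (D ^^ n) ([c] \<cdot>\<^bsub>U\<^esub> x n)"
    using linear_int_pow[OF linear_maps_funpow[OF D_linear] x_closed] by (simp add: funpow_D_x)
  also have "\<dots> = \<zero>\<^bsub>U\<^esub>" unfolding zero by (rule linear_zero[OF linear_maps_funpow[OF D_linear]])
  finally have "[(nat \<bar>c\<bar>)] \<cdot>\<^bsub>U\<^esub> x 0 = \<zero>\<^bsub>U\<^esub>"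
    using M.add.inv_eq_1_iff[of "[(nat (- c))] \<cdot>\<^bsub>U\<^esub> x 0"] x_closed
    by (cases "c \<ge> 0") (auto simp: add_pow_int_ge add_pow_int_lt)
  then have "p dvd nat \<bar>c\<bar>"
    using x_faithful p unfolding has_characteristic_def by blast
  then have "int p dvd int (nat \<bar>c\<bar>)" by (simp only: int_dvd_int_iff)
  then show ?thesis by simp
qed

lemma nonempty_prod_x:
  "nonempty_prod U (\<lambda>j. x (d j)) k = [int (multinomial_coeff d k)] \<cdot>\<^bsub>U\<^esub> x (sum d {..k})"
proof (induction k)
  case 0
  show ?case by (simp add: add_pow_int_ge x_closed)
next
  case (Suc k)
  let ?s = "sum d {..k}" and ?c = "int (multinomial_coeff d k)"
  have "nonempty_prod U (\<lambda>j. x (d j)) (Suc k) = ([?c] \<cdot>\<^bsub>U\<^esub> x ?s) \<otimes>\<^bsub>U\<^esub> x (d (Suc k))"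
    using Suc by simp
  also have "\<dots> = [?c] \<cdot>\<^bsub>U\<^esub> (x ?s \<otimes>\<^bsub>U\<^esub> x (d (Suc k)))"
    by (rule linear_int_pow[OF mult_right_linear[OF x_closed] x_closed])
  also have "x ?s \<otimes>\<^bsub>U\<^esub> x (d (Suc k)) = [int (?s + d (Suc k) choose d (Suc k))] \<cdot>\<^bsub>U\<^esub> x (?s + d (Suc k))"
    by (simp add: x_mult add_pow_int_ge)
  also have "[?c] \<cdot>\<^bsub>U\<^esub> \<dots> = [int (multinomial_coeff d (Suc k))] \<cdot>\<^bsub>U\<^esub> x (sum d {..Suc k})"
    by (simp add: M.add.int_pow_pow x_closed mult.commute)
  finally show ?case .
qed

lemma nonempty_prod_funpow_D_x:
  assumes \<pi>: "\<pi> permutes {0..k}" and es: "length es = Suc k"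
  shows "nonempty_prod U (\<lambda>j. (D ^^ \<pi> j) (map x es ! j)) k =
    [derivative_coeff es \<pi> k] \<cdot>\<^bsub>U\<^esub> x (sum_list es - \<Sum>{0..k})"
proof (cases "\<forall>j\<le>k. \<pi> j \<le> es ! j")
  case True
  have "nonempty_prod U (\<lambda>j. (D ^^ \<pi> j) (map x es ! j)) k = nonempty_prod U (\<lambda>j. x (es ! j - \<pi> j)) k"
    by (rule nonempty_prod_cong) (use True es in \<open>simp add: funpow_D_x\<close>)
  moreover have "(\<Sum>j\<le>k. es ! j - \<pi> j) = (\<Sum>j\<le>k. es ! j) - (\<Sum>j\<le>k. \<pi> j)"
    using True by (intro sum_subtractf_nat) auto
  moreover have "(\<Sum>j\<le>k. es ! j) = sum_list es"
    unfolding sum_list_sum_nth es by (simp add: atLeastLessThanSuc_atLeastAtMost atLeast0AtMost)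
  moreover have "(\<Sum>j\<le>k. \<pi> j) = \<Sum>{0..k}"
    using sum.permute[OF \<pi>, of id] by (simp add: atLeast0AtMost)
  ultimately show ?thesis using True by (simp add: derivative_coeff_def nonempty_prod_x)
next
  case False
  then obtain i where i: "i \<le> k" "es ! i < \<pi> i" by (auto simp: not_le)
  let ?f = "\<lambda>j. (D ^^ \<pi> j) (map x es ! j)"
  have closed: "?f j \<in> carrier U" if "j \<le> k" for j using that es by (simp add: funpow_D_closed x_closed)
  have "?f i = \<zero>\<^bsub>U\<^esub>" using i es by (simp add: funpow_D_x)
  then have "nonempty_prod U ?f k = nonempty_prod U (?f(i := \<zero>\<^bsub>U\<^esub>)) k" by (simp add: fun_upd_idem)
  also have "\<dots> = \<zero>\<^bsub>U\<^esub>" by (rule linear_zero[OF nonempty_prod_slot_linear[OF i(1) closed]])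
  finally show ?thesis unfolding derivative_coeff_def if_not_P[OF False] by (simp add: add_pow_int_ge)
qed

lemma wronskian_x:
  assumes "length es = Suc k"
  shows "wronskian U D k (map x es) = [wronskian_coeff k es] \<cdot>\<^bsub>U\<^esub> x (sum_list es - \<Sum>{0..k})"
  unfolding wronskian_def wronskian_coeff_def M.finsum_int_pow[OF x_closed, symmetric]
  using assms by (intro M.finsum_cong')
    (auto simp: nonempty_prod_funpow_D_x M.add.int_pow_pow x_closed mult.commute[of "sign _"] simp del: nth_map)

lemma dvd_wronskian_coeff_repeated:
  assumes p: "has_characteristic K p" and es: "length es = Suc k" "\<not> distinct es"
  shows "int p dvd wronskian_coeff k es"
proof (rule int_pow_x_eq_zero[OF p])
  show "[wronskian_coeff k es] \<cdot>\<^bsub>U\<^esub> x (sum_list es - \<Sum>{0..k}) = \<zero>\<^bsub>U\<^esub>"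
    unfolding wronskian_x[OF es(1), symmetric]
    using es by (intro wronskian_alternating) (auto simp: x_closed distinct_map)
qed

lemma wronskian_nested_x:
  assumes zs: "length zs = Suc k" and ys: "length ys = Suc q" and i: "i \<le> k"
    and degree: "sum_list (zs[i := 0]) + sum_list ys = \<Sum>{0..k} + \<Sum>{0..q}"
  shows "wronskian U D k ((map x zs)[i := wronskian U D q (map x ys)]) =
    [(wronskian_coeff q ys * wronskian_coeff k (zs[i := sum_list ys - \<Sum>{0..q}]))] \<cdot>\<^bsub>U\<^esub> x 0"
proof -
  let ?t = "sum_list ys - \<Sum>{0..q}"
  have "wronskian U D k ((map x zs)[i := wronskian U D q (map x ys)]) =
      [wronskian_coeff q ys] \<cdot>\<^bsub>U\<^esub> wronskian U D k ((map x zs)[i := x ?t])"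
    unfolding wronskian_x[OF ys]
    using zs i by (intro linear_int_pow[OF wronskian_slot_linear]) (auto simp: x_closed)
  also have "(map x zs)[i := x ?t] = map x (zs[i := ?t])" by (simp add: map_update)
  also have "wronskian U D k (map x (zs[i := ?t])) =
      [wronskian_coeff k (zs[i := ?t])] \<cdot>\<^bsub>U\<^esub> x (sum_list (zs[i := ?t]) - \<Sum>{0..k})"
    using zs by (intro wronskian_x) simp
  finally have nested: "wronskian U D k ((map x zs)[i := wronskian U D q (map x ys)]) =
      [(wronskian_coeff q ys * wronskian_coeff k (zs[i := ?t]))] \<cdot>\<^bsub>U\<^esub> x (sum_list (zs[i := ?t]) - \<Sum>{0..k})"
    by (simp add: M.add.int_pow_pow x_closed mult.commute)
  show ?thesis
  proof (cases "sum_list ys < \<Sum>{0..q}")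
    case True
    then show ?thesis unfolding nested by (simp add: wronskian_coeff_degree[OF ys] add_pow_int_ge)
  next
    case False
    have "sum_list (zs[i := ?t]) = sum_list (zs[i := 0]) + ?t"
      using zs i sum_list_update[of i "zs[i := 0]" ?t] by simp
    then show ?thesis using False degree unfolding nested by simp
  qed
qed


section \<open>Wronskians violating the identities\<close>

lemma n_lie_imp_dvd:
  assumes lie: "n_lie K U (k + 1) (wronskian U D k)" and p: "has_characteristic K p"
    and cs: "length cs = k" and es: "length es = Suc k"
    and degree: "sum_list cs + sum_list es = 2 * \<Sum>{0..k}"
  shows "int p dvd wronskian_coeff k es * wronskian_coeff k (cs @ [sum_list es - \<Sum>{0..k}]) -
    (\<Sum>i<k + 1. wronskian_coeff k (cs @ [es ! i]) *
      wronskian_coeff k (es[i := sum_list cs + es ! i - \<Sum>{0..k}]))"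
    (is "int p dvd ?c - (\<Sum>i<k + 1. ?d i)")
proof (rule int_pow_x_eq_zero[OF p])
  let ?W = "wronskian U D k" and ?as = "map x cs" and ?bs = "map x es"
  have "?as @ [?W ?bs] = (map x (cs @ [0]))[k := ?W ?bs]" using cs by (simp add: list_update_append)
  also have "?W \<dots> = [?c] \<cdot>\<^bsub>U\<^esub> x 0"
    using cs es degree by (subst wronskian_nested_x) (simp_all add: list_update_append)
  finally have lhs: "?W (?as @ [?W ?bs]) = [?c] \<cdot>\<^bsub>U\<^esub> x 0" .
  have rhs: "?W (?bs[i := ?W (?as @ [?bs ! i])]) = [(?d i)] \<cdot>\<^bsub>U\<^esub> x 0" if "i < k + 1" for i
  proof -
    have "?as @ [?bs ! i] = map x (cs @ [es ! i])" using that es by simp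
    moreover have "sum_list (es[i := 0]) + sum_list (cs @ [es ! i]) = \<Sum>{0..k} + \<Sum>{0..k}"
      using degree that es elem_le_sum_list[of i es] by (simp add: sum_list_update)
    ultimately show ?thesis
      using wronskian_nested_x[of es k "cs @ [es ! i]" k i] that cs es by simp
  qed
  have "length ?as = k + 1 - 1" "set ?as \<subseteq> carrier U" "length ?bs = k + 1" "set ?bs \<subseteq> carrier U"
    using cs es by (auto simp: x_closed)
  then have "?W (?as @ [?W ?bs]) = (\<Oplus>\<^bsub>U\<^esub>i\<in>{..<k + 1}. ?W (?bs[i := ?W (?as @ [?bs ! i])]))"
    using lie unfolding n_lie_def by blast
  also have "\<dots> = (\<Oplus>\<^bsub>U\<^esub>i\<in>{..<k + 1}. [(?d i)] \<cdot>\<^bsub>U\<^esub> x 0)"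
    using rhs by (intro M.finsum_cong') (auto simp: x_closed)
  also have "\<dots> = [(\<Sum>i<k + 1. ?d i)] \<cdot>\<^bsub>U\<^esub> x 0" by (rule M.finsum_int_pow[OF x_closed])
  finally show "[(?c - (\<Sum>i<k + 1. ?d i))] \<cdot>\<^bsub>U\<^esub> x 0 = \<zero>\<^bsub>U\<^esub>"
    unfolding lhs by (simp add: M.add.int_pow_diff x_closed M.r_neg)
qed

lemma wronskian_coeff_upt_last: "wronskian_coeff k ([0..<k] @ [k + n]) = 1"
  using wronskian_coeff_upt_append[of "[n]" 0 k] by (simp add: wronskian_coeff_0)

lemma wronskian_coeff_upt_last_two:
  "wronskian_coeff (Suc m) ([0..<m] @ [m + u, m + v]) = wronskian_coeff 1 [u, v]"
  using wronskian_coeff_upt_append[of "[u, v]" 1 m] by simp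

lemma wronskian_coeff_upt_last_three:
  "wronskian_coeff (Suc (Suc m)) ([0..<m] @ [m + u, m + v, m + w]) = wronskian_coeff 2 [u, v, w]"
  using wronskian_coeff_upt_append[of "[u, v, w]" 2 m] by simp

lemma not_distinct_list_update:
  assumes "i < length es" "j < length es" "i \<noteq> j" "es ! j = v"
  shows "\<not> distinct (es[i := v])"
  using assms nth_eq_iff_index_eq[of "es[i := v]" i j] by auto

lemma sum_upto_Suc: "\<Sum>{0..Suc m} = \<Sum>{0..<m} + m + Suc m"
  by (simp add: atLeastLessThanSuc_atLeastAtMost[symmetric])

lemma n_lie_imp_dvd_index:
  assumes lie: "n_lie K U (k + 1) (wronskian U D k)" and p: "has_characteristic K p" and k: "k \<ge> 2"
  shows "int p dvd int k"
proof -
  obtain m where m: "k = Suc m" "m \<ge> 1" using k by (cases k) auto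
  let ?es = "[0..<m] @ [m + 1, m + (m + 1)]"
  define d where "d i = wronskian_coeff k ([0..<k] @ [?es ! i]) *
    wronskian_coeff k (?es[i := ?es ! i - k])" for i
  have es: "length ?es = Suc k" by (simp add: m)
  have "int p dvd d i" if "i < m" for i
  proof -
    have "int p dvd wronskian_coeff k ([0..<k] @ [?es ! i])"
      using that m by (intro dvd_wronskian_coeff_repeated[OF p]) (auto simp: nth_append)
    then show ?thesis unfolding d_def by (rule dvd_mult2)
  qed
  moreover have "int p dvd d m"
  proof -
    have "\<not> distinct (?es[m := ?es ! m - k])"
      by (rule not_distinct_list_update[of _ _ 0]) (use m in \<open>auto simp: nth_append\<close>)
    then have "int p dvd wronskian_coeff k (?es[m := ?es ! m - k])"
      by (rule dvd_wronskian_coeff_repeated[OF p, rotated]) (simp add: m)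
    then show ?thesis unfolding d_def by (rule dvd_mult)
  qed
  ultimately have rest: "int p dvd (\<Sum>i<m. d i) + d m" by (intro dvd_add dvd_sum) auto
  have "d (Suc m) = wronskian_coeff (Suc m) ([0..<Suc m] @ [Suc m + m]) *
      wronskian_coeff (Suc m) ([0..<m] @ [m + 1, m + 0])"
    unfolding d_def m(1) by (simp add: nth_append list_update_append del: upt_Suc)
  also have "\<dots> = - 1"
    unfolding wronskian_coeff_upt_last wronskian_coeff_upt_last_two wronskian_coeff_1 by simp
  finally have last: "d (Suc m) = - 1" .
  have degree: "sum_list [0..<k] + sum_list ?es = 2 * \<Sum>{0..k}" "sum_list ?es - \<Sum>{0..k} = k + 0"
    and shift: "sum_list [0..<k] + e - \<Sum>{0..k} = e - k" for e
    unfolding m(1) sum_upto_Suc by (simp_all add: sum_list_upt)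
  have "int p dvd wronskian_coeff k ?es * wronskian_coeff k ([0..<k] @ [k + 0]) - (\<Sum>i<k + 1. d i)"
    using n_lie_imp_dvd[OF lie p _ es degree(1)] unfolding degree(2) shift d_def by simp
  also have "wronskian_coeff k ?es = int m"
    unfolding m(1) wronskian_coeff_upt_last_two wronskian_coeff_1 by simp
  also have "(\<Sum>i<k + 1. d i) = (\<Sum>i<m. d i) + d m - 1" using last by (simp add: m)
  finally have "int p dvd int m + 1 - ((\<Sum>i<m. d i) + d m)"
    unfolding wronskian_coeff_upt_last by (simp add: algebra_simps)
  then have "int p dvd int m + 1" by (simp only: dvd_diff_left_iff[OF rest])
  then show ?thesis by (simp add: m add.commute)
qed

lemma n_lie_imp_dvd_wronskian_coeff:
  assumes lie: "n_lie K U (k + 1) (wronskian U D k)" and p: "has_characteristic K p"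
    and k: "k = Suc m" and es: "length es = Suc k" and degree: "sum_list es = \<Sum>{0..k} + m"
    and repeated: "\<And>i. i \<le> k \<Longrightarrow> m \<le> es ! i \<Longrightarrow> \<exists>j\<le>k. j \<noteq> i \<and> es ! j = es ! i - m"
  shows "int p dvd wronskian_coeff k es"
proof -
  let ?cs = "[0..<m] @ [Suc m]"
  let ?d = "\<lambda>i. wronskian_coeff k (?cs @ [es ! i]) * wronskian_coeff k (es[i := es ! i - m])"
  have cs: "length ?cs = k" by (simp add: k)
  have "int p dvd ?d i" if i: "i < k + 1" for i
  proof (cases "m \<le> es ! i")
    case True
    then obtain j where "j \<le> k" "j \<noteq> i" "es ! j = es ! i - m" using repeated[of i] i by auto
    then have "\<not> distinct (es[i := es ! i - m])"
      using i es by (intro not_distinct_list_update[of _ _ j]) auto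
    then show ?thesis using es by (intro dvd_mult dvd_wronskian_coeff_repeated[OF p]) simp_all
  next
    case False
    then show ?thesis using cs by (intro dvd_mult2 dvd_wronskian_coeff_repeated[OF p]) auto
  qed
  then have rest: "int p dvd (\<Sum>i<k + 1. ?d i)" by (intro dvd_sum) simp
  have sums: "sum_list ?cs + sum_list es = 2 * \<Sum>{0..k}" "sum_list es - \<Sum>{0..k} = m"
    and shift: "sum_list ?cs + e - \<Sum>{0..k} = e - m" for e
    unfolding degree k sum_upto_Suc by (simp_all add: sum_list_upt)
  have "wronskian_coeff k (?cs @ [m]) = wronskian_coeff 1 [1, 0]"
    unfolding k using wronskian_coeff_upt_last_two[of m 1 0] by simp
  also have "\<dots> = - 1" by (simp only: wronskian_coeff_1) simp
  finally have "int p dvd - wronskian_coeff k es - (\<Sum>i<k + 1. ?d i)"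
    using n_lie_imp_dvd[OF lie p cs es sums(1)] unfolding sums(2) shift by simp
  then have "int p dvd - wronskian_coeff k es" by (simp only: dvd_diff_left_iff[OF rest])
  then show ?thesis by simp
qed

lemma n_lie_imp_dvd_quadratic:
  assumes lie: "n_lie K U (k + 1) (wronskian U D k)" and p: "has_characteristic K p" and k: "k \<ge> 5"
  shows "int p dvd (int k - 1) * (int k - 4)"
proof -
  obtain n where "k = 5 + n" using k le_Suc_ex by blast
  then have n: "k = Suc (n + 4)" by simp
  let ?m = "n + 4" and ?es = "[0..<n + 4] @ [n + 4 + 2, n + 4 + (n + 3)]"
  have "int p dvd wronskian_coeff k ?es"
  proof (rule n_lie_imp_dvd_wronskian_coeff[OF lie p n])
    show "sum_list ?es = \<Sum>{0..k} + ?m" unfolding n sum_upto_Suc by (simp add: sum_list_upt)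
    fix i assume "i \<le> k" "?m \<le> ?es ! i"
    then consider (before_last) "i = ?m" | (last) "i = Suc ?m" using n by (force simp: nth_append)
    then show "\<exists>j\<le>k. j \<noteq> i \<and> ?es ! j = ?es ! i - ?m"
    proof cases
      case before_last
      then show ?thesis using n by (intro exI[of _ 2]) (auto simp: nth_append)
    next
      case last
      then show ?thesis using n by (intro exI[of _ "n + 3"]) (auto simp: nth_append)
    qed
  qed (simp add: n)
  also have "wronskian_coeff k ?es = int (n + 4 choose (n + 2)) - int (n + 4 choose (n + 3))"
    unfolding n wronskian_coeff_upt_last_two wronskian_coeff_1
    by (simp add: eval_nat_numeral add.commute del: binomial_Suc_Suc)
  finally have dvd: "int p dvd 2 * (int (n + 4 choose (n + 2)) - int (n + 4 choose (n + 3)))" by (rule dvd_mult)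
  have "2 * (n + 4 choose 2) = (n + 4) * (n + 3)" by (simp add: choose_two)
  moreover have "n + 4 choose (n + 2) = n + 4 choose 2" using binomial_symmetric[of 2 "n + 4"] by simp
  ultimately have "2 * int (n + 4 choose (n + 2)) = int ((n + 4) * (n + 3))" by linarith
  moreover have "n + 4 choose (n + 3) = n + 4" using binomial_symmetric[of 1 "n + 4"] by (simp add: add.commute)
  ultimately have "2 * (int (n + 4 choose (n + 2)) - int (n + 4 choose (n + 3))) = (int k - 1) * (int k - 4)"
    unfolding n by (simp add: algebra_simps)
  with dvd show ?thesis by simp
qed

lemma n_lie_imp_dvd_cubic:
  assumes lie: "n_lie K U (k + 1) (wronskian U D k)" and p: "has_characteristic K p" and k: "k \<ge> 6"
  shows "int p dvd 2 * (int (k - 1 choose 3) - int (k - 1 choose 2)) + (int k - 1)"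
proof -
  obtain n where "k = 6 + n" using k le_Suc_ex by blast
  then have n: "k = Suc (Suc (n + 4))" by simp
  let ?r = "n + 4" and ?es = "[0..<n + 4] @ [n + 4 + 1, n + 4 + 3, n + 4 + (n + 4)]"
  have "int p dvd wronskian_coeff k ?es"
  proof (rule n_lie_imp_dvd_wronskian_coeff[OF lie p n])
    show "sum_list ?es = \<Sum>{0..k} + Suc ?r"
      unfolding n sum_upto_Suc sum.atLeast0_lessThan_Suc by (simp add: sum_list_upt)
    fix i assume "i \<le> k" "Suc ?r \<le> ?es ! i"
    then consider (first) "i = ?r" | (second) "i = Suc ?r" | (third) "i = Suc (Suc ?r)" using n by (force simp: nth_append)
    then show "\<exists>j\<le>k. j \<noteq> i \<and> ?es ! j = ?es ! i - Suc ?r"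
    proof cases
      case first
      then show ?thesis using n by (intro exI[of _ 0]) (auto simp: nth_append)
    next
      case second
      then show ?thesis using n by (intro exI[of _ 2]) (auto simp: nth_append)
    next
      case third
      then show ?thesis using n by (intro exI[of _ "n + 3"]) (auto simp: nth_append)
    qed
  qed (simp add: n)
  also have "wronskian_coeff k ?es = 2 * (int (n + 5 choose (n + 2)) - int (n + 5 choose (n + 3))) + (int k - 1)"
    unfolding n wronskian_coeff_upt_last_three wronskian_coeff_2 by (simp add: eval_nat_numeral algebra_simps)
  also have "n + 5 choose (n + 2) = k - 1 choose 3"
    using binomial_symmetric[of 3 "n + 5"] by (simp add: n add.commute)
  also have "n + 5 choose (n + 3) = k - 1 choose 2"
    using binomial_symmetric[of 2 "n + 5"] by (simp add: n add.commute)
  finally show ?thesis .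
qed

lemma n_lie_wronskian_imp:
  assumes lie: "n_lie K U (k + 1) (wronskian U D k)" and p: "has_characteristic K p" "prime p \<or> p = 0"
    and k: "k > 0"
  shows "k = 1 \<or> k = 2 \<and> p = 2 \<or> k = 3 \<and> p = 3 \<or> k = 4 \<and> p = 2"
proof (cases "k = 1")
  case False
  then have ge_2: "k \<ge> 2" using k by simp
  have p_dvd_k: "p dvd k" using n_lie_imp_dvd_index[OF lie p(1) ge_2] by simp
  then have prime: "prime p" using p(2) k by auto
  have p_eq_2: "p = 2" if "p dvd 2 ^ n" for n
    using that prime by (metis prime_dvd_power primes_dvd_imp_eq two_is_prime_nat)
  have "k < 5"
  proof (rule ccontr)
    assume "\<not> k < 5"
    then have ge_5: "k \<ge> 5" by simp
    have "int p dvd (int k - 1) * (int k - 4) - int k * (int k - 5)"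
      using n_lie_imp_dvd_quadratic[OF lie p(1) ge_5] p_dvd_k by (intro dvd_diff) auto
    also have "(int k - 1) * (int k - 4) - int k * (int k - 5) = int (2 ^ 2)" by (simp add: algebra_simps)
    finally have "p = 2" by (intro p_eq_2[of 2]) (simp only: int_dvd_int_iff)
    then have "even k" using p_dvd_k by simp
    then have "k \<ge> 6" using ge_5 by (cases "k = 5") auto
    then have "even (int k - 1)" using n_lie_imp_dvd_cubic[OF lie p(1)] \<open>p = 2\<close> by auto
    then show False using \<open>even k\<close> by simp
  qed
  then consider "k = 2" | "k = 3" | "k = 4" using ge_2 by linarith
  then show ?thesis
  proof cases
    assume "k = 2"
    then show ?thesis using p_dvd_k p_eq_2[of 1] by simp
  next
    assume "k = 3"
    moreover have "prime (3::nat)" by simp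
    ultimately show ?thesis using p_dvd_k prime primes_dvd_imp_eq[of p 3] by simp
  next
    assume "k = 4"
    then show ?thesis using p_dvd_k p_eq_2[of 2] by simp
  qed
qed simp

lemma left_commutative_imp_dvd:
  fixes e :: "nat \<Rightarrow> nat" and k :: nat
  defines "xs \<equiv> \<lambda>\<sigma>. map (\<lambda>i. e (\<sigma> i)) [1..<k + 1]"
    and "ys \<equiv> \<lambda>\<sigma>. map (\<lambda>i. e (\<sigma> i)) [k + 1..<2 * k + 1] @ [e (2 * k + 1)]"
  assumes lc: "left_commutative U k (wronskian U D k)" and p: "has_characteristic K p"
    and degree: "(\<Sum>i\<in>{1..2 * k}. e i) + e (2 * k + 1) = 2 * \<Sum>{0..k}"
  shows "int p dvd (\<Sum>\<sigma> | \<sigma> permutes {1..2 * k}. sign \<sigma> *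
    (wronskian_coeff k (ys \<sigma>) * wronskian_coeff k (xs \<sigma> @ [sum_list (ys \<sigma>) - \<Sum>{0..k}])))"
    (is "int p dvd (\<Sum>\<sigma> | _. sign \<sigma> * ?c \<sigma>)")
proof (rule int_pow_x_eq_zero[OF p])
  let ?W = "wronskian U D k"
  have nested: "?W (map x (xs \<sigma>) @ [?W (map x (ys \<sigma>))]) = [?c \<sigma>] \<cdot>\<^bsub>U\<^esub> x 0"
    if \<sigma>: "\<sigma> permutes {1..2 * k}" for \<sigma>
  proof -
    have len: "length (xs \<sigma>) = k" "length (ys \<sigma>) = Suc k" by (simp_all add: xs_def ys_def)
    have "sum_list (xs \<sigma>) + sum_list (ys \<sigma>) =
        (\<Sum>i\<in>{1..<k + 1}. e (\<sigma> i)) + (\<Sum>i\<in>{k + 1..<2 * k + 1}. e (\<sigma> i)) + e (2 * k + 1)"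
      by (simp add: xs_def ys_def sum_list_distinct_conv_sum_set del: upt_Suc)
    also have "(\<Sum>i\<in>{1..<k + 1}. e (\<sigma> i)) + (\<Sum>i\<in>{k + 1..<2 * k + 1}. e (\<sigma> i)) = (\<Sum>i\<in>{1..<2 * k + 1}. e (\<sigma> i))"
      by (rule sum.atLeastLessThan_concat) auto
    also have "{1..<2 * k + 1} = {1..2 * k}" by auto
    also have "(\<Sum>i\<in>{1..2 * k}. e (\<sigma> i)) = (\<Sum>i\<in>{1..2 * k}. e i)"
      using sum.permute[OF \<sigma>, of e] by (simp add: o_def)
    finally have "sum_list (xs \<sigma>) + sum_list (ys \<sigma>) = \<Sum>{0..k} + \<Sum>{0..k}" using degree by simp
    moreover have "map x (xs \<sigma>) @ [w] = (map x (xs \<sigma> @ [0]))[k := w]" for w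
      using len by (simp add: list_update_append)
    ultimately show ?thesis
      using len by (simp only:) (subst wronskian_nested_x, simp_all add: list_update_append)
  qed
  have "[(\<Sum>\<sigma> | \<sigma> permutes {1..2 * k}. sign \<sigma> * ?c \<sigma>)] \<cdot>\<^bsub>U\<^esub> x 0 =
      (\<Oplus>\<^bsub>U\<^esub>\<sigma>\<in>{\<sigma>. \<sigma> permutes {1..2 * k}}. [(sign \<sigma> * ?c \<sigma>)] \<cdot>\<^bsub>U\<^esub> x 0)"
    by (rule M.finsum_int_pow[OF x_closed, symmetric])
  also have "\<dots> = (\<Oplus>\<^bsub>U\<^esub>\<sigma>\<in>{\<sigma>. \<sigma> permutes {1..2 * k}}.
      [sign \<sigma>] \<cdot>\<^bsub>U\<^esub> ?W (map x (xs \<sigma>) @ [?W (map x (ys \<sigma>))]))"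
    using nested by (intro M.finsum_cong') (auto simp: M.add.int_pow_pow x_closed mult.commute[of "sign _"])
  also have "\<dots> = \<zero>\<^bsub>U\<^esub>"
  proof -
    have "(\<lambda>i. x (e i)) \<in> {1..2 * k + 1} \<rightarrow> carrier U" by (simp add: x_closed)
    from lc[unfolded left_commutative_def, rule_format, OF this] show ?thesis
      by (simp add: xs_def ys_def o_def del: upt_Suc)
  qed
  finally show "[(\<Sum>\<sigma> | \<sigma> permutes {1..2 * k}. sign \<sigma> * ?c \<sigma>)] \<cdot>\<^bsub>U\<^esub> x 0 = \<zero>\<^bsub>U\<^esub>" .
qed

lemma left_commutative_1_imp_dvd_1:
  assumes lc: "left_commutative U 1 (wronskian U D 1)" and p: "has_characteristic K p"
  shows "int p dvd 1"
proof -
  let ?e = "(!) [0, 2, 0, 0 :: nat]"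
  let ?f = "\<lambda>u v. wronskian_coeff 1 [v, 0] * wronskian_coeff 1 [u, v - 1]"
  have "int p dvd (\<Sum>\<sigma> | \<sigma> permutes {1..2 * 1}. sign \<sigma> * ?f (?e (\<sigma> 1)) (?e (\<sigma> 2)))"
    using left_commutative_imp_dvd[OF lc p, of ?e] by (simp add: numeral_2_eq_2 upt_rec)
  also have "{1..2 * 1} = insert 1 {2 :: nat}" by auto
  also have "(\<Sum>\<sigma> | \<sigma> permutes insert 1 {2}. sign \<sigma> * ?f (?e (\<sigma> 1)) (?e (\<sigma> 2))) = ?f 2 0 - ?f 0 2"
    by (simp add: signed_int_sum_permutations_insert)
  also have "\<dots> = 1" by (simp only: wronskian_coeff_1) simp
  finally show ?thesis .
qed

lemma left_commutative_2_imp_dvd_8: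
  assumes lc: "left_commutative U 2 (wronskian U D 2)" and p: "has_characteristic K p"
  shows "int p dvd 8"
proof -
  let ?e = "(!) [0, 0, 1, 2, 3, 0 :: nat]"
  let ?f = "\<lambda>a b c d. wronskian_coeff 2 [c, d, 0] * wronskian_coeff 2 [a, b, c + d - 3]"
  have sum_3: "\<Sum>{0..2::nat} = 3" by (simp add: numeral_2_eq_2)
  have insert: "{1..2 * 2} = insert 1 (insert 2 (insert 3 {4 :: nat}))" by auto
  have "(\<Sum>i\<in>{1..2 * 2}. ?e i) + ?e (2 * 2 + 1) = 2 * \<Sum>{0..2}" unfolding insert sum_3 by simp
  from left_commutative_imp_dvd[OF lc p this]
  have "int p dvd (\<Sum>\<sigma> | \<sigma> permutes {1..2 * 2}. sign \<sigma> *
      ?f (?e (\<sigma> 1)) (?e (\<sigma> 2)) (?e (\<sigma> 3)) (?e (\<sigma> 4)))"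
    unfolding sum_3 by (simp add: upt_rec numeral_2_eq_2[symmetric])
  also have "\<dots> =
      ?f 0 1 2 3 - ?f 0 1 3 2 - ?f 0 2 1 3 + ?f 0 2 3 1 + ?f 0 3 1 2 - ?f 0 3 2 1 -
      ?f 1 0 2 3 + ?f 1 0 3 2 + ?f 1 2 0 3 - ?f 1 2 3 0 - ?f 1 3 0 2 + ?f 1 3 2 0 +
      ?f 2 0 1 3 - ?f 2 0 3 1 - ?f 2 1 0 3 + ?f 2 1 3 0 + ?f 2 3 0 1 - ?f 2 3 1 0 -
      ?f 3 0 1 2 + ?f 3 0 2 1 + ?f 3 1 0 2 - ?f 3 1 2 0 - ?f 3 2 0 1 + ?f 3 2 1 0"
    unfolding insert by (simp add: signed_int_sum_permutations_insert)
  also have "\<dots> = 8" unfolding wronskian_coeff_2 by code_simp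
  finally show ?thesis .
qed

lemma left_commutative_wronskian_imp:
  assumes lc: "left_commutative U k (wronskian U D k)" and p: "has_characteristic K p" "prime p \<or> p = 0"
  shows "k \<noteq> 1 \<and> (k \<noteq> 2 \<or> p = 2)"
proof (intro conjI disj_imp[THEN iffD2] notI impI)
  assume "k = 1"
  then show False using left_commutative_1_imp_dvd_1[OF _ p(1)] lc p(2) by auto
next
  assume "\<not> k \<noteq> 2"
  then have "int p dvd int (2 ^ 3)" using left_commutative_2_imp_dvd_8[OF _ p(1)] lc by simp
  then have "p dvd 2 ^ 3" by (simp only: int_dvd_int_iff)
  moreover from this have "prime p" using p(2) by auto
  ultimately show "p = 2" by (metis prime_dvd_power primes_dvd_imp_eq two_is_prime_nat)
qed

end

lemma (in field) has_characteristic_prime: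
  assumes "has_characteristic R p"
  shows "prime p \<or> p = 0"
proof (rule disjCI)
  assume "p \<noteq> 0"
  have zero_iff: "[m] \<cdot> \<one> = \<zero> \<longleftrightarrow> p dvd m" for m :: nat
    using assms by (simp add: has_characteristic_def)
  show "prime p"
  unfolding prime_def
  proof (intro conjI prime_elemI)
    show "p \<noteq> 0" by fact
    show "\<not> p dvd 1" using zero_iff[of 1] by simp
    fix m n assume "p dvd m * n"
    have "([m] \<cdot> \<one>) \<otimes> ([n] \<cdot> \<one>) = [m] \<cdot> (\<one> \<otimes> ([n] \<cdot> \<one>))" by (rule add_pow_ldistr) auto
    also have "\<dots> = [(m * n)] \<cdot> \<one>" by (simp add: add.nat_pow_pow mult.commute)
    also have "\<dots> = \<zero>" using \<open>p dvd m * n\<close> by (simp only: zero_iff)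
    finally have "[m] \<cdot> \<one> = \<zero> \<or> [n] \<cdot> \<one> = \<zero>" by (intro integral) auto
    then show "p dvd m \<or> p dvd n" by (simp only: zero_iff)
  qed simp
qed

lemma left_commutative_wronskian_iff:
  fixes K :: "('k, 'm) ring_scheme"
  assumes "field K" and p: "has_characteristic K p" and "large_universe TYPE('k) TYPE('u)" and k: "k > 0"
  shows "(\<forall>(U :: ('k, 'u) module) D. differential_algebra K U D \<longrightarrow> left_commutative U k (wronskian U D k)) \<longleftrightarrow>
    k \<noteq> 1 \<and> (k \<noteq> 2 \<or> p = 2)"
    (is "?lc \<longleftrightarrow> ?cond")
proof
  interpret field K by fact
  assume ?lc
  obtain U :: "('k, 'u) module" and D x where "divided_powers K U D x"
    using ex_divided_powers assms(3) by blast
  then interpret divided_powers K U D x .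
  show ?cond
    using \<open>?lc\<close> differential_algebra_axioms
      left_commutative_wronskian_imp[OF _ p has_characteristic_prime[OF p]]
    by blast
next
  assume ?cond
  then show ?lc using differential_algebra.left_commutative_wronskian_if[OF _ p k] by blast
qed

lemma n_lie_wronskian_iff:
  fixes K :: "('k, 'm) ring_scheme"
  assumes "field K" and p: "has_characteristic K p" and "large_universe TYPE('k) TYPE('u)" and k: "k > 0"
  shows "(\<forall>(U :: ('k, 'u) module) D. differential_algebra K U D \<longrightarrow> n_lie K U (k + 1) (wronskian U D k)) \<longleftrightarrow>
    k = 1 \<or> k = 2 \<and> p = 2 \<or> k = 3 \<and> p = 3 \<or> k = 4 \<and> p = 2"
    (is "?lie \<longleftrightarrow> ?cond")
proof
  interpret field K by fact
  assume ?lie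
  obtain U :: "('k, 'u) module" and D x where "divided_powers K U D x"
    using ex_divided_powers assms(3) by blast
  then interpret divided_powers K U D x .
  show ?cond
    using \<open>?lie\<close> differential_algebra_axioms n_lie_wronskian_imp[OF _ p has_characteristic_prime[OF p] k]
    by blast
next
  assume ?cond
  then show ?lie using differential_algebra.n_lie_wronskian_if[OF _ p] by blast
qed

theorem theorem1p1:
  fixes K :: "('k, 'm) ring_scheme" and p :: nat
  assumes "field K" and "has_characteristic K p"
  shows
    "(\<forall>(U :: ('k, 'u) module) D. differential_algebra K U D \<longrightarrow>
        (\<forall>k>0. homotopical_n_lie K U (k + 1) (wronskian U D k)) \<and>
        (\<forall>l\<in>{2..} \<rightarrow> carrier K.
          homotopical_lie K U
            (\<lambda>i us. if i \<le> 1 then \<zero>\<^bsub>U\<^esub> else l i \<odot>\<^bsub>U\<^esub> wronskian U D (i - 1) us)))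
     \<and>
     (\<forall>k>0.
        (k \<noteq> 1 \<and> (k \<noteq> 2 \<or> p = 2) \<longrightarrow>
          (\<forall>(U :: ('k, 'u) module) D. differential_algebra K U D \<longrightarrow>
             left_commutative U k (wronskian U D k))) \<and>
        (large_universe TYPE('k) TYPE('u) \<longrightarrow>
          ((\<forall>(U :: ('k, 'u) module) D. differential_algebra K U D \<longrightarrow>
             left_commutative U k (wronskian U D k))
           \<longleftrightarrow> k \<noteq> 1 \<and> (k \<noteq> 2 \<or> p = 2))))
     \<and>
     (\<forall>k>0.
        (k = 1 \<and> (prime p \<or> p = 0) \<or> k = 2 \<and> p = 2 \<or> k = 3 \<and> p = 3 \<or> k = 4 \<and> p = 2 \<longrightarrow>
          (\<forall>(U :: ('k, 'u) module) D. differential_algebra K U D \<longrightarrow>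
             n_lie K U (k + 1) (wronskian U D k))) \<and>
        (large_universe TYPE('k) TYPE('u) \<longrightarrow>
          ((\<forall>(U :: ('k, 'u) module) D. differential_algebra K U D \<longrightarrow>
             n_lie K U (k + 1) (wronskian U D k))
           \<longleftrightarrow> k = 1 \<and> (prime p \<or> p = 0) \<or> k = 2 \<and> p = 2 \<or> k = 3 \<and> p = 3 \<or> k = 4 \<and> p = 2)))"
proof (intro conjI allI impI ballI)
  fix U :: "('k, 'u) module" and D assume "differential_algebra K U D"
  then interpret differential_algebra K U D .
  show "homotopical_n_lie K U (k + 1) (wronskian U D k)" if "k > 0" for k
    using that by (rule homotopical_n_lie_wronskian)
  show "homotopical_lie K U (\<lambda>i us. if i \<le> 1 then \<zero>\<^bsub>U\<^esub> else l i \<odot>\<^bsub>U\<^esub> wronskian U D (i - 1) us)"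
    if "l \<in> {2..} \<rightarrow> carrier K" for l
    using that by (rule homotopical_lie_wronskian)
  show "left_commutative U k (wronskian U D k)" if "k > 0" "k \<noteq> 1 \<and> (k \<noteq> 2 \<or> p = 2)" for k
    using left_commutative_wronskian_if[OF assms(2)] that by blast
  show "n_lie K U (k + 1) (wronskian U D k)"
    if "k = 1 \<and> (prime p \<or> p = 0) \<or> k = 2 \<and> p = 2 \<or> k = 3 \<and> p = 3 \<or> k = 4 \<and> p = 2" for k
    using n_lie_wronskian_if[OF assms(2)] that by blast
next
  fix k :: nat assume k: "k > 0" and large: "large_universe TYPE('k) TYPE('u)"
  show "(\<forall>(U :: ('k, 'u) module) D. differential_algebra K U D \<longrightarrow> left_commutative U k (wronskian U D k))
      \<longleftrightarrow> k \<noteq> 1 \<and> (k \<noteq> 2 \<or> p = 2)"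
    by (rule left_commutative_wronskian_iff[OF assms large k])
  show "(\<forall>(U :: ('k, 'u) module) D. differential_algebra K U D \<longrightarrow> n_lie K U (k + 1) (wronskian U D k))
      \<longleftrightarrow> k = 1 \<and> (prime p \<or> p = 0) \<or> k = 2 \<and> p = 2 \<or> k = 3 \<and> p = 3 \<or> k = 4 \<and> p = 2"
    using n_lie_wronskian_iff[OF assms large k] field.has_characteristic_prime[OF assms] by simp
qed

end
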